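(* Let $(F,\partial)$, $W$, $\tau$, $W_0$, $P=(P_0,P_1)$ be as in the context, write $W_e=W_\partial$, let $\mathbf{x}=(x_1,\dots,x_l)$ be the vector of coordinate functions on $W_e$, and put $\delta=P_1^{\partial}\langle\mathbf{x}\rangle^{-1}\partial$. Then the field $C\langle W_e;\partial\rangle^G$ of $G$-invariant differential rational functions on $W_e$ is invariant with respect to the commuting system of differential operators $\delta^1,\dots,\delta^m$, and as such a $\delta$-differential field it is generated over $C$ by the components of $\tau^{\partial}\langle P^{\partial}\langle\mathbf{x}\rangle;\mathbf{x}\rangle$, that is $$C\langle W_e;\partial\rangle^G=C\langle\tau^{\partial}\langle P^{\partial}\langle\mathbf{x}\rangle;\mathbf{x}\rangle;\delta\rangle .$$
   Context: Fix natural numbers $l,m,n$. $(F,\partial)$ is a differentially algebraically closed field of characteristic zero with commuting derivations $\partial^1,\dots,\partial^m$ which are linearly independent over $F$; $\partial$ also denotes the column with entries $\partial^1,\dots,\partial^m$; $C=\{a\in F:\partial^1a=\dots=\partial^ma=0\}$ is the constant field. For a column $\delta=(\delta^1,\dots,\delta^m)^t$ of commuting derivations put $GL^{\delta}(m,F)=\{g=(g^i_j)\in GL(m,F): \delta^i g^j_k=\delta^j g^i_k \text{ for all } i,j,k\}$, where $g^i_j$ is the entry in row $i$, column $j$. For an invertible matrix $g$, $g^{-1}\delta$ is the column obtained by matrix multiplication. $\mathbf{B}=\{g^{-1}\partial: g\in GL^{\partial}(m,F)\}$; for $\delta=g^{-1}\partial\in \mathbf{B}$ the $\delta^i$ commute,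 have the same constant field $C$, and $GL^{\delta}(m,F)=g^{-1}GL^{\partial}(m,F)$. For each $\delta\in\mathbf{B}$ let $W_\delta\subset F^l$ be a closed irreducible subset in the $\delta$-differential Zariski topology, and $W=\bigcup_{\delta\in\mathbf{B}}(\delta,W_\delta)$. An action is given: for each $\delta\in\mathbf{B}$, $(h,g)\in GL(n,F)\times GL^{\delta}(m,F)$, $v\in W_\delta$, an element $\tau^{\delta}\langle h,g;v\rangle\in W_{g^{-1}\delta}$, such that $\tau^{\delta}\langle I_n,I_m;v\rangle=v$ and $\tau^{g^{-1}\delta}\langle h_1,g_1;\tau^{\delta}\langle h,g;v\rangle\rangle=\tau^{\delta}\langle hh_1,gg_1;v\rangle$ for all $h,h_1\in GL(n,F)$, $g\in GL^{\delta}(m,F)$, $g_1\in GL^{g^{-1}\delta}(m,F)$, $v\in W_\delta$. The components of $\tau^\delta$ are $\delta$-differential rational functions over $C$ in the components of $h,g,v$, given by expressions that do not depend on $\delta$ except that the derivations used are $\delta^1,\dots,\delta^m$. $W_0=\bigcup_{\delta}(\delta,W_{0\delta})\subset W$ is a nonempty $G$-invariant subset ($\tau^\delta\langle h,g;v\rangle\in W_{0\,g^{-1}\delta}$ whenever $v\in W_{0\delta}$, $(h,g)\in GL(n,F)\times GL^\delta(m,F)$), with $W_{0\delta}$ dense in $W_\delta$. There is given a family of maps $P^{\delta}=(P_0^\delta,P_1^\delta):W_{0\delta}\to GL(n,F)\times GL^{\delta}(m,F)$, $\delta\in\mathbf{B}$, with $$P_0^{g^{-1}\delta}\langle\tau^{\delta}\langle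 h,g;\mathbf{v}\rangle\rangle=h^{-1}P_0^{\delta}\langle\mathbf{v}\rangle,\qquad P_1^{g^{-1}\delta}\langle\tau^{\delta}\langle h,g;\mathbf{v}\rangle\rangle=g^{-1}P_1^{\delta}\langle\mathbf{v}\rangle$$ for all $\delta\in\mathbf{B}$, $\mathbf{v}\in W_{0\delta}$, $(h,g)\in GL(n,F)\times GL^{\delta}(m,F)$, the components of $P^\delta\langle\mathbf{v}\rangle$ being $\delta$-differential rational functions of $\mathbf{v}$ over $C$, given by expressions independent of $\delta$ in the same sense. $\tau^{\partial}\langle P^{\partial}\langle\mathbf{x}\rangle;\mathbf{x}\rangle$ means $\tau^{\partial}\langle P_0^{\partial}\langle\mathbf{x}\rangle,P_1^{\partial}\langle\mathbf{x}\rangle;\mathbf{x}\rangle$. $C\langle W_e;\partial\rangle$ is the field of $\partial$-differential rational functions on $W_e=W_\partial$ with coefficients in $C$. $C\langle W\rangle$ is the field of families $(f^\delta)_{\delta\in\mathbf{B}}$ of differential rational functions, $f^\delta$ on $W_\delta$, obtained from one differential rational expression $f^\partial$ over $C$ by replacing $\partial$ with $\delta$. Such a family is $G$-invariant if $f^{g^{-1}\delta}\langle\tau^\delta\langle h,g;\mathbf{v}\rangle\rangle=f^\delta\langle\mathbf{v}\rangle$ for all $\delta\in\mathbf{B}$, $(h,g,\mathbf{v})\in GL(n,F)\times GL^\delta(m,F)\times W_\delta$ (where defined); it is determined by $f^\partial$, and $C\langle W_e;\partial\rangle^G\subset C\langle W_e;\partial\rangle$ is the field of the functions $f^\partial$ of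 $G$-invariant families. For a set $S$ of elements and a system of derivations $\delta$, $C\langle S;\delta\rangle$ is the $\delta$-differential field generated by $S$ over $C$. *)

theory Defs
  imports "HOL-Analysis.Analysis" "HOL-Algebra.Subrings" "HOL-Algebra.Algebraic_Closure_Type"
begin

section \<open>Columns of derivations\<close>

text \<open>
  A system of derivations is a column \<open>\<delta> :: ('a \<Rightarrow> 'a) ^ 'm\<close>. Matrices are of type
  \<open>'a ^ 'k ^ 'k\<close>, and \<open>g $ i $ j\<close> is the entry of \<open>g\<close> in row \<open>i\<close> and column \<open>j\<close>.
\<close>

type_synonym ('a, 'm) der_col = "('a \<Rightarrow> 'a) ^ 'm"

definition derivation :: "('a::field \<Rightarrow> 'a) \<Rightarrow> bool" where
  "derivation d \<longleftrightarrow> (\<forall>a b. d (a + b) = d a + d b) \<and> (\<forall>a b. d (a * b) = d a * b + a * d b)"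

definition commuting_derivations :: "('a::field, 'm::finite) der_col \<Rightarrow> bool" where
  "commuting_derivations D \<longleftrightarrow>
     (\<forall>i. derivation (D $ i)) \<and> (\<forall>i j a. (D $ i) ((D $ j) a) = (D $ j) ((D $ i) a))"

definition lin_indep_derivations :: "('a::field, 'm::finite) der_col \<Rightarrow> bool" where
  "lin_indep_derivations D \<longleftrightarrow>
     (\<forall>c :: 'm \<Rightarrow> 'a. (\<forall>a. (\<Sum>i\<in>UNIV. c i * (D $ i) a) = 0) \<longrightarrow> (\<forall>i. c i = 0))"

definition constants :: "('a::field, 'm::finite) der_col \<Rightarrow> 'a set" where
  "constants D = {a. \<forall>i. (D $ i) a = 0}"

definition mat_der :: "'a::field ^ 'm ^ 'm \<Rightarrow> ('a, 'm::finite) der_col \<Rightarrow> ('a, 'm) der_col"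
    (infixr \<open>**\<^sub>d\<close> 75) where
  "g **\<^sub>d \<delta> = (\<chi> i. (\<lambda>a. \<Sum>j\<in>UNIV. g $ i $ j * (\<delta> $ j) a))"

definition GL :: "('a::field ^ 'k ^ 'k) set" where
  "GL = {h. invertible h}"

definition GLd :: "('a::field, 'm::finite) der_col \<Rightarrow> ('a ^ 'm ^ 'm) set" where
  "GLd \<delta> = {g \<in> GL. \<forall>i j k. (\<delta> $ i) (g $ j $ k) = (\<delta> $ j) (g $ i $ k)}"

text \<open>The set \<open>\<^bold>B\<close> of all columns \<open>g\<^sup>-\<^sup>1 \<partial>\<close> with \<open>g \<in> GL\<^sup>\<partial>(m, F)\<close>.\<close>

definition frames :: "('a::field, 'm::finite) der_col \<Rightarrow> ('a, 'm) der_col set" where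
  "frames D = {matrix_inv g **\<^sub>d D | g. g \<in> GLd D}"


section \<open>Differential polynomials\<close>

text \<open>
  Differential polynomials are written as expressions in coefficients, differential unknowns
  indexed by \<open>'v\<close>, and symbols for the derivations indexed by \<open>'m\<close>. The system of derivations
  is an argument of the evaluation, so one expression can be read with \<open>\<partial>\<close> replaced by any \<open>\<delta>\<close>.
  Different expressions may denote the same differential polynomial; they are only
  used through their values.
\<close>

datatype (dcoeffs: 'a, 'm, 'v) dpoly =
    Const 'a
  | Var 'v
  | Add "('a, 'm, 'v) dpoly" "('a, 'm, 'v) dpoly"
  | Mul "('a, 'm, 'v) dpoly" "('a, 'm, 'v) dpoly"
  | Der 'm "('a, 'm, 'v) dpoly"

primrec deval ::
  "('a::field, 'm::finite) der_col \<Rightarrow> ('a, 'm, 'v) dpoly \<Rightarrow> ('v \<Rightarrow> 'a) \<Rightarrow> 'a" where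
  "deval \<delta> (Const c) u = c"
| "deval \<delta> (Var x) u = u x"
| "deval \<delta> (Add p q) u = deval \<delta> p u + deval \<delta> q u"
| "deval \<delta> (Mul p q) u = deval \<delta> p u * deval \<delta> q u"
| "deval \<delta> (Der i p) u = (\<delta> $ i) (deval \<delta> p u)"

text \<open>A fraction \<open>(p, q)\<close> stands for the differential rational expression \<open>p / q\<close>.\<close>

type_synonym ('a, 'm, 'v) dfrac = "('a, 'm, 'v) dpoly \<times> ('a, 'm, 'v) dpoly"


section \<open>Differentially closed fields\<close>

text \<open>Evaluation in a differential extension \<open>(L, d)\<close> of the field of coefficients, along the
  embedding \<open>\<sigma>\<close>.\<close>

primrec deval_ext ::
  "('b, 'c) ring_scheme \<Rightarrow> ('m \<Rightarrow> 'b \<Rightarrow> 'b) \<Rightarrow> ('a \<Rightarrow> 'b) \<Rightarrow> ('a, 'm, 'v) dpoly \<Rightarrow> ('v \<Rightarrow> 'b) \<Rightarrow> 'b"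
where
  "deval_ext L d \<sigma> (Const c) u = \<sigma> c"
| "deval_ext L d \<sigma> (Var x) u = u x"
| "deval_ext L d \<sigma> (Add p q) u = deval_ext L d \<sigma> p u \<oplus>\<^bsub>L\<^esub> deval_ext L d \<sigma> q u"
| "deval_ext L d \<sigma> (Mul p q) u = deval_ext L d \<sigma> p u \<otimes>\<^bsub>L\<^esub> deval_ext L d \<sigma> q u"
| "deval_ext L d \<sigma> (Der i p) u = d i (deval_ext L d \<sigma> p u)"

definition diff_extension ::
  "('a::field, 'm::finite) der_col \<Rightarrow> ('b, 'c) ring_scheme \<Rightarrow> ('m \<Rightarrow> 'b \<Rightarrow> 'b) \<Rightarrow> ('a \<Rightarrow> 'b) \<Rightarrow> bool"
where
  "diff_extension D L d \<sigma> \<longleftrightarrow>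
     Ring.field L \<and> \<sigma> \<in> ring_hom ring_of_type_algebra L \<and>
     (\<forall>i. \<forall>x\<in>carrier L. d i x \<in> carrier L) \<and>
     (\<forall>i. \<forall>x\<in>carrier L. \<forall>y\<in>carrier L. d i (x \<oplus>\<^bsub>L\<^esub> y) = d i x \<oplus>\<^bsub>L\<^esub> d i y) \<and>
     (\<forall>i. \<forall>x\<in>carrier L. \<forall>y\<in>carrier L.
        d i (x \<otimes>\<^bsub>L\<^esub> y) = (d i x \<otimes>\<^bsub>L\<^esub> y) \<oplus>\<^bsub>L\<^esub> (x \<otimes>\<^bsub>L\<^esub> d i y)) \<and>
     (\<forall>i j. \<forall>x\<in>carrier L. d i (d j x) = d j (d i x)) \<and>
     (\<forall>i a. d i (\<sigma> a) = \<sigma> ((D $ i) a))"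

text \<open>
  Every finite system of differential equations and inequations over \<open>F\<close> that is solvable in a
  differential extension of \<open>F\<close> is solvable in \<open>F\<close>. HOL cannot quantify over all types inside a
  formula, so the extensions have carriers in the fixed type of sets of fractions. This is no
  restriction: a solution generates a differential extension that is the fraction field of
  a residue ring of a ring of differential polynomials over \<open>F\<close>, and its elements are
  classes of fractions.
\<close>

definition diff_closed :: "('a::field, 'm::finite) der_col \<Rightarrow> bool" where
  "diff_closed D \<longleftrightarrow>
     (\<forall>(L :: ('a, 'm, nat) dfrac set ring) d \<sigma> (S :: ('a, 'm, nat) dpoly set) T.
        diff_extension D L d \<sigma> \<and> finite S \<and> finite T \<and>
        (\<exists>u. (\<forall>k. u k \<in> carrier L) \<and>
             (\<forall>p\<in>S. deval_ext L d \<sigma> p u = \<zero>\<^bsub>L\<^esub>) \<and> (\<forall>q\<in>T. deval_ext L d \<sigma> q u \<noteq> \<zero>\<^bsub>L\<^esub>))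
        \<longrightarrow> (\<exists>u. (\<forall>p\<in>S. deval D p u = 0) \<and> (\<forall>q\<in>T. deval D q u \<noteq> 0)))"


section \<open>Differential Zariski topology\<close>

definition kolchin_topology :: "('a::field, 'm::finite) der_col \<Rightarrow> ('a ^ 'l) topology" where
  "kolchin_topology \<delta> = topology_generated_by {{v. deval \<delta> p (($) v) \<noteq> 0} | p. True}"

definition irreducible_in :: "'b topology \<Rightarrow> 'b set \<Rightarrow> bool" where
  "irreducible_in T S \<longleftrightarrow> S \<subseteq> topspace T \<and> S \<noteq> {} \<and>
     (\<forall>A B. closedin T A \<and> closedin T B \<and> S \<subseteq> A \<union> B \<longrightarrow> S \<subseteq> A \<or> S \<subseteq> B)"


section \<open>Differential rational functions\<close>

text \<open>
  The family \<open>f \<delta>\<close>, \<open>\<delta> \<in> \<^bold>B\<close>, of functions on the sets \<open>Z \<delta>\<close> is given by one differential rational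
  expression over the constants of \<open>D\<close>, read with the derivations \<open>\<delta>\<close>; \<open>crd u\<close> lists the
  coordinates of a point \<open>u\<close>.
\<close>

definition uniform_rational ::
  "('a::field, 'm::finite) der_col \<Rightarrow> (('a, 'm) der_col \<Rightarrow> 'u set) \<Rightarrow> ('u \<Rightarrow> 'v \<Rightarrow> 'a) \<Rightarrow>
   (('a, 'm) der_col \<Rightarrow> 'u \<Rightarrow> 'a) \<Rightarrow> bool"
where
  "uniform_rational D Z crd f \<longleftrightarrow>
     (\<exists>p q. dcoeffs p \<subseteq> constants D \<and> dcoeffs q \<subseteq> constants D \<and>
        (\<forall>\<delta>\<in>frames D. \<forall>u\<in>Z \<delta>. deval \<delta> q (crd u) \<noteq> 0 \<and>
           f \<delta> u = deval \<delta> p (crd u) / deval \<delta> q (crd u)))"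

fun crd_hgv :: "('a ^ 'n ^ 'n) \<times> ('a ^ 'm ^ 'm) \<times> ('a ^ 'l) \<Rightarrow> ('n \<times> 'n) + ('m \<times> 'm) + 'l \<Rightarrow> 'a" where
  "crd_hgv (h, g, v) (Inl (i, j)) = h $ i $ j"
| "crd_hgv (h, g, v) (Inr (Inl (i, j))) = g $ i $ j"
| "crd_hgv (h, g, v) (Inr (Inr k)) = v $ k"

text \<open>
  The field \<open>C\<langle>W; \<partial>\<rangle>\<close> for irreducible \<open>W\<close>: fractions over \<open>C\<close> whose denominator does not vanish
  identically on \<open>W\<close>, modulo equality on \<open>W\<close>.
\<close>

definition dfracs :: "('a::field, 'm::finite) der_col \<Rightarrow> ('a ^ 'l) set \<Rightarrow> ('a, 'm, 'l) dfrac set" where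
  "dfracs D W = {(p, q). dcoeffs p \<subseteq> constants D \<and> dcoeffs q \<subseteq> constants D \<and>
     (\<exists>v\<in>W. deval D q (($) v) \<noteq> 0)}"

definition dfrac_rel ::
  "('a::field, 'm::finite) der_col \<Rightarrow> ('a ^ 'l) set \<Rightarrow> (('a, 'm, 'l) dfrac \<times> ('a, 'm, 'l) dfrac) set"
where
  "dfrac_rel D W = {((p, q), (p', q')). (p, q) \<in> dfracs D W \<and> (p', q') \<in> dfracs D W \<and>
     (\<forall>v\<in>W. deval D p (($) v) * deval D q' (($) v) = deval D p' (($) v) * deval D q (($) v))}"

definition ratfun_class ::
  "('a::field, 'm::finite) der_col \<Rightarrow> ('a ^ 'l) set \<Rightarrow> ('a, 'm, 'l) dfrac \<Rightarrow> ('a, 'm, 'l) dfrac set"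
where
  "ratfun_class D W r = dfrac_rel D W `` {r}"

definition ratfun_field ::
  "('a::field, 'm::finite) der_col \<Rightarrow> ('a ^ 'l) set \<Rightarrow> ('a, 'm, 'l) dfrac set ring"
where
  "ratfun_field D W = \<lparr>
     carrier = dfracs D W // dfrac_rel D W,
     monoid.mult = (\<lambda>A B. \<Union>(p, q)\<in>A. \<Union>(p', q')\<in>B. ratfun_class D W (Mul p p', Mul q q')),
     one = ratfun_class D W (Const 1, Const 1),
     ring.zero = ratfun_class D W (Const 0, Const 1),
     add = (\<lambda>A B. \<Union>(p, q)\<in>A. \<Union>(p', q')\<in>B.
              ratfun_class D W (Add (Mul p q') (Mul p' q), Mul q q')) \<rparr>"

text \<open>The quotient rule \<open>\<partial>\<^sup>i(p / q) = (\<partial>\<^sup>ip q - p \<partial>\<^sup>iq) / q\<^sup>2\<close>.\<close>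

definition ratfun_der ::
  "('a::field, 'm::finite) der_col \<Rightarrow> ('a ^ 'l) set \<Rightarrow> 'm \<Rightarrow> ('a, 'm, 'l) dfrac set \<Rightarrow>
   ('a, 'm, 'l) dfrac set"
where
  "ratfun_der D W i A = (\<Union>(p, q)\<in>A. ratfun_class D W
     (Add (Mul (Der i p) q) (Mul (Const (- 1)) (Mul p (Der i q))), Mul q q))"

definition ratfun_consts ::
  "('a::field, 'm::finite) der_col \<Rightarrow> ('a ^ 'l) set \<Rightarrow> ('a, 'm, 'l) dfrac set set"
where
  "ratfun_consts D W = {ratfun_class D W (Const c, Const 1) | c. c \<in> constants D}"

text \<open>
  The element of \<open>C\<langle>W; \<partial>\<rangle>\<close> represented by a function \<open>f\<close> on a dense subset \<open>W0\<close> of \<open>W\<close>: all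
  fractions that agree with \<open>f\<close> on \<open>W0\<close> wherever their denominator does not vanish.
  It is a full equivalence class whenever \<open>f\<close> is given on \<open>W0\<close> by a fraction over \<open>C\<close>
  whose denominator has no zero there.
\<close>

definition ratfun_of ::
  "('a::field, 'm::finite) der_col \<Rightarrow> ('a ^ 'l) set \<Rightarrow> ('a ^ 'l) set \<Rightarrow> ('a ^ 'l \<Rightarrow> 'a) \<Rightarrow>
   ('a, 'm, 'l) dfrac set"
where
  "ratfun_of D W W0 f = {(p, q). (p, q) \<in> dfracs D W \<and>
     (\<forall>v\<in>W0. deval D q (($) v) \<noteq> 0 \<longrightarrow> f v = deval D p (($) v) / deval D q (($) v))}"

text \<open>The operator \<open>\<delta>\<^sup>i = \<Sum>\<^sub>j q\<^sub>i\<^sub>j \<partial>\<^sup>j\<close> on \<open>C\<langle>W; \<partial>\<rangle>\<close> for a matrix \<open>q\<close> over that field.\<close>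

definition ratfun_mat_der ::
  "('a::field, 'm::finite) der_col \<Rightarrow> ('a ^ 'l) set \<Rightarrow> ('m \<Rightarrow> 'm \<Rightarrow> ('a, 'm, 'l) dfrac set) \<Rightarrow>
   'm \<Rightarrow> ('a, 'm, 'l) dfrac set \<Rightarrow> ('a, 'm, 'l) dfrac set"
where
  "ratfun_mat_der D W q i f =
     (\<Oplus>\<^bsub>ratfun_field D W\<^esub>j\<in>UNIV. q i j \<otimes>\<^bsub>ratfun_field D W\<^esub> ratfun_der D W j f)"

text \<open>
  The functions \<open>f\<^sup>\<partial>\<close> of the \<open>G\<close>-invariant families \<open>(f\<^sup>\<delta>)\<close>. A family is given by one fraction
  \<open>(p, q)\<close> over \<open>C\<close>, read with \<open>\<delta>\<close> on \<open>W \<delta>\<close>, and \<open>f\<^sup>\<delta>\<close> has to exist for every \<open>\<delta> \<in> \<^bold>B\<close>.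
\<close>

definition invariant_ratfuns ::
  "('a::field, 'm::finite) der_col \<Rightarrow> (('a, 'm) der_col \<Rightarrow> ('a ^ 'l) set) \<Rightarrow>
   (('a, 'm) der_col \<Rightarrow> 'a ^ 'n ^ 'n \<Rightarrow> 'a ^ 'm ^ 'm \<Rightarrow> 'a ^ 'l \<Rightarrow> 'a ^ 'l) \<Rightarrow>
   ('a, 'm, 'l) dfrac set set"
where
  "invariant_ratfuns D W \<tau> = {ratfun_class D (W D) (p, q) | p q.
     dcoeffs p \<subseteq> constants D \<and> dcoeffs q \<subseteq> constants D \<and>
     (\<forall>\<delta>\<in>frames D. \<exists>v\<in>W \<delta>. deval \<delta> q (($) v) \<noteq> 0) \<and>
     (\<forall>\<delta>\<in>frames D. \<forall>h\<in>GL. \<forall>g\<in>GLd \<delta>. \<forall>v\<in>W \<delta>.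
        let \<delta>' = matrix_inv g **\<^sub>d \<delta>; v' = \<tau> \<delta> h g v in
        deval \<delta> q (($) v) \<noteq> 0 \<and> deval \<delta>' q (($) v') \<noteq> 0 \<longrightarrow>
        deval \<delta>' p (($) v') / deval \<delta>' q (($) v') = deval \<delta> p (($) v) / deval \<delta> q (($) v))}"

text \<open>The \<open>d\<close>-differential subfield of \<open>K\<close> generated over \<open>C\<close> by \<open>S\<close>.\<close>

definition diff_field_gen ::
  "('b, 'c) ring_scheme \<Rightarrow> ('m \<Rightarrow> 'b \<Rightarrow> 'b) \<Rightarrow> 'b set \<Rightarrow> 'b set \<Rightarrow> 'b set" where
  "diff_field_gen K d C S =
     \<Inter>{E. subfield E K \<and> C \<subseteq> E \<and> S \<subseteq> E \<and> (\<forall>i. \<forall>f\<in>E. d i f \<in> E)}"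

end

theory Submission
  imports Defs
begin

text \<open>
  Elements of \<open>C\<langle>W\<^sub>e; \<partial>\<rangle>\<close> are handled through their values at the points of a Kolchin dense subset
  of \<open>W\<^sub>0\<close>, where \<open>\<delta>\<close> acts by the frame \<open>P\<^sub>1(v)\<^sup>-\<^sup>1 \<partial>\<close>. This frame and the point \<open>y(v) = \<tau>\<langle>P(v); v\<rangle>\<close> depend only
  on the orbit of \<open>v\<close>, so \<open>\<delta>\<close> preserves the invariants and the components of \<open>y\<close> are invariant.

  Conversely, an invariant \<open>f = p / q\<close> satisfies \<open>f(v) q(\<tau>\<langle>h, g; y(v)\<rangle>) = p(\<tau>\<langle>h, g; y(v)\<rangle>)\<close> for all \<open>h\<close>
  and \<open>g\<close>. Setting \<open>h = 1\<close>, \<open>g = 1\<close> would express \<open>f\<close> by \<open>y\<close>, but \<open>q\<close> may vanish at all \<open>y(v)\<close>.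
  Instead both sides are regarded as polynomials in the \<open>\<delta>\<close>-jets of \<open>(h, g)\<close> with coefficients
  in \<open>C\<langle>y; \<delta>\<rangle>\<close>. The jets of \<open>h\<close> and of a closed matrix \<open>g\<close> are independent, since commuting derivations that
  are linearly independent over \<open>F\<close> have linearly independent iterates; hence the identity may be
  differentiated with respect to the jets until the denominator is free of \<open>h\<close> and \<open>g\<close>.
\<close>

text \<open>Every identity is tested in F, at one fixed v and with h, g over F. The test points lie
  on lines h + t \<eta>, g + t \<gamma> with t a natural number. Such t are constants, so g stays
  closed and all jets are affine in t; determinants exclude finitely many t, and characteristic zero
  leaves infinitely many. Hence a polynomial vanishing on all jets has zero derivative in every
  direction (\<eta>, \<gamma>).

  A direction \<eta> with a single entry a, or \<gamma> with one column equal to the gradient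
  \<open>\<delta>\<^sup>j a\<close>, has the jets \<open>\<delta>\<^sup>B a\<close>, whose
  independence isolates each partial derivative. A column of a closed matrix behaves like a
  gradient: the coordinates \<open>Inr (k, G)\<close> are the derivatives of a formal potential, and
  the dummy \<open>G = {#}\<close> stands in the place of the potential itself.

  The denominator in the jets does not vanish identically, because the pair of inverses of
  \<open>P0\<close> and \<open>P1\<close> at v carries y(v) back to v. All coefficients stay
  functions without poles on W0; a division in the field takes place only at the very end.\<close>

no_notation fps_nth (infixl \<open>$\<close> 75)

section \<open>Derivations\<close>

lemma derivation_add: "derivation d \<Longrightarrow> d (a + b) = d a + d b"
  and derivation_mult: "derivation d \<Longrightarrow> d (a * b) = d a * b + a * d b"
  by (auto simp: derivation_def)

lemma derivation_zero: "derivation d \<Longrightarrow> d 0 = 0"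
  by (metis add_cancel_left_right derivation_add)

lemma derivation_one: "derivation d \<Longrightarrow> d 1 = 0"
  by (metis add_cancel_left_right derivation_mult mult_1_left mult_1_right)

lemma derivation_uminus: "derivation d \<Longrightarrow> d (- a) = - d a"
  using derivation_add[of d a "- a"] derivation_zero[of d] by (simp add: eq_neg_iff_add_eq_0 add.commute)

lemma derivation_diff: "derivation d \<Longrightarrow> d (a - b) = d a - d b"
  using derivation_add[of d a "- b"] by (simp add: derivation_uminus)

lemma derivation_sum: "derivation d \<Longrightarrow> d (sum f A) = (\<Sum>x\<in>A. d (f x))"
  by (induction A rule: infinite_finite_induct) (auto simp: derivation_zero derivation_add)

lemma derivation_of_nat: "derivation d \<Longrightarrow> d (of_nat n) = 0"
  by (induction n) (auto simp: derivation_zero derivation_add derivation_one)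

lemma derivation_divide:
  assumes "derivation d" "b \<noteq> 0"
  shows "d (a / b) = (d a * b - a * d b) / (b * b)"
proof -
  have "d a = d (a / b) * b + a / b * d b"
    using derivation_mult[OF assms(1), of "a / b" b] assms(2) by simp
  then show ?thesis
    using assms(2) by (simp add: field_simps)
qed

lemmas derivation_simps = derivation_add derivation_mult derivation_zero derivation_one
  derivation_uminus derivation_diff derivation_sum derivation_of_nat

section \<open>Inverse matrices and the group \<open>GL\<close>\<close>

lemma matrix_inv_mult:
  fixes g :: "'a::field ^ 'k ^ 'k"
  assumes "invertible g"
  shows "g ** matrix_inv g = mat 1" "matrix_inv g ** g = mat 1"
proof -
  have "\<exists>A. g ** A = mat 1 \<and> A ** g = mat 1"
    using assms by (auto simp: invertible_def)
  then have "g ** matrix_inv g = mat 1 \<and> matrix_inv g ** g = mat 1"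
    unfolding matrix_inv_def by (rule someI_ex)
  then show "g ** matrix_inv g = mat 1" "matrix_inv g ** g = mat 1" by auto
qed

lemma matrix_inv_eqI:
  fixes g :: "'a::field ^ 'k ^ 'k"
  assumes "g ** A = mat 1"
  shows "matrix_inv g = A"
proof -
  have "A ** g = mat 1" using assms by (simp add: matrix_left_right_inverse)
  then have "invertible g" using assms by (auto simp: invertible_def)
  then have "matrix_inv g ** (g ** A) = A"
    by (simp add: matrix_mul_assoc matrix_inv_mult)
  then show ?thesis using assms by simp
qed

lemma matrix_inv_one: "matrix_inv (mat 1 :: 'a::field ^ 'k ^ 'k) = mat 1"
  by (rule matrix_inv_eqI) simp

lemma invertible_matrix_inv: "invertible (g :: 'a::field ^ 'k ^ 'k) \<Longrightarrow> invertible (matrix_inv g)"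
  using matrix_inv_mult invertible_def by blast

lemma matrix_inv_matrix_inv: "invertible (g :: 'a::field ^ 'k ^ 'k) \<Longrightarrow> matrix_inv (matrix_inv g) = g"
  by (rule matrix_inv_eqI) (rule matrix_inv_mult)

lemma matrix_inv_mul:
  fixes g h :: "'a::field ^ 'k ^ 'k"
  assumes "invertible g" "invertible h"
  shows "matrix_inv (g ** h) = matrix_inv h ** matrix_inv g"
proof (rule matrix_inv_eqI)
  have "g ** h ** (matrix_inv h ** matrix_inv g) = g ** (h ** matrix_inv h) ** matrix_inv g"
    by (simp add: matrix_mul_assoc)
  then show "g ** h ** (matrix_inv h ** matrix_inv g) = mat 1"
    by (simp add: assms matrix_inv_mult)
qed

text \<open>Cramer's rule. As a quotient of determinants, an entry of the inverse is a rational
  function of the entries of \<open>g\<close>, which is what \<open>rat_matrix_inv\<close>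
  needs.\<close>

lemma matrix_inv_entry:
  fixes g :: "'a::field ^ 'k ^ 'k"
  assumes "invertible g"
  shows "matrix_inv g $ i $ j =
    det (\<chi> r s. if s = i then (if r = j then 1 else 0) else g $ r $ s) / det g"
proof -
  have "g *v column j (matrix_inv g) = column j (g ** matrix_inv g)"
    by (simp add: vec_eq_iff column_def matrix_vector_mult_def matrix_matrix_mult_def)
  also have "\<dots> = (\<chi> r. if r = j then 1 else 0)"
    by (simp add: assms matrix_inv_mult column_def mat_def vec_eq_iff)
  finally have "column j (matrix_inv g) = (\<chi> k. det (\<chi> r s. if s = k then (\<chi> r. if r = j then 1 else 0) $ r else g $ r $ s) / det g)"
    using assms by (subst (asm) cramer) (auto simp: invertible_det_nz)
  then show ?thesis
    by (simp add: vec_eq_iff column_def cong: if_cong)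
qed

lemma GL_mult: "g \<in> GL \<Longrightarrow> h \<in> GL \<Longrightarrow> g ** h \<in> GL"
  by (auto simp: GL_def invertible_mult)

lemma GL_one: "mat 1 \<in> GL"
  by (auto simp: GL_def invertible_def)

lemma GL_inv: "g \<in> GL \<Longrightarrow> matrix_inv g \<in> GL"
  by (auto simp: GL_def invertible_matrix_inv)

lemma GLd_GL: "g \<in> GLd \<delta> \<Longrightarrow> g \<in> GL"
  by (auto simp: GLd_def)

section \<open>Change of frame\<close>

lemma mat_der_nth: "((g **\<^sub>d \<delta>) $ i) a = (\<Sum>j\<in>UNIV. g $ i $ j * (\<delta> $ j) a)"
  by (simp add: mat_der_def)

lemma mat_der_mat_der: "g **\<^sub>d (h **\<^sub>d \<delta>) = (g ** h) **\<^sub>d \<delta>"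
  by (simp add: vec_eq_iff fun_eq_iff mat_der_nth matrix_matrix_mult_def sum_distrib_left
      sum_distrib_right mult.assoc) (intro allI, rule sum.swap)

lemma mat_der_one: "mat 1 **\<^sub>d \<delta> = \<delta>"
proof -
  have "(\<Sum>j\<in>UNIV. (if i = j then 1 else 0) * (\<delta> $ j) a) = (\<delta> $ i) a" for i a
    by (simp add: if_distrib[of "\<lambda>x. x * _"] cong: if_cong)
  then show ?thesis
    by (simp add: vec_eq_iff fun_eq_iff mat_der_nth mat_def)
qed

lemma derivation_mat_der:
  assumes "\<And>i. derivation (\<delta> $ i)"
  shows "derivation ((g **\<^sub>d \<delta>) $ i)"
  using assms
  by (simp add: derivation_def mat_der_nth sum_distrib_left sum_distrib_right sum.distrib
      distrib_left mult_ac)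

definition good_frame :: "('a::field, 'm::finite) der_col \<Rightarrow> bool" where
  "good_frame \<delta> \<longleftrightarrow> commuting_derivations \<delta> \<and> lin_indep_derivations \<delta>"

lemma good_frame_derivation: "good_frame \<delta> \<Longrightarrow> derivation (\<delta> $ i)"
  and good_frame_commute: "good_frame \<delta> \<Longrightarrow> (\<delta> $ i) ((\<delta> $ j) a) = (\<delta> $ j) ((\<delta> $ i) a)"
  and good_frame_indep: "good_frame \<delta> \<Longrightarrow> (\<And>a. (\<Sum>i\<in>UNIV. c i * (\<delta> $ i) a) = 0) \<Longrightarrow> c i = 0"
  by (auto simp: good_frame_def commuting_derivations_def lin_indep_derivations_def)

text \<open>A bracket of combinations of the \<epsilon> splits into a first order part, from
  differentiating the coefficients, and a combination of the brackets of the \<epsilon>. It is read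
  both ways below: closedness of the matrix gives commutation, and commutation gives
  closedness.\<close>

lemma mat_der_commutator:
  assumes "\<And>i. derivation (\<epsilon> $ i)" and \<delta>: "\<delta> = s **\<^sub>d \<epsilon>"
  shows "(\<delta> $ i) ((\<delta> $ j) a) - (\<delta> $ j) ((\<delta> $ i) a) =
    (\<Sum>l\<in>UNIV. ((\<delta> $ i) (s $ j $ l) - (\<delta> $ j) (s $ i $ l)) * (\<epsilon> $ l) a) +
    (\<Sum>k\<in>UNIV. \<Sum>l\<in>UNIV. s $ i $ k * s $ j $ l *
       ((\<epsilon> $ k) ((\<epsilon> $ l) a) - (\<epsilon> $ l) ((\<epsilon> $ k) a)))"
proof -
  have d: "derivation (\<delta> $ i)" for i
    unfolding \<delta> by (intro derivation_mat_der assms)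
  have *: "(\<delta> $ i) ((\<delta> $ j) a) = (\<Sum>l\<in>UNIV. (\<delta> $ i) (s $ j $ l) * (\<epsilon> $ l) a) +
     (\<Sum>k\<in>UNIV. \<Sum>l\<in>UNIV. s $ i $ k * s $ j $ l * (\<epsilon> $ k) ((\<epsilon> $ l) a))" for i j
  proof -
    have "(\<delta> $ i) ((\<delta> $ j) a) = (\<delta> $ i) (\<Sum>l\<in>UNIV. s $ j $ l * (\<epsilon> $ l) a)"
      by (simp add: \<delta> mat_der_nth)
    also have "\<dots> = (\<Sum>l\<in>UNIV. (\<delta> $ i) (s $ j $ l) * (\<epsilon> $ l) a) +
       (\<Sum>l\<in>UNIV. s $ j $ l * (\<delta> $ i) ((\<epsilon> $ l) a))"
      by (simp add: derivation_simps[OF d] sum.distrib)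
    also have "(\<Sum>l\<in>UNIV. s $ j $ l * (\<delta> $ i) ((\<epsilon> $ l) a)) =
      (\<Sum>l\<in>UNIV. \<Sum>k\<in>UNIV. s $ i $ k * s $ j $ l * (\<epsilon> $ k) ((\<epsilon> $ l) a))"
      by (simp add: \<delta> mat_der_nth sum_distrib_left mult_ac)
    also have "\<dots> = (\<Sum>k\<in>UNIV. \<Sum>l\<in>UNIV. s $ i $ k * s $ j $ l * (\<epsilon> $ k) ((\<epsilon> $ l) a))"
      by (rule sum.swap)
    finally show ?thesis .
  qed
  have "(\<Sum>k\<in>UNIV. \<Sum>l\<in>UNIV. s $ j $ k * s $ i $ l * (\<epsilon> $ k) ((\<epsilon> $ l) a)) =
    (\<Sum>k\<in>UNIV. \<Sum>l\<in>UNIV. s $ i $ k * s $ j $ l * (\<epsilon> $ l) ((\<epsilon> $ k) a))"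
    by (subst sum.swap) (simp add: mult_ac)
  then show ?thesis
    by (simp add: *[of i j] *[of j i] left_diff_distrib right_diff_distrib sum_subtractf)
qed

text \<open>For \<delta> = g \<epsilon>, with \<delta> commuting and g closed, the bracket formula
  leaves only products of entries of g with brackets of the \<epsilon>, and cancelling g twice makes
  these brackets zero. For \<epsilon> = \<open>g\<^sup>-\<^sup>1\<close> \<delta> it then leaves
  only the first order part, and the independence of the \<delta> makes
  \<open>g\<^sup>-\<^sup>1\<close> closed.\<close>

lemma good_frame_matrix_inv:
  assumes \<delta>: "good_frame \<delta>" and g: "g \<in> GLd \<delta>"
  shows "good_frame (matrix_inv g **\<^sub>d \<delta>)" "matrix_inv g \<in> GLd (matrix_inv g **\<^sub>d \<delta>)"
proof -
  define \<epsilon> where "\<epsilon> = matrix_inv g **\<^sub>d \<delta>"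
  define s where "s = matrix_inv g"
  have inv: "invertible g" using g by (auto simp: GLd_def GL_def)
  have \<delta>\<epsilon>: "\<delta> = g **\<^sub>d \<epsilon>"
    by (simp add: \<epsilon>_def mat_der_mat_der matrix_inv_mult inv mat_der_one)
  have der: "derivation (\<epsilon> $ i)" for i
    unfolding \<epsilon>_def by (intro derivation_mat_der good_frame_derivation \<delta>)
  define br where "br k l a = (\<epsilon> $ k) ((\<epsilon> $ l) a) - (\<epsilon> $ l) ((\<epsilon> $ k) a)" for k l a
  have sg: "(\<Sum>i\<in>UNIV. s $ p $ i * g $ i $ k) = (if p = k then 1 else 0)" for p k
  proof -
    have "(s ** g) $ p $ k = mat 1 $ p $ k" by (simp add: s_def matrix_inv_mult inv)
    then show ?thesis by (simp add: matrix_matrix_mult_def mat_def)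
  qed
  have zero: "(\<Sum>k\<in>UNIV. \<Sum>l\<in>UNIV. g $ i $ k * g $ j $ l * br k l a) = 0" for i j a
    using mat_der_commutator[of \<epsilon> \<delta> g i j a, OF der \<delta>\<epsilon>] g good_frame_commute[OF \<delta>, of i j a]
    by (simp add: GLd_def br_def)
  have cancel: "(\<Sum>i\<in>UNIV. s $ p $ i * (\<Sum>k\<in>UNIV. g $ i $ k * f k)) = f p" for p f
  proof -
    have "(\<Sum>i\<in>UNIV. s $ p $ i * (\<Sum>k\<in>UNIV. g $ i $ k * f k)) =
        (\<Sum>k\<in>UNIV. (\<Sum>i\<in>UNIV. s $ p $ i * g $ i $ k) * f k)"
      by (simp add: sum_distrib_left sum_distrib_right mult.assoc) (rule sum.swap)
    then show ?thesis
      by (simp add: sg if_distrib[of "\<lambda>x. x * _"] cong: if_cong)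
  qed
  have br: "br p q a = 0" for p q a
  proof -
    have "(\<Sum>k\<in>UNIV. g $ i $ k * (\<Sum>l\<in>UNIV. g $ j $ l * br k l a)) = 0" for i j
      using zero[of i j a] by (simp add: sum_distrib_left mult.assoc)
    then have "(\<Sum>l\<in>UNIV. g $ j $ l * br p l a) = 0" for j
      using cancel[of p "\<lambda>k. \<Sum>l\<in>UNIV. g $ j $ l * br k l a"] by simp
    then show ?thesis
      using cancel[of q "\<lambda>l. br p l a"] by simp
  qed
  have comm: "(\<epsilon> $ k) ((\<epsilon> $ l) a) = (\<epsilon> $ l) ((\<epsilon> $ k) a)" for k l a
    using br[of k l a] by (simp add: br_def)
  have indep: "lin_indep_derivations \<epsilon>"
    unfolding lin_indep_derivations_def
  proof safe
    fix c :: "'b \<Rightarrow> 'a" and i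
    assume *: "\<forall>a. (\<Sum>i\<in>UNIV. c i * (\<epsilon> $ i) a) = 0"
    define e where "e j = (\<Sum>i\<in>UNIV. c i * s $ i $ j)" for j
    have "e j = 0" for j
    proof (rule good_frame_indep[OF \<delta>])
      fix a
      have "(\<Sum>j\<in>UNIV. e j * (\<delta> $ j) a) = (\<Sum>i\<in>UNIV. c i * (\<epsilon> $ i) a)"
        by (simp add: e_def \<epsilon>_def mat_der_nth sum_distrib_left sum_distrib_right mult.assoc s_def,
            subst sum.swap, simp)
      then show "(\<Sum>j\<in>UNIV. e j * (\<delta> $ j) a) = 0" using * by simp
    qed
    then have "0 = (\<Sum>j\<in>UNIV. e j * g $ j $ i)" by simp
    also have "\<dots> = (\<Sum>k\<in>UNIV. c k * (\<Sum>j\<in>UNIV. s $ k $ j * g $ j $ i))"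
      by (simp add: e_def sum_distrib_left sum_distrib_right mult.assoc, subst sum.swap, simp)
    also have "\<dots> = c i"
      by (simp add: sg if_distrib[of "\<lambda>x. _ * x"] cong: if_cong)
    finally show "c i = 0" by simp
  qed
  show gf: "good_frame (matrix_inv g **\<^sub>d \<delta>)"
    using der comm indep unfolding \<epsilon>_def[symmetric] good_frame_def commuting_derivations_def by auto
  have "(\<epsilon> $ i) (s $ j $ l) - (\<epsilon> $ j) (s $ i $ l) = 0" for i j l
  proof (rule good_frame_indep[OF \<delta>])
    fix a
    show "(\<Sum>l\<in>UNIV. ((\<epsilon> $ i) (s $ j $ l) - (\<epsilon> $ j) (s $ i $ l)) * (\<delta> $ l) a) = 0"
      using mat_der_commutator[of \<delta> \<epsilon> s i j a, OF good_frame_derivation[OF \<delta>]] comm[of i j a]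
        good_frame_commute[OF \<delta>]
      by (simp add: \<epsilon>_def s_def)
  qed
  then show "matrix_inv g \<in> GLd (matrix_inv g **\<^sub>d \<delta>)"
    using inv unfolding \<epsilon>_def[symmetric]
    by (auto simp: GLd_def GL_def s_def invertible_matrix_inv)
qed

text \<open>The derivative \<open>\<delta>\<^sup>i\<close> of h, expressed through \<epsilon>,
  enters with the coefficient \<open>g\<^sub>j\<^sub>k g\<^sub>i\<^sub>r\<close>. Since h is closed
  for \<epsilon>, this part is symmetric in i and j; the part with the derivative of g is symmetric
  because g is closed for \<delta>.\<close>

lemma GLd_mult:
  assumes \<delta>: "good_frame \<delta>" and g: "g \<in> GLd \<delta>" and h: "h \<in> GLd (matrix_inv g **\<^sub>d \<delta>)"
  shows "g ** h \<in> GLd \<delta>"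
proof -
  define \<epsilon> where "\<epsilon> = matrix_inv g **\<^sub>d \<delta>"
  have inv: "invertible g" using g by (auto simp: GLd_def GL_def)
  have \<delta>\<epsilon>: "\<delta> = g **\<^sub>d \<epsilon>"
    by (simp add: \<epsilon>_def mat_der_mat_der matrix_inv_mult inv mat_der_one)
  note d = good_frame_derivation[OF \<delta>]
  have *: "(\<delta> $ i) ((g ** h) $ j $ l) = (\<Sum>k\<in>UNIV. (\<delta> $ i) (g $ j $ k) * h $ k $ l) +
     (\<Sum>k\<in>UNIV. \<Sum>r\<in>UNIV. g $ j $ k * g $ i $ r * (\<epsilon> $ r) (h $ k $ l))" for i j l
  proof -
    have "(\<delta> $ i) ((g ** h) $ j $ l) = (\<Sum>k\<in>UNIV. (\<delta> $ i) (g $ j $ k) * h $ k $ l) +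
        (\<Sum>k\<in>UNIV. g $ j $ k * (\<delta> $ i) (h $ k $ l))"
      by (simp add: matrix_matrix_mult_def derivation_simps[OF d] sum.distrib)
    also have "(\<Sum>k\<in>UNIV. g $ j $ k * (\<delta> $ i) (h $ k $ l)) =
      (\<Sum>k\<in>UNIV. \<Sum>r\<in>UNIV. g $ j $ k * g $ i $ r * (\<epsilon> $ r) (h $ k $ l))"
      by (subst \<delta>\<epsilon>) (simp add: mat_der_nth sum_distrib_left mult.assoc)
    finally show ?thesis .
  qed
  have "(\<delta> $ i) ((g ** h) $ j $ l) = (\<delta> $ j) ((g ** h) $ i $ l)" for i j l
  proof -
    have h': "(\<epsilon> $ r) (h $ k $ l) = (\<epsilon> $ k) (h $ r $ l)" for r k l
      using h by (simp add: GLd_def \<epsilon>_def)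
    have "(\<Sum>k\<in>UNIV. \<Sum>r\<in>UNIV. g $ i $ k * g $ j $ r * (\<epsilon> $ r) (h $ k $ l)) =
      (\<Sum>k\<in>UNIV. \<Sum>r\<in>UNIV. g $ j $ k * g $ i $ r * (\<epsilon> $ r) (h $ k $ l))"
      by (subst sum.swap) (simp add: mult_ac h')
    moreover have "(\<delta> $ i) (g $ j $ k) = (\<delta> $ j) (g $ i $ k)" for k
      using g by (simp add: GLd_def)
    ultimately show ?thesis by (simp add: *)
  qed
  moreover have "g ** h \<in> GL"
    using g h by (auto intro: GL_mult GLd_GL)
  ultimately show ?thesis by (simp add: GLd_def)
qed

lemma GLd_one: "(\<And>i. derivation (\<delta> $ i)) \<Longrightarrow> mat 1 \<in> GLd \<delta>"
  using GL_one[unfolded mat_def] by (auto simp: GLd_def mat_def derivation_simps)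

lemma frames_self: "good_frame D \<Longrightarrow> D \<in> frames D"
  using GLd_one[of D] good_frame_derivation[of D]
  by (force simp: frames_def matrix_inv_one mat_der_one intro!: exI[of _ "mat 1"])

lemma frames_good: "good_frame D \<Longrightarrow> \<delta> \<in> frames D \<Longrightarrow> good_frame \<delta>"
  by (auto simp: frames_def good_frame_matrix_inv)

lemma frames_matrix_inv:
  assumes "good_frame D" "\<delta> \<in> frames D" "g \<in> GLd \<delta>"
  shows "matrix_inv g **\<^sub>d \<delta> \<in> frames D"
proof -
  obtain k where k: "k \<in> GLd D" "\<delta> = matrix_inv k **\<^sub>d D"
    using assms(2) by (auto simp: frames_def)
  have "k ** g \<in> GLd D" using GLd_mult[OF assms(1) k(1)] assms(3) k(2) by simp
  moreover have "matrix_inv (k ** g) **\<^sub>d D = matrix_inv g **\<^sub>d \<delta>"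
    using k(1) assms(3) by (simp add: k(2) mat_der_mat_der matrix_inv_mul GLd_def GL_def)
  ultimately show ?thesis unfolding frames_def by force
qed

section \<open>Functions given by one differential rational expression\<close>

text \<open>Coefficients and domain are parameters: group elements held fixed become coefficients
  from all of F, whereas invariant families need constants. The domain consists of pairs of a frame
  and a point, since one expression is read in many frames.\<close>

definition rat_on :: "'a::field set \<Rightarrow> (('a, 'm::finite) der_col \<times> 'u) set \<Rightarrow> ('u \<Rightarrow> 'v \<Rightarrow> 'a) \<Rightarrow>
   (('a, 'm) der_col \<Rightarrow> 'u \<Rightarrow> 'a) \<Rightarrow> bool" where
  "rat_on C Z crd f \<longleftrightarrow> (\<exists>p q. dcoeffs p \<subseteq> C \<and> dcoeffs q \<subseteq> C \<and>
     (\<forall>(\<delta>, u)\<in>Z. deval \<delta> q (crd u) \<noteq> 0 \<and> f \<delta> u = deval \<delta> p (crd u) / deval \<delta> q (crd u)))"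

lemma rat_onI:
  assumes "dcoeffs p \<subseteq> C" "dcoeffs q \<subseteq> C"
    and "\<And>\<delta> u. (\<delta>, u) \<in> Z \<Longrightarrow> deval \<delta> q (crd u) \<noteq> 0"
    and "\<And>\<delta> u. (\<delta>, u) \<in> Z \<Longrightarrow> f \<delta> u = deval \<delta> p (crd u) / deval \<delta> q (crd u)"
  shows "rat_on C Z crd f"
  using assms unfolding rat_on_def by blast

lemma rat_onE:
  assumes "rat_on C Z crd f"
  obtains p q where "dcoeffs p \<subseteq> C" "dcoeffs q \<subseteq> C"
    "\<And>\<delta> u. (\<delta>, u) \<in> Z \<Longrightarrow> deval \<delta> q (crd u) \<noteq> 0"
    "\<And>\<delta> u. (\<delta>, u) \<in> Z \<Longrightarrow> f \<delta> u = deval \<delta> p (crd u) / deval \<delta> q (crd u)"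
  using assms unfolding rat_on_def by blast

lemma rat_on_cong:
  assumes "\<And>\<delta> u. (\<delta>, u) \<in> Z \<Longrightarrow> f \<delta> u = g \<delta> u"
  shows "rat_on C Z crd f \<longleftrightarrow> rat_on C Z crd g"
  using assms by (force simp: rat_on_def)

lemma rat_on_mono: "rat_on C Z crd f \<Longrightarrow> C \<subseteq> C' \<Longrightarrow> Z' \<subseteq> Z \<Longrightarrow> rat_on C' Z' crd f"
  unfolding rat_on_def by blast

lemma uniform_rational_iff:
  "uniform_rational D Z crd f \<longleftrightarrow> rat_on (constants D) (Sigma (frames D) Z) crd f"
  by (force simp: uniform_rational_def rat_on_def)

text \<open>Expressions are combined formally, so the only coefficients that the closure rules
  introduce are 0, 1 and -1, the last one for the quotient rule and for signs of
  permutations.\<close>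

locale rat_domain =
  fixes C :: "'a::field set" and Z :: "(('a, 'm::finite) der_col \<times> 'u) set"
    and crd :: "'u \<Rightarrow> 'v \<Rightarrow> 'a"
  assumes coeffs: "0 \<in> C" "1 \<in> C" "- 1 \<in> C"
    and derivations: "\<And>\<delta> u i. (\<delta>, u) \<in> Z \<Longrightarrow> derivation (\<delta> $ i)"
begin

abbreviation rat :: "(('a, 'm) der_col \<Rightarrow> 'u \<Rightarrow> 'a) \<Rightarrow> bool" where
  "rat \<equiv> rat_on C Z crd"

lemma rat_const: "c \<in> C \<Longrightarrow> rat (\<lambda>\<delta> u. c)"
  by (rule rat_onI[of "Const c" _ "Const 1"]) (auto simp: coeffs)

lemma rat_var: "rat (\<lambda>\<delta> u. crd u x)"
  by (rule rat_onI[of "Var x" _ "Const 1"]) (auto simp: coeffs)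

lemma rat_add:
  assumes "rat f" "rat g" shows "rat (\<lambda>\<delta> u. f \<delta> u + g \<delta> u)"
  using assms(1)
proof (rule rat_onE)
  fix p q
  assume 1: "dcoeffs p \<subseteq> C" "dcoeffs q \<subseteq> C"
    "\<And>\<delta> u. (\<delta>, u) \<in> Z \<Longrightarrow> deval \<delta> q (crd u) \<noteq> 0"
    "\<And>\<delta> u. (\<delta>, u) \<in> Z \<Longrightarrow> f \<delta> u = deval \<delta> p (crd u) / deval \<delta> q (crd u)"
  from assms(2) obtain p' q' where 2: "dcoeffs p' \<subseteq> C" "dcoeffs q' \<subseteq> C"
    "\<And>\<delta> u. (\<delta>, u) \<in> Z \<Longrightarrow> deval \<delta> q' (crd u) \<noteq> 0"
    "\<And>\<delta> u. (\<delta>, u) \<in> Z \<Longrightarrow> g \<delta> u = deval \<delta> p' (crd u) / deval \<delta> q' (crd u)"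
    by (rule rat_onE) blast
  show ?thesis
    by (rule rat_onI[of "Add (Mul p q') (Mul p' q)" _ "Mul q q'"])
      (use 1 2 in \<open>auto simp: add_frac_eq\<close>)
qed

lemma rat_mult:
  assumes "rat f" "rat g" shows "rat (\<lambda>\<delta> u. f \<delta> u * g \<delta> u)"
  using assms(1)
proof (rule rat_onE)
  fix p q
  assume 1: "dcoeffs p \<subseteq> C" "dcoeffs q \<subseteq> C"
    "\<And>\<delta> u. (\<delta>, u) \<in> Z \<Longrightarrow> deval \<delta> q (crd u) \<noteq> 0"
    "\<And>\<delta> u. (\<delta>, u) \<in> Z \<Longrightarrow> f \<delta> u = deval \<delta> p (crd u) / deval \<delta> q (crd u)"
  from assms(2) obtain p' q' where 2: "dcoeffs p' \<subseteq> C" "dcoeffs q' \<subseteq> C"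
    "\<And>\<delta> u. (\<delta>, u) \<in> Z \<Longrightarrow> deval \<delta> q' (crd u) \<noteq> 0"
    "\<And>\<delta> u. (\<delta>, u) \<in> Z \<Longrightarrow> g \<delta> u = deval \<delta> p' (crd u) / deval \<delta> q' (crd u)"
    by (rule rat_onE) blast
  show ?thesis
    by (rule rat_onI[of "Mul p p'" _ "Mul q q'"]) (use 1 2 in auto)
qed

lemma rat_divide:
  assumes "rat f" "rat g" "\<And>\<delta> u. (\<delta>, u) \<in> Z \<Longrightarrow> g \<delta> u \<noteq> 0"
  shows "rat (\<lambda>\<delta> u. f \<delta> u / g \<delta> u)"
  using assms(1)
proof (rule rat_onE)
  fix p q
  assume 1: "dcoeffs p \<subseteq> C" "dcoeffs q \<subseteq> C"
    "\<And>\<delta> u. (\<delta>, u) \<in> Z \<Longrightarrow> deval \<delta> q (crd u) \<noteq> 0"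
    "\<And>\<delta> u. (\<delta>, u) \<in> Z \<Longrightarrow> f \<delta> u = deval \<delta> p (crd u) / deval \<delta> q (crd u)"
  from assms(2) obtain p' q' where 2: "dcoeffs p' \<subseteq> C" "dcoeffs q' \<subseteq> C"
    "\<And>\<delta> u. (\<delta>, u) \<in> Z \<Longrightarrow> deval \<delta> q' (crd u) \<noteq> 0"
    "\<And>\<delta> u. (\<delta>, u) \<in> Z \<Longrightarrow> g \<delta> u = deval \<delta> p' (crd u) / deval \<delta> q' (crd u)"
    by (rule rat_onE) blast
  have 3: "deval \<delta> p' (crd u) \<noteq> 0" if "(\<delta>, u) \<in> Z" for \<delta> u
    using assms(3)[OF that] 2(4)[OF that] by auto
  show ?thesis
    by (rule rat_onI[of "Mul p q'" _ "Mul q p'"]) (use 1 2 3 in auto)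
qed

lemma rat_sum: "(\<And>x. x \<in> A \<Longrightarrow> rat (f x)) \<Longrightarrow> rat (\<lambda>\<delta> u. \<Sum>x\<in>A. f x \<delta> u)"
  by (induction A rule: infinite_finite_induct) (auto intro: rat_const coeffs rat_add)

lemma rat_prod: "(\<And>x. x \<in> A \<Longrightarrow> rat (f x)) \<Longrightarrow> rat (\<lambda>\<delta> u. \<Prod>x\<in>A. f x \<delta> u)"
  by (induction A rule: infinite_finite_induct) (auto intro: rat_const coeffs rat_mult)

lemma rat_det:
  fixes M :: "('a, 'm) der_col \<Rightarrow> 'u \<Rightarrow> 'a ^ 'k ^ 'k"
  assumes "\<And>i j. rat (\<lambda>\<delta> u. M \<delta> u $ i $ j)"
  shows "rat (\<lambda>\<delta> u. det (M \<delta> u))"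
proof -
  have "of_int (sign p) \<in> C" for p :: "'k \<Rightarrow> 'k"
    using coeffs by (simp add: sign_def)
  then show ?thesis
    unfolding det_def by (intro rat_sum rat_mult rat_const rat_prod assms)
qed

lemma rat_matrix_inv:
  fixes M :: "('a, 'm) der_col \<Rightarrow> 'u \<Rightarrow> 'a ^ 'k ^ 'k"
  assumes M: "\<And>i j. rat (\<lambda>\<delta> u. M \<delta> u $ i $ j)"
    and inv: "\<And>\<delta> u. (\<delta>, u) \<in> Z \<Longrightarrow> invertible (M \<delta> u)"
  shows "rat (\<lambda>\<delta> u. matrix_inv (M \<delta> u) $ i $ j)"
proof -
  have "rat (\<lambda>\<delta> u. (\<chi> r s. if s = i then (if r = j then 1 else 0) else M \<delta> u $ r $ s) $ r $ s)" for r s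
    by (cases "s = i"; cases "r = j") (auto intro: rat_const coeffs M)
  then have "rat (\<lambda>\<delta> u. det (\<chi> r s. if s = i then (if r = j then 1 else 0) else M \<delta> u $ r $ s) / det (M \<delta> u))"
    using inv by (intro rat_divide rat_det M) (auto simp: invertible_det_nz)
  then show ?thesis
    by (rule iffD2[OF rat_on_cong, rotated]) (use inv in \<open>auto simp: matrix_inv_entry\<close>)
qed

lemma rat_der:
  assumes "rat f" shows "rat (\<lambda>\<delta> u. (\<delta> $ i) (f \<delta> u))"
  using assms
proof (rule rat_onE)
  fix p q
  assume 1: "dcoeffs p \<subseteq> C" "dcoeffs q \<subseteq> C"
    "\<And>\<delta> u. (\<delta>, u) \<in> Z \<Longrightarrow> deval \<delta> q (crd u) \<noteq> 0"
    "\<And>\<delta> u. (\<delta>, u) \<in> Z \<Longrightarrow> f \<delta> u = deval \<delta> p (crd u) / deval \<delta> q (crd u)"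
  show ?thesis
    by (rule rat_onI[of "Add (Mul (Der i p) q) (Mul (Const (- 1)) (Mul p (Der i q)))" _ "Mul q q"])
      (use 1 coeffs in \<open>auto simp: derivation_divide derivations\<close>)
qed

text \<open>A derivation of the changed frame is a combination of the
  \<open>\<delta>\<^sup>j\<close> with rational coefficients, so by induction an expression read in
  that frame is one expression read in \<delta>.\<close>

lemma rat_deval:
  assumes M: "\<And>i j. rat (\<lambda>\<delta> u. M \<delta> u $ i $ j)" and Y: "\<And>k. rat (\<lambda>\<delta> u. Y \<delta> u k)"
    and "dcoeffs p \<subseteq> C"
  shows "rat (\<lambda>\<delta> u. deval (M \<delta> u **\<^sub>d \<delta>) p (Y \<delta> u))"
  using assms(3)
proof (induction p)
  case (Der i p)
  then show ?case
    by (auto simp: mat_der_nth intro!: rat_sum rat_mult M rat_der)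
qed (auto intro: rat_const Y rat_add rat_mult)

lemma rat_deval_same:
  assumes "\<And>k. rat (\<lambda>\<delta> u. Y \<delta> u k)" "dcoeffs p \<subseteq> C"
  shows "rat (\<lambda>\<delta> u. deval \<delta> p (Y \<delta> u))"
proof -
  have "rat (\<lambda>\<delta> u. deval (mat 1 **\<^sub>d \<delta>) p (Y \<delta> u))"
    by (rule rat_deval) (auto simp: mat_def assms intro: rat_const coeffs)
  then show ?thesis by (simp add: mat_der_one)
qed

lemma rat_compose:
  assumes f: "rat_on C Z' crd' f"
    and \<phi>: "\<And>\<delta> u. (\<delta>, u) \<in> Z \<Longrightarrow> (\<delta>, \<phi> \<delta> u) \<in> Z'" "\<And>x. rat (\<lambda>\<delta> u. crd' (\<phi> \<delta> u) x)"
  shows "rat (\<lambda>\<delta> u. f \<delta> (\<phi> \<delta> u))"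
  using f
proof (rule rat_onE)
  fix p q
  assume pq: "dcoeffs p \<subseteq> C" "dcoeffs q \<subseteq> C"
    "\<And>\<delta> u. (\<delta>, u) \<in> Z' \<Longrightarrow> deval \<delta> q (crd' u) \<noteq> 0"
    "\<And>\<delta> u. (\<delta>, u) \<in> Z' \<Longrightarrow> f \<delta> u = deval \<delta> p (crd' u) / deval \<delta> q (crd' u)"
  have "rat (\<lambda>\<delta> u. deval \<delta> p (crd' (\<phi> \<delta> u)) / deval \<delta> q (crd' (\<phi> \<delta> u)))"
    by (intro rat_divide rat_deval_same pq \<phi>)
  then show ?thesis
    by (rule iffD2[OF rat_on_cong, rotated]) (simp add: pq(4) \<phi>(1))
qed

end

section \<open>Independence of the iterated derivations\<close>

text \<open>A multiset over \<open>'m\<close> is a multi-index; for commuting derivations the order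
  of the fold is irrelevant.\<close>

definition iter_der :: "('a::field, 'm::finite) der_col \<Rightarrow> 'm multiset \<Rightarrow> 'a \<Rightarrow> 'a" where
  "iter_der \<delta> B a = fold_mset (\<lambda>i. \<delta> $ i) a B"

locale frame =
  fixes \<delta> :: "('a::field_char_0, 'm::finite) der_col"
  assumes good: "good_frame \<delta>"
begin

lemmas der = good_frame_derivation[OF good]
lemmas der_simps = derivation_simps[OF der]

abbreviation dB :: "'m multiset \<Rightarrow> 'a \<Rightarrow> 'a" where "dB \<equiv> iter_der \<delta>"

lemma dB_empty [simp]: "dB {#} a = a"
  by (simp add: iter_der_def)

lemma dB_add_mset: "dB (add_mset i B) a = (\<delta> $ i) (dB B a)"
proof -
  interpret comp_fun_commute "\<lambda>i. \<delta> $ i"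
    by standard (simp add: fun_eq_iff good_frame_commute[OF good])
  show ?thesis by (simp add: iter_der_def)
qed

lemma dB_add_mset': "dB (add_mset i B) a = dB B ((\<delta> $ i) a)"
  by (induction B) (simp_all add: dB_add_mset good_frame_commute[OF good, of i])

lemma dB_add: "dB B (a + b) = dB B a + dB B b"
  by (induction B) (simp_all add: dB_add_mset der_simps)

lemma dB_scale: "(\<And>i. (\<delta> $ i) t = 0) \<Longrightarrow> dB B (t * a) = t * dB B a"
  by (induction B) (simp_all add: dB_add_mset der_simps)

lemma dB_const: "(\<And>i. (\<delta> $ i) t = 0) \<Longrightarrow> dB B t = (if B = {#} then t else 0)"
  by (induction B) (simp_all add: dB_add_mset der_simps)

definition lower :: "nat \<Rightarrow> 'm multiset set" where
  "lower N = {B. size B < N}"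

lemma finite_lower: "finite (lower N)"
proof -
  have "lower N = (\<Union>n\<in>{..<N}. multisets_of_size UNIV n)"
    by (auto simp: lower_def multisets_of_size_def)
  then show ?thesis by auto
qed

text \<open>The linear differential operators of order below \<open>N\<close>, as maps;
  \<open>ops 0\<close> contains only the zero map.\<close>

definition ops :: "nat \<Rightarrow> ('a \<Rightarrow> 'a) set" where
  "ops N = {L. \<exists>c. \<forall>a. L a = (\<Sum>B\<in>lower N. c B * dB B a)}"

lemma ops_zero: "(\<lambda>a. 0) \<in> ops N"
  by (auto simp: ops_def intro!: exI[of _ "\<lambda>_. 0"])

lemma ops_basic: "size B < N \<Longrightarrow> (\<lambda>a. c * dB B a) \<in> ops N"
  unfolding ops_def
  by (auto intro!: exI[of _ "\<lambda>B'. if B' = B then c else 0"]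
      simp: finite_lower if_distrib[of "\<lambda>x. x * _"] lower_def[of N] sum.delta[OF finite_lower[unfolded lower_def]] cong: if_cong)

lemma ops_add: "L \<in> ops N \<Longrightarrow> L' \<in> ops N \<Longrightarrow> (\<lambda>a. L a + L' a) \<in> ops N"
proof -
  assume "L \<in> ops N" "L' \<in> ops N"
  then obtain c c' where "\<And>a. L a = (\<Sum>B\<in>lower N. c B * dB B a)" "\<And>a. L' a = (\<Sum>B\<in>lower N. c' B * dB B a)"
    by (auto simp: ops_def)
  then show ?thesis
    by (auto simp: ops_def sum.distrib distrib_right intro!: exI[of _ "\<lambda>B. c B + c' B"])
qed

lemma ops_sum: "(\<And>x. x \<in> I \<Longrightarrow> L x \<in> ops N) \<Longrightarrow> (\<lambda>a. \<Sum>x\<in>I. L x a) \<in> ops N"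
  by (induction I rule: infinite_finite_induct) (auto intro: ops_zero ops_add)

lemma ops_scale: "L \<in> ops N \<Longrightarrow> (\<lambda>a. c * L a) \<in> ops N"
proof -
  assume "L \<in> ops N"
  then obtain e where "\<And>a. L a = (\<Sum>B\<in>lower N. e B * dB B a)"
    by (auto simp: ops_def)
  then show ?thesis
    by (auto simp: ops_def sum_distrib_left mult.assoc intro!: exI[of _ "\<lambda>B. c * e B"])
qed

lemma ops_mono: "L \<in> ops N \<Longrightarrow> N \<le> N' \<Longrightarrow> L \<in> ops N'"
proof -
  assume "L \<in> ops N" "N \<le> N'"
  then obtain c where c: "L = (\<lambda>a. \<Sum>B\<in>lower N. c B * dB B a)"
    by (auto simp: ops_def)
  show ?thesis
    unfolding c using \<open>N \<le> N'\<close> by (intro ops_sum ops_basic) (auto simp: lower_def)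
qed

lemma ops_der: "L \<in> ops N \<Longrightarrow> (\<lambda>a. (\<delta> $ i) (L a)) \<in> ops (Suc N)"
proof -
  assume "L \<in> ops N"
  then obtain c where "\<And>a. L a = (\<Sum>B\<in>lower N. c B * dB B a)"
    by (auto simp: ops_def)
  then have "(\<lambda>a. (\<delta> $ i) (L a)) =
      (\<lambda>a. \<Sum>B\<in>lower N. (\<delta> $ i) (c B) * dB B a + c B * dB (add_mset i B) a)"
    by (simp add: der_simps dB_add_mset)
  also have "\<dots> \<in> ops (Suc N)"
    by (intro ops_sum ops_add ops_basic) (auto simp: lower_def)
  finally show ?thesis .
qed

lemma ops_0: "L \<in> ops 0 \<Longrightarrow> L a = 0"
  by (auto simp: ops_def lower_def)

text \<open>The sum collects the terms in which exactly one derivation falls on \<xi>. In the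
  remaining ones at least two do, so their order in a is below \<open>size B - 1\<close>. For empty
  \<open>B\<close> the truncated subtraction gives order below 0, and the remainder is zero.\<close>

lemma leibniz:
  "\<exists>L\<in>ops (size B - 1). \<forall>a. dB B (\<xi> * a) = \<xi> * dB B a +
     (\<Sum>i\<in>UNIV. of_nat (count B i) * (\<delta> $ i) \<xi> * dB (B - {#i#}) a) + L a"
proof (induction B)
  case empty
  show ?case by (rule bexI[OF _ ops_zero]) simp
next
  case (add j B)
  obtain L where L: "L \<in> ops (size B - 1)" "\<And>a. dB B (\<xi> * a) = \<xi> * dB B a +
     (\<Sum>i\<in>UNIV. of_nat (count B i) * (\<delta> $ i) \<xi> * dB (B - {#i#}) a) + L a"
    using add by blast
  define R where "R a = (\<Sum>i\<in>UNIV. of_nat (count B i) * (\<delta> $ j) ((\<delta> $ i) \<xi>) * dB (B - {#i#}) a) + (\<delta> $ j) (L a)" for a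
  \<comment> \<open>For i outside \<open>B\<close> the multiset \<open>B - {#i#}\<close> keeps its
    size, but the multiplicity 0 removes the term.\<close>
  have "(\<lambda>a. of_nat (count B i) * (\<delta> $ j) ((\<delta> $ i) \<xi>) * dB (B - {#i#}) a) \<in> ops (size B)" for i
  proof (cases "i \<in># B")
    case True
    then show ?thesis by (intro ops_basic size_Diff1_less)
  next
    case False
    then show ?thesis by (simp add: not_in_iff ops_zero)
  qed
  note 1 = this
  \<comment> \<open>\<open>ops_der\<close> gives the bound \<open>Suc (size B - 1)\<close>, which
    exceeds \<open>size B\<close> when \<open>B\<close> is empty; in that case \<open>L\<close> is
    zero.\<close>
  have 2: "(\<lambda>a. (\<delta> $ j) (L a)) \<in> ops (size B)"
  proof (cases "size B = 0")
    case True
    then have "(\<lambda>a. (\<delta> $ j) (L a)) = (\<lambda>a. 0)" using L(1) by (simp add: ops_0 der_simps)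
    then show ?thesis by (simp add: ops_zero)
  next
    case False
    then have "Suc (size B - 1) = size B" by (rule Suc_diff_1[OF neq0_conv[THEN iffD1]])
    then show ?thesis using ops_der[OF L(1), of j] by metis
  qed
  have "R \<in> ops (size B)"
    unfolding R_def[abs_def] by (intro ops_add ops_sum 1 2)
  then have R: "R \<in> ops (size (add_mset j B) - 1)" by simp
  have shift: "of_nat (count B i) * c * (\<delta> $ j) (dB (B - {#i#}) a) =
      of_nat (count B i) * c * dB (add_mset j B - {#i#}) a" for i c a
  proof (cases "i \<in># B")
    case True
    then have "add_mset j B - {#i#} = add_mset j (B - {#i#})" by simp
    then show ?thesis by (simp add: dB_add_mset)
  next
    case False
    then show ?thesis by (simp add: not_in_iff)
  qed
  have "dB (add_mset j B) (\<xi> * a) = \<xi> * dB (add_mset j B) a +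
     (\<Sum>i\<in>UNIV. of_nat (count (add_mset j B) i) * (\<delta> $ i) \<xi> * dB (add_mset j B - {#i#}) a) + R a" for a
  proof -
    \<comment> \<open>Adding j raises only the multiplicity of j. The extra summand is the term in
      which the new derivation alone falls on \<xi>.\<close>
    have "(\<Sum>i\<in>UNIV. of_nat (count (add_mset j B) i) * (\<delta> $ i) \<xi> * dB (add_mset j B - {#i#}) a) =
      (\<Sum>i\<in>UNIV. of_nat (count B i) * (\<delta> $ i) \<xi> * dB (add_mset j B - {#i#}) a +
        (if i = j then (\<delta> $ j) \<xi> * dB B a else 0))"
      by (rule sum.cong) (auto simp: distrib_right)
    also have "\<dots> = (\<Sum>i\<in>UNIV. of_nat (count B i) * (\<delta> $ i) \<xi> * dB (add_mset j B - {#i#}) a) + (\<delta> $ j) \<xi> * dB B a"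
      by (simp add: sum.distrib)
    finally have 3: "(\<Sum>i\<in>UNIV. of_nat (count (add_mset j B) i) * (\<delta> $ i) \<xi> * dB (add_mset j B - {#i#}) a) = \<dots>" .
    have "(\<delta> $ j) (of_nat (count B i) * (\<delta> $ i) \<xi> * dB (B - {#i#}) a) =
        of_nat (count B i) * (\<delta> $ j) ((\<delta> $ i) \<xi>) * dB (B - {#i#}) a +
        of_nat (count B i) * (\<delta> $ i) \<xi> * dB (add_mset j B - {#i#}) a" for i
      by (simp only: der_simps shift[symmetric] mult_zero_left add_0_left)
    then have "dB (add_mset j B) (\<xi> * a) = (\<delta> $ j) \<xi> * dB B a + \<xi> * (\<delta> $ j) (dB B a) +
       (\<Sum>i\<in>UNIV. of_nat (count B i) * (\<delta> $ j) ((\<delta> $ i) \<xi>) * dB (B - {#i#}) a +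
          of_nat (count B i) * (\<delta> $ i) \<xi> * dB (add_mset j B - {#i#}) a) + (\<delta> $ j) (L a)"
      by (simp only: dB_add_mset[of j B "\<xi> * a"] L(2) derivation_add[OF der] derivation_sum[OF der] derivation_mult[OF der, where a = \<xi>])
    then show ?thesis
      unfolding 3 R_def sum.distrib dB_add_mset[of j B a] by (simp only: ac_simps)
  qed
  then show ?case using R by blast
qed

text \<open>If \<open>L = \<Sum> c\<^sub>B \<delta>\<^sup>B\<close> vanishes, so does its commutator with multiplication by \<open>\<xi>\<close>, whose order
  is lower and whose leading coefficients are \<open>\<Sum>\<^sub>i (B\<^sub>i + 1) c\<^bsub>B + {#i#}\<^esub> \<delta>\<^sup>i \<xi>\<close>. By induction these are zero
  for all \<open>\<xi>\<close>, and the independence of the \<open>\<delta>\<^sup>i\<close> kills the leading coefficients of \<open>L\<close>.\<close>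

lemma dB_indep_lower:
  assumes "\<And>a. (\<Sum>B\<in>lower N. c B * dB B a) = 0" "size B < N"
  shows "c B = 0"
  using assms
proof (induction N arbitrary: c B)
  case 0
  then show ?case by simp
next
  case (Suc N)
  have lower_Suc: "lower (Suc N) = lower N \<union> multisets_of_size UNIV N"
    by (auto simp: lower_def multisets_of_size_def)
  have fin: "finite (multisets_of_size (UNIV :: 'm set) n)" for n by auto
  have split: "(\<Sum>B\<in>lower (Suc N). F B) = (\<Sum>B\<in>lower N. F B) + (\<Sum>B\<in>multisets_of_size UNIV N. F B)" for F :: "'m multiset \<Rightarrow> 'a"
    unfolding lower_Suc by (rule sum.union_disjoint) (auto simp: finite_lower, auto simp: lower_def multisets_of_size_def)
  have top: "c B = 0" if sB: "size B = N" for B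
  proof (cases N)
    case 0
    \<comment> \<open>In order zero the only coefficient is the value of the operator at 1.\<close>
    have "lower (Suc N) = {{#}}" using 0 by (auto simp: lower_def)
    then show ?thesis using Suc.prems(1)[of 1] sB 0 by simp
  next
    case (Suc M)
    obtain i0 B0 where B: "B = add_mset i0 B0" using sB Suc by (metis size_eq_Suc_imp_eq_union)
    have B0: "size B0 = M" using B sB Suc by simp
    have "(\<Sum>i\<in>UNIV. (c (add_mset i B0) * of_nat (count B0 i + 1)) * (\<delta> $ i) \<xi>) = 0" for \<xi>
    proof -
      have "\<forall>B. \<exists>L. L \<in> ops (size B - 1) \<and> (\<forall>a. dB B (\<xi> * a) = \<xi> * dB B a +
        (\<Sum>i\<in>UNIV. of_nat (count B i) * (\<delta> $ i) \<xi> * dB (B - {#i#}) a) + L a)"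
        using leibniz[where \<xi> = \<xi>] by blast
      from choice[OF this] obtain L where L: "\<And>B. L B \<in> ops (size B - 1)" "\<And>B a. dB B (\<xi> * a) = \<xi> * dB B a +
        (\<Sum>i\<in>UNIV. of_nat (count B i) * (\<delta> $ i) \<xi> * dB (B - {#i#}) a) + L B a"
        by blast
      define S where "S B a = (\<Sum>i\<in>UNIV. of_nat (count B i) * (\<delta> $ i) \<xi> * dB (B - {#i#}) a)" for B a
      \<comment> \<open>The part of the commutator of order below M: the single-derivative terms of
        the monomials below the top order, and all Leibniz remainders.\<close>
      define R where "R a = (\<Sum>B\<in>lower N. c B * S B a) + (\<Sum>B\<in>lower (Suc N). c B * L B a)" for a
      have "(\<lambda>a. S B a) \<in> ops M" if "B \<in> lower N" for B
        unfolding S_def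
      proof (rule ops_sum)
        fix i
        show "(\<lambda>a. of_nat (count B i) * (\<delta> $ i) \<xi> * dB (B - {#i#}) a) \<in> ops M"
        proof (cases "i \<in># B")
          case True
          then have "size (B - {#i#}) < size B" by (rule size_Diff1_less)
          then show ?thesis using that Suc by (intro ops_basic) (auto simp: lower_def)
        next
          case False
          then show ?thesis by (simp add: not_in_iff ops_zero)
        qed
      qed
      moreover have "L B \<in> ops M" if "B \<in> lower (Suc N)" for B
        using L(1)[of B] that Suc by (auto simp: lower_def intro: ops_mono)
      ultimately have "R \<in> ops M"
        unfolding R_def[abs_def] by (intro ops_add ops_sum ops_scale)
      then obtain e where e: "\<And>a. R a = (\<Sum>B\<in>lower M. e B * dB B a)"
        by (auto simp: ops_def)
      define t where "t B = (\<Sum>i\<in>UNIV. (c (add_mset i B) * of_nat (count B i + 1)) * (\<delta> $ i) \<xi>)" for B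
      have tops: "(\<Sum>B\<in>multisets_of_size UNIV N. c B * S B a) = (\<Sum>B\<in>multisets_of_size UNIV M. t B * dB B a)" for a
      proof -
        \<comment> \<open>Reindexing by removal of one i from the multiset; the terms with i outside
          \<open>B\<close> have multiplicity 0.\<close>
        have "(\<Sum>B\<in>multisets_of_size UNIV N. c B * (of_nat (count B i) * (\<delta> $ i) \<xi> * dB (B - {#i#}) a)) =
          (\<Sum>B\<in>multisets_of_size UNIV M. c (add_mset i B) * of_nat (count B i + 1) * (\<delta> $ i) \<xi> * dB B a)" (is "?l = ?r") for i
        proof -
          have sub: "B \<in> add_mset i ` multisets_of_size UNIV M" if "B \<in> multisets_of_size UNIV N" "i \<in># B" for B
            using that Suc by (intro image_eqI[of _ _ "B - {#i#}"]) (auto simp: multisets_of_size_def size_Diff_singleton)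
          have "?l = (\<Sum>B\<in>add_mset i ` multisets_of_size UNIV M. c B * (of_nat (count B i) * (\<delta> $ i) \<xi> * dB (B - {#i#}) a))"
            using Suc sub by (intro sum.mono_neutral_right fin) (auto simp: multisets_of_size_def not_in_iff[symmetric])
          also have "\<dots> = ?r"
            by (subst sum.reindex) (auto simp: inj_on_def mult_ac)
          finally show ?thesis .
        qed
        then show ?thesis
          unfolding S_def t_def sum_distrib_left sum_distrib_right
          by (subst sum.swap, subst (2) sum.swap) simp
      qed
      \<comment> \<open>The commutator with \<xi> in normal form, with coefficients t in order M and
        e below; the induction hypothesis applies to it.\<close>
      have "(\<Sum>B\<in>lower N. (if size B = M then t B else e B) * dB B a) = 0" for a
      proof -
        have lowN: "lower N = lower M \<union> multisets_of_size UNIV M"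
          using Suc by (auto simp: lower_def multisets_of_size_def)
        have "(\<Sum>B\<in>lower N. (if size B = M then t B else e B) * dB B a) =
          (\<Sum>B\<in>lower M. (if size B = M then t B else e B) * dB B a) + (\<Sum>B\<in>multisets_of_size UNIV M. (if size B = M then t B else e B) * dB B a)"
          unfolding lowN by (rule sum.union_disjoint) (auto simp: finite_lower, auto simp: lower_def multisets_of_size_def)
        also have "(\<Sum>B\<in>lower M. (if size B = M then t B else e B) * dB B a) = R a"
          unfolding e by (rule sum.cong) (auto simp: lower_def)
        also have "(\<Sum>B\<in>multisets_of_size UNIV M. (if size B = M then t B else e B) * dB B a) = (\<Sum>B\<in>multisets_of_size UNIV N. c B * S B a)"
          unfolding tops by (rule sum.cong) (auto simp: multisets_of_size_def)
        also have "R a + \<dots> = (\<Sum>B\<in>lower (Suc N). c B * (S B a + L B a))"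
          unfolding R_def by (simp add: split distrib_left sum.distrib)
        also have "\<dots> = (\<Sum>B\<in>lower (Suc N). c B * dB B (\<xi> * a) - \<xi> * (c B * dB B a))"
          by (rule sum.cong) (auto simp: L(2) S_def algebra_simps)
        also have "\<dots> = 0"
          using Suc.prems(1) by (simp add: sum_subtractf flip: sum_distrib_left)
        finally show ?thesis .
      qed
      then have "(if size B0 = M then t B0 else e B0) = 0"
        by (rule Suc.IH) (simp add: B0 Suc)
      then show ?thesis by (simp add: B0 t_def)
    qed
    then have "c (add_mset i0 B0) * of_nat (count B0 i0 + 1) = 0"
      by (rule good_frame_indep[OF good])
    \<comment> \<open>Multiplicity plus one is a positive integer, hence nonzero in characteristic
      zero.\<close>
    then show ?thesis by (simp add: B del: of_nat_add of_nat_Suc)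
  qed
  have "(\<Sum>B\<in>lower N. c B * dB B a) = 0" for a
    using Suc.prems(1)[of a] split[of "\<lambda>B. c B * dB B a"] top by (simp add: multisets_of_size_def)
  then have "size B < N \<Longrightarrow> c B = 0" by (rule Suc.IH)
  then show ?case using top[of B] Suc.prems(2) by (cases "size B = N") auto
qed

lemma dB_indep:
  assumes "finite S" "\<And>a. (\<Sum>B\<in>S. c B * dB B a) = 0" "B \<in> S"
  shows "c B = 0"
proof -
  obtain N where N: "\<And>B. B \<in> S \<Longrightarrow> size B < N"
    using finite_nat_set_iff_bounded[of "size ` S"] assms(1) by auto
  have "(\<Sum>B\<in>lower N. (if B \<in> S then c B else 0) * dB B a) = (\<Sum>B\<in>S. c B * dB B a)" for a
    by (rule sum.mono_neutral_cong_right[OF finite_lower]) (use N in \<open>auto simp: lower_def\<close>)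
  then have "(\<Sum>B\<in>lower N. (if B \<in> S then c B else 0) * dB B a) = 0" for a
    by (simp only: assms(2))
  from dB_indep_lower[OF this N[OF assms(3)]] have "(if B \<in> S then c B else 0) = 0" .
  then show ?thesis using assms(3) by simp
qed

end

section \<open>The field of differential rational functions\<close>

lemma constants_basic:
  assumes "\<And>i. derivation (D $ i)"
  shows "0 \<in> constants D" "1 \<in> constants D" "- 1 \<in> constants D"
  using assms by (auto simp: constants_def derivation_simps)

definition frac_at :: "('a::field, 'm::finite) der_col \<Rightarrow> ('a, 'm, 'l) dfrac \<Rightarrow> 'a ^ 'l \<Rightarrow> 'a" where
  "frac_at D r v = deval D (fst r) (($) v) / deval D (snd r) (($) v)"

text \<open>\<open>W_irr\<close> is irreducibility and \<open>W0_dense\<close> is density, both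
  tested on the basic open sets of the differential Zariski topology. The polynomials in them have
  coefficients in all of F, not only constant ones.\<close>

locale ratfun =
  fixes D :: "('a::field, 'm::finite) der_col" and W W0 :: "('a ^ 'l::finite) set"
  assumes D_derivation: "\<And>i. derivation (D $ i)"
    and W_ne: "W \<noteq> {}"
    and W_irr: "\<And>p q. \<exists>v\<in>W. deval D p (($) v) \<noteq> 0 \<Longrightarrow> \<exists>v\<in>W. deval D q (($) v) \<noteq> 0 \<Longrightarrow>
      \<exists>v\<in>W. deval D p (($) v) \<noteq> 0 \<and> deval D q (($) v) \<noteq> 0"
    and W0_sub: "W0 \<subseteq> W"
    and W0_dense: "\<And>p. \<exists>v\<in>W. deval D p (($) v) \<noteq> 0 \<Longrightarrow> \<exists>v\<in>W0. deval D p (($) v) \<noteq> 0"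
begin

abbreviation "cls \<equiv> ratfun_class D W"
abbreviation "K \<equiv> ratfun_field D W"
abbreviation "C \<equiv> constants D"

lemmas C_basic = constants_basic[OF D_derivation]

definition dense :: "('a ^ 'l) set \<Rightarrow> bool" where
  "dense S \<longleftrightarrow> S \<subseteq> W0 \<and>
     (\<forall>p. (\<exists>v\<in>W. deval D p (($) v) \<noteq> 0) \<longrightarrow> (\<exists>v\<in>S. deval D p (($) v) \<noteq> 0))"

lemma dense_W0: "dense W0"
  using W0_dense by (auto simp: dense_def)

lemma dense_sub: "dense S \<Longrightarrow> S \<subseteq> W0"
  by (auto simp: dense_def)

lemma dense_witness: "dense S \<Longrightarrow> \<exists>v\<in>W. deval D p (($) v) \<noteq> 0 \<Longrightarrow> \<exists>v\<in>S. deval D p (($) v) \<noteq> 0"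
  by (auto simp: dense_def)

lemma dense_ne: "dense S \<Longrightarrow> S \<noteq> {}"
  using dense_witness[of S "Const 1"] W_ne by auto

text \<open>A nonempty open subset of an irreducible space is dense. In this way poles and zeros are
  discarded whenever a class is turned into a function.\<close>

lemma dense_nonzero:
  assumes "dense S" "\<exists>v\<in>W. deval D q (($) v) \<noteq> 0"
  shows "dense {v\<in>S. deval D q (($) v) \<noteq> 0}"
  unfolding dense_def
proof safe
  fix p v assume "v \<in> W" "deval D p (($) v) \<noteq> 0"
  then have "\<exists>v\<in>W. deval D p (($) v) \<noteq> 0 \<and> deval D q (($) v) \<noteq> 0"
    using W_irr assms(2) by blast
  then have "\<exists>v\<in>W. deval D (Mul p q) (($) v) \<noteq> 0" by simp
  then show "\<exists>v\<in>{v \<in> S. deval D q (($) v) \<noteq> 0}. deval D p (($) v) \<noteq> 0"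
    using dense_witness[OF assms(1)] by fastforce
qed (use assms(1) in \<open>auto simp: dense_def\<close>)

lemma equiv_rel: "equiv (dfracs D W) (dfrac_rel D W)"
proof (rule equivI)
  show "refl_on (dfracs D W) (dfrac_rel D W)"
    by (auto simp: refl_on_def dfrac_rel_def)
  show "sym (dfrac_rel D W)"
    by (auto simp: sym_def dfrac_rel_def)
  show "dfrac_rel D W \<subseteq> dfracs D W \<times> dfracs D W"
    by (auto simp: dfrac_rel_def)
  show "trans (dfrac_rel D W)"
  proof (rule transI, clarify)
    fix p q p' q' p'' q''
    assume 1: "((p, q), (p', q')) \<in> dfrac_rel D W" and 2: "((p', q'), (p'', q'')) \<in> dfrac_rel D W"
    \<comment> \<open>On W the product of \<open>?t\<close> and the middle denominator
      \<open>q'\<close> is zero; irreducibility allows \<open>q'\<close> to be cancelled.\<close>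
    let ?t = "Add (Mul p q'') (Mul (Const (- 1)) (Mul p'' q))"
    have "deval D ?t (($) v) * deval D q' (($) v) = 0" if "v \<in> W" for v
    proof -
      have eq: "deval D p (($) v) * deval D q' (($) v) = deval D p' (($) v) * deval D q (($) v)"
        "deval D p'' (($) v) * deval D q' (($) v) = deval D p' (($) v) * deval D q'' (($) v)"
        using 1 2 that by (auto simp: dfrac_rel_def)
      have "deval D ?t (($) v) * deval D q' (($) v) =
          (deval D p (($) v) * deval D q' (($) v)) * deval D q'' (($) v) -
          (deval D p'' (($) v) * deval D q' (($) v)) * deval D q (($) v)"
        by (simp add: algebra_simps)
      also have "\<dots> = 0" unfolding eq by (simp add: mult_ac)
      finally show ?thesis .
    qed
    moreover have "\<exists>v\<in>W. deval D q' (($) v) \<noteq> 0"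
      using 1 by (auto simp: dfrac_rel_def dfracs_def)
    ultimately have "\<forall>v\<in>W. deval D ?t (($) v) = 0"
      using W_irr[of ?t q'] by (metis mult_eq_0_iff)
    then show "((p, q), (p'', q'')) \<in> dfrac_rel D W"
      using 1 2 by (auto simp: dfrac_rel_def)
  qed
qed

lemma cls_eq_iff:
  assumes "(p, q) \<in> dfracs D W" "(p', q') \<in> dfracs D W"
  shows "cls (p, q) = cls (p', q') \<longleftrightarrow>
    (\<forall>v\<in>W. deval D p (($) v) * deval D q' (($) v) = deval D p' (($) v) * deval D q (($) v))"
  unfolding ratfun_class_def
  by (subst eq_equiv_class_iff[OF equiv_rel assms]) (use assms in \<open>auto simp: dfrac_rel_def\<close>)

lemma cls_eqI:
  assumes r: "r \<in> dfracs D W" and s: "s \<in> dfracs D W" and S: "dense S"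
    and eq: "\<And>v. v \<in> S \<Longrightarrow> deval D (snd r) (($) v) \<noteq> 0 \<Longrightarrow> deval D (snd s) (($) v) \<noteq> 0 \<Longrightarrow>
      frac_at D r v = frac_at D s v"
  shows "cls r = cls s"
proof -
  obtain p q p' q' where rs: "r = (p, q)" "s = (p', q')" by (metis prod.exhaust)
  let ?t = "Add (Mul p q') (Mul (Const (- 1)) (Mul p' q))"
  have "\<forall>v\<in>W. deval D ?t (($) v) = 0"
  proof (rule ccontr)
    assume *: "\<not> ?thesis"
    have "dense {v \<in> {v \<in> S. deval D q (($) v) \<noteq> 0}. deval D q' (($) v) \<noteq> 0}"
      using r s S unfolding rs by (intro dense_nonzero) (auto simp: dfracs_def)
    then obtain v where "v \<in> S" "deval D q (($) v) \<noteq> 0" "deval D q' (($) v) \<noteq> 0" "deval D ?t (($) v) \<noteq> 0"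
      using * dense_witness[of _ ?t] by blast
    then show False using eq[of v] by (auto simp: frac_at_def rs frac_eq_eq)
  qed
  then show ?thesis using r s unfolding rs by (subst cls_eq_iff) auto
qed

lemma mem_cls:
  assumes "r \<in> dfracs D W" "s \<in> cls r"
  shows "s \<in> dfracs D W" "cls s = cls r"
proof -
  have "(r, s) \<in> dfrac_rel D W" using assms(2) by (simp add: ratfun_class_def)
  then show "s \<in> dfracs D W" "cls s = cls r"
    using equiv_class_eq[OF equiv_rel] by (auto simp: ratfun_class_def dfrac_rel_def)
qed

lemma cls_self: "r \<in> dfracs D W \<Longrightarrow> r \<in> cls r"
  unfolding ratfun_class_def using equiv_class_self[OF equiv_rel] by auto

lemma cls_frac_eq:
  assumes "r \<in> dfracs D W" "s \<in> cls r" "v \<in> W"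
    "deval D (snd r) (($) v) \<noteq> 0" "deval D (snd s) (($) v) \<noteq> 0"
  shows "frac_at D s v = frac_at D r v"
  using assms by (cases r; cases s) (auto simp: ratfun_class_def dfrac_rel_def frac_at_def frac_eq_eq)

section \<open>Classes as functions without poles on a set\<close>

definition rep :: "('a ^ 'l) set \<Rightarrow> ('a ^ 'l \<Rightarrow> 'a) \<Rightarrow> ('a, 'm, 'l) dfrac set \<Rightarrow> bool" where
  "rep S f A \<longleftrightarrow> (\<exists>r\<in>dfracs D W. A = cls r \<and>
     (\<forall>v\<in>S. deval D (snd r) (($) v) \<noteq> 0 \<and> f v = frac_at D r v))"

lemma rep_mono: "rep S f A \<Longrightarrow> T \<subseteq> S \<Longrightarrow> rep T f A"
  unfolding rep_def by blast

lemma rep_carrier: "rep S f A \<Longrightarrow> A \<in> carrier K"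
  by (auto simp: rep_def ratfun_field_def ratfun_class_def quotientI)

text \<open>With \<open>rep_inj\<close> this makes classes and functions interchangeable on a dense
  set, so identities in the field become identities between values in F.\<close>

lemma rep_unique:
  assumes "rep S f A" "rep S g B" "dense S" "\<And>v. v \<in> S \<Longrightarrow> f v = g v"
  shows "A = B"
proof -
  obtain r s where rs: "r \<in> dfracs D W" "s \<in> dfracs D W" "A = cls r" "B = cls s"
    "\<And>v. v \<in> S \<Longrightarrow> f v = frac_at D r v" "\<And>v. v \<in> S \<Longrightarrow> g v = frac_at D s v"
    using assms(1,2) unfolding rep_def by blast
  have "cls r = cls s"
    by (rule cls_eqI[OF rs(1,2) assms(3)]) (simp flip: rs(5,6) add: assms(4))
  then show ?thesis using rs(3,4) by simp
qed

lemma rep_inj: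
  assumes "rep S f A" "rep S g A" "v \<in> S" "S \<subseteq> W"
  shows "f v = g v"
proof -
  obtain r s where "r \<in> dfracs D W" "s \<in> dfracs D W" "A = cls r" "A = cls s"
    "f v = frac_at D r v" "g v = frac_at D s v"
     "deval D (snd r) (($) v) \<noteq> 0" "deval D (snd s) (($) v) \<noteq> 0"
    using assms unfolding rep_def by blast
  then show ?thesis using assms(3,4) cls_frac_eq[of r s v] cls_self[of s] by auto
qed

lemma rep_cls:
  assumes "(p, q) \<in> dfracs D W" "\<And>v. v \<in> S \<Longrightarrow> deval D q (($) v) \<noteq> 0"
  shows "rep S (frac_at D (p, q)) (cls (p, q))"
  using assms unfolding rep_def by force

lemma carrierE:
  assumes "A \<in> carrier K"
  obtains p q where "(p, q) \<in> dfracs D W" "A = cls (p, q)"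
proof -
  obtain r where "r \<in> dfracs D W" "A = cls r"
    using assms by (auto simp: ratfun_field_def quotient_def ratfun_class_def)
  then show ?thesis using that by (cases r) auto
qed

lemma ex_rep:
  assumes "A \<in> carrier K" "dense S"
  obtains T f where "dense T" "T \<subseteq> S" "rep T f A"
proof -
  obtain p q where pq: "(p, q) \<in> dfracs D W" "A = cls (p, q)" using carrierE[OF assms(1)] .
  let ?T = "{v\<in>S. deval D q (($) v) \<noteq> 0}"
  have "dense ?T" using pq(1) assms(2) by (intro dense_nonzero) (auto simp: dfracs_def)
  moreover have "rep ?T (frac_at D (p, q)) A" unfolding pq(2) by (rule rep_cls[OF pq(1)]) simp
  ultimately show ?thesis using that[of ?T] by blast
qed

lemma dfracs_mult:
  assumes "(p, q) \<in> dfracs D W" "(p', q') \<in> dfracs D W"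
  shows "(Mul p p', Mul q q') \<in> dfracs D W" "(Add (Mul p q') (Mul p' q), Mul q q') \<in> dfracs D W"
  using assms W_irr[of q q'] by (auto simp: dfracs_def)

lemma dfracs_der:
  assumes "(p, q) \<in> dfracs D W"
  shows "(Add (Mul (Der i p) q) (Mul (Const (- 1)) (Mul p (Der i q))), Mul q q) \<in> dfracs D W"
  using assms C_basic by (auto simp: dfracs_def)

text \<open>The operation is a union over all pairs of representatives. Every pair yields the same
  class, so the union collapses to it; \<open>add_cls\<close> and \<open>der_cls\<close> follow the
  same pattern.\<close>

lemma mult_cls:
  assumes r: "(p, q) \<in> dfracs D W" and s: "(p', q') \<in> dfracs D W"
  shows "cls (p, q) \<otimes>\<^bsub>K\<^esub> cls (p', q') = cls (Mul p p', Mul q q')"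
proof -
  have *: "cls (Mul a a', Mul b b') = cls (Mul p p', Mul q q')"
    if "(a, b) \<in> cls (p, q)" "(a', b') \<in> cls (p', q')" for a b a' b'
  proof (rule cls_eqI[OF _ _ dense_W0])
    fix v assume v: "v \<in> W0" "deval D (snd (Mul a a', Mul b b')) (($) v) \<noteq> 0"
      "deval D (snd (Mul p p', Mul q q')) (($) v) \<noteq> 0"
    then have "frac_at D (a, b) v = frac_at D (p, q) v" "frac_at D (a', b') v = frac_at D (p', q') v"
      using r s that W0_sub by (auto intro!: cls_frac_eq)
    then show "frac_at D (Mul a a', Mul b b') v = frac_at D (Mul p p', Mul q q') v"
      unfolding frac_at_def fst_conv snd_conv deval.simps times_divide_times_eq[symmetric] by simp
  qed (intro dfracs_mult r s mem_cls(1)[OF r that(1)] mem_cls(1)[OF s that(2)])+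
  have "cls (p, q) \<otimes>\<^bsub>K\<^esub> cls (p', q') = (\<Union>s\<in>cls (p, q). \<Union>s'\<in>cls (p', q'). cls (Mul (fst s) (fst s'), Mul (snd s) (snd s')))"
    by (simp add: ratfun_field_def case_prod_beta)
  also have "\<dots> = (\<Union>s\<in>cls (p, q). \<Union>s'\<in>cls (p', q'). cls (Mul p p', Mul q q'))"
    by (intro SUP_cong refl, rule *) auto
  also have "\<dots> = cls (Mul p p', Mul q q')" using cls_self[OF r] cls_self[OF s] by blast
  finally show ?thesis .
qed

lemma add_cls:
  assumes r: "(p, q) \<in> dfracs D W" and s: "(p', q') \<in> dfracs D W"
  shows "cls (p, q) \<oplus>\<^bsub>K\<^esub> cls (p', q') = cls (Add (Mul p q') (Mul p' q), Mul q q')"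
proof -
  have *: "cls (Add (Mul a b') (Mul a' b), Mul b b') = cls (Add (Mul p q') (Mul p' q), Mul q q')"
    if "(a, b) \<in> cls (p, q)" "(a', b') \<in> cls (p', q')" for a b a' b'
  proof (rule cls_eqI[OF _ _ dense_W0])
    fix v assume v: "v \<in> W0" "deval D (snd (Add (Mul a b') (Mul a' b), Mul b b')) (($) v) \<noteq> 0"
      "deval D (snd (Add (Mul p q') (Mul p' q), Mul q q')) (($) v) \<noteq> 0"
    then have "frac_at D (a, b) v = frac_at D (p, q) v" "frac_at D (a', b') v = frac_at D (p', q') v"
      using r s that W0_sub by (auto intro!: cls_frac_eq)
    then show "frac_at D (Add (Mul a b') (Mul a' b), Mul b b') v = frac_at D (Add (Mul p q') (Mul p' q), Mul q q') v"
      using v by (simp add: frac_at_def add_frac_eq[symmetric])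
  qed (intro dfracs_mult r s mem_cls(1)[OF r that(1)] mem_cls(1)[OF s that(2)])+
  have "cls (p, q) \<oplus>\<^bsub>K\<^esub> cls (p', q') = (\<Union>s\<in>cls (p, q). \<Union>s'\<in>cls (p', q'). cls (Add (Mul (fst s) (snd s')) (Mul (fst s') (snd s)), Mul (snd s) (snd s')))"
    by (simp add: ratfun_field_def case_prod_beta)
  also have "\<dots> = (\<Union>s\<in>cls (p, q). \<Union>s'\<in>cls (p', q'). cls (Add (Mul p q') (Mul p' q), Mul q q'))"
    by (intro SUP_cong refl, rule *) auto
  also have "\<dots> = cls (Add (Mul p q') (Mul p' q), Mul q q')" using cls_self[OF r] cls_self[OF s] by blast
  finally show ?thesis .
qed

lemma der_cls:
  assumes r: "(p, q) \<in> dfracs D W"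
  shows "ratfun_der D W i (cls (p, q)) = cls (Add (Mul (Der i p) q) (Mul (Const (- 1)) (Mul p (Der i q))), Mul q q)"
proof -
  have frac: "frac_at D (Add (Mul (Der i a) b) (Mul (Const (- 1)) (Mul a (Der i b))), Mul b b) v =
     (D $ i) (frac_at D (a, b) v)" if "deval D b (($) v) \<noteq> 0" for a b v
    using that by (simp add: frac_at_def derivation_divide D_derivation)
  have *: "cls (Add (Mul (Der i a) b) (Mul (Const (- 1)) (Mul a (Der i b))), Mul b b) =
     cls (Add (Mul (Der i p) q) (Mul (Const (- 1)) (Mul p (Der i q))), Mul q q)"
    if ab: "(a, b) \<in> cls (p, q)" for a b
  proof (rule cls_eqI[OF _ _ dense_W0])
    fix v assume v: "v \<in> W0"
      "deval D (snd (Add (Mul (Der i a) b) (Mul (Const (- 1)) (Mul a (Der i b))), Mul b b)) (($) v) \<noteq> 0"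
      "deval D (snd (Add (Mul (Der i p) q) (Mul (Const (- 1)) (Mul p (Der i q))), Mul q q)) (($) v) \<noteq> 0"
    then have "frac_at D (a, b) v = frac_at D (p, q) v"
      using r that W0_sub by (auto intro!: cls_frac_eq)
    then show "frac_at D (Add (Mul (Der i a) b) (Mul (Const (- 1)) (Mul a (Der i b))), Mul b b) v =
      frac_at D (Add (Mul (Der i p) q) (Mul (Const (- 1)) (Mul p (Der i q))), Mul q q) v"
      using v by (subst (1 2) frac) auto
  qed (intro dfracs_der r mem_cls(1)[OF r ab])+
  have "ratfun_der D W i (cls (p, q)) = (\<Union>s\<in>cls (p, q). cls (Add (Mul (Der i (fst s)) (snd s)) (Mul (Const (- 1)) (Mul (fst s) (Der i (snd s)))), Mul (snd s) (snd s)))"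
    by (simp add: ratfun_der_def case_prod_beta)
  also have "\<dots> = (\<Union>s\<in>cls (p, q). cls (Add (Mul (Der i p) q) (Mul (Const (- 1)) (Mul p (Der i q))), Mul q q))"
    by (intro SUP_cong refl, rule *) auto
  also have "\<dots> = cls (Add (Mul (Der i p) q) (Mul (Const (- 1)) (Mul p (Der i q))), Mul q q)"
    using cls_self[OF r] by blast
  finally show ?thesis .
qed

lemma repE:
  assumes "rep S f A"
  obtains p q where "(p, q) \<in> dfracs D W" "A = cls (p, q)"
    "\<And>v. v \<in> S \<Longrightarrow> deval D q (($) v) \<noteq> 0"
    "\<And>v. v \<in> S \<Longrightarrow> f v = deval D p (($) v) / deval D q (($) v)"
  using assms unfolding rep_def frac_at_def by fastforce

lemma repI:
  assumes "(p, q) \<in> dfracs D W"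
    "\<And>v. v \<in> S \<Longrightarrow> deval D q (($) v) \<noteq> 0"
    "\<And>v. v \<in> S \<Longrightarrow> f v = deval D p (($) v) / deval D q (($) v)"
  shows "rep S f (cls (p, q))"
  using assms unfolding rep_def frac_at_def by force

lemma rep_mult:
  assumes "rep S f A" "rep S g B"
  shows "rep S (\<lambda>v. f v * g v) (A \<otimes>\<^bsub>K\<^esub> B)"
  using assms(1)
proof (rule repE)
  fix p q assume 1: "(p, q) \<in> dfracs D W" "A = cls (p, q)"
    "\<And>v. v \<in> S \<Longrightarrow> deval D q (($) v) \<noteq> 0"
    "\<And>v. v \<in> S \<Longrightarrow> f v = deval D p (($) v) / deval D q (($) v)"
  obtain p' q' where 2: "(p', q') \<in> dfracs D W" "B = cls (p', q')"
    "\<And>v. v \<in> S \<Longrightarrow> deval D q' (($) v) \<noteq> 0"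
    "\<And>v. v \<in> S \<Longrightarrow> g v = deval D p' (($) v) / deval D q' (($) v)"
    using assms(2) by (rule repE) blast
  show ?thesis
    unfolding 1(2) 2(2) mult_cls[OF 1(1) 2(1)]
    by (rule repI) (use 1 2 in \<open>auto intro!: dfracs_mult\<close>)
qed

lemma rep_add:
  assumes "rep S f A" "rep S g B"
  shows "rep S (\<lambda>v. f v + g v) (A \<oplus>\<^bsub>K\<^esub> B)"
  using assms(1)
proof (rule repE)
  fix p q assume 1: "(p, q) \<in> dfracs D W" "A = cls (p, q)"
    "\<And>v. v \<in> S \<Longrightarrow> deval D q (($) v) \<noteq> 0"
    "\<And>v. v \<in> S \<Longrightarrow> f v = deval D p (($) v) / deval D q (($) v)"
  obtain p' q' where 2: "(p', q') \<in> dfracs D W" "B = cls (p', q')"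
    "\<And>v. v \<in> S \<Longrightarrow> deval D q' (($) v) \<noteq> 0"
    "\<And>v. v \<in> S \<Longrightarrow> g v = deval D p' (($) v) / deval D q' (($) v)"
    using assms(2) by (rule repE) blast
  show ?thesis
    unfolding 1(2) 2(2) add_cls[OF 1(1) 2(1)]
    by (rule repI) (use 1 2 in \<open>auto intro!: dfracs_mult simp: add_frac_eq\<close>)
qed

lemma rep_der:
  assumes "rep S f A"
  shows "rep S (\<lambda>v. (D $ i) (f v)) (ratfun_der D W i A)"
  using assms
proof (rule repE)
  fix p q assume 1: "(p, q) \<in> dfracs D W" "A = cls (p, q)"
    "\<And>v. v \<in> S \<Longrightarrow> deval D q (($) v) \<noteq> 0"
    "\<And>v. v \<in> S \<Longrightarrow> f v = deval D p (($) v) / deval D q (($) v)"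
  show ?thesis
    unfolding 1(2) der_cls[OF 1(1)]
    by (rule repI) (use 1 dfracs_der in \<open>auto simp: derivation_divide D_derivation\<close>)
qed

lemma rep_const: "c \<in> C \<Longrightarrow> rep S (\<lambda>v. c) (cls (Const c, Const 1))"
  by (rule repI) (use W_ne C_basic in \<open>auto simp: dfracs_def\<close>)

lemma rep_one: "rep S (\<lambda>v. 1) \<one>\<^bsub>K\<^esub>"
  and rep_zero: "rep S (\<lambda>v. 0) \<zero>\<^bsub>K\<^esub>"
  using rep_const[of 1] rep_const[of 0] C_basic by (auto simp: ratfun_field_def)

lemma rep_inverse:
  assumes "rep S f A" "\<And>v. v \<in> S \<Longrightarrow> f v \<noteq> 0" "S \<noteq> {}" "S \<subseteq> W"
  obtains B where "rep S (\<lambda>v. 1 / f v) B"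
  using assms(1)
proof (rule repE)
  fix p q assume 1: "(p, q) \<in> dfracs D W" "A = cls (p, q)"
    "\<And>v. v \<in> S \<Longrightarrow> deval D q (($) v) \<noteq> 0"
    "\<And>v. v \<in> S \<Longrightarrow> f v = deval D p (($) v) / deval D q (($) v)"
  have 2: "deval D p (($) v) \<noteq> 0" if "v \<in> S" for v
    using assms(2) that 1(4) by force
  have "\<exists>v\<in>W. deval D p (($) v) \<noteq> 0"
    using assms(3,4) 2 by blast
  then have "rep S (\<lambda>v. 1 / f v) (cls (q, p))"
    by (intro repI) (use 1 2 in \<open>auto simp: dfracs_def\<close>)
  then show ?thesis by (rule that)
qed

section \<open>The field axioms\<close>

lemma ex_rep2:
  assumes "A \<in> carrier K" "B \<in> carrier K"
  obtains T f g where "dense T" "rep T f A" "rep T g B"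
proof -
  obtain T f where 1: "dense T" "rep T f A" using ex_rep[OF assms(1) dense_W0] by blast
  obtain T' g where 2: "dense T'" "T' \<subseteq> T" "rep T' g B" using ex_rep[OF assms(2) 1(1)] by blast
  show ?thesis using that[OF 2(1) rep_mono[OF 1(2) 2(2)] 2(3)] .
qed

lemma ex_rep3:
  assumes "A \<in> carrier K" "B \<in> carrier K" "E \<in> carrier K"
  obtains T f g h where "dense T" "rep T f A" "rep T g B" "rep T h E"
proof -
  obtain T f g where 1: "dense T" "rep T f A" "rep T g B" using ex_rep2[OF assms(1,2)] by blast
  obtain T' h where 2: "dense T'" "T' \<subseteq> T" "rep T' h E" using ex_rep[OF assms(3) 1(1)] by blast
  show ?thesis using that[OF 2(1) rep_mono[OF 1(2) 2(2)] rep_mono[OF 1(3) 2(2)] 2(3)] .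
qed

lemma K_closed:
  assumes "A \<in> carrier K" "B \<in> carrier K"
  shows "A \<oplus>\<^bsub>K\<^esub> B \<in> carrier K" "A \<otimes>\<^bsub>K\<^esub> B \<in> carrier K"
  by (rule ex_rep2[OF assms], rule rep_carrier, rule rep_add rep_mult, assumption, assumption)+

text \<open>Each axiom is checked on a dense set on which all classes involved are functions; there
  it is an axiom of F.\<close>

lemma K_cring: "cring K"
proof (rule cringI)
  show "abelian_group K"
  proof (rule abelian_groupI)
    show "\<zero>\<^bsub>K\<^esub> \<in> carrier K" using rep_carrier[OF rep_zero] .
  next
    fix A B E assume "A \<in> carrier K" "B \<in> carrier K" "E \<in> carrier K"
    then show "(A \<oplus>\<^bsub>K\<^esub> B) \<oplus>\<^bsub>K\<^esub> E = A \<oplus>\<^bsub>K\<^esub> (B \<oplus>\<^bsub>K\<^esub> E)"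
      by (rule ex_rep3) (rule rep_unique, (rule rep_add | assumption)+, simp)
  next
    fix A B assume "A \<in> carrier K" "B \<in> carrier K"
    then show "A \<oplus>\<^bsub>K\<^esub> B = B \<oplus>\<^bsub>K\<^esub> A"
      by (rule ex_rep2) (rule rep_unique, (rule rep_add | assumption)+, simp)
  next
    fix A assume A: "A \<in> carrier K"
    obtain T f where 1: "dense T" "rep T f A" using ex_rep[OF A dense_W0] by blast
    show "\<zero>\<^bsub>K\<^esub> \<oplus>\<^bsub>K\<^esub> A = A"
      by (rule rep_unique[OF rep_add[OF rep_zero 1(2)] 1(2) 1(1)]) simp
    have m: "rep T (\<lambda>v. - 1 * f v) (cls (Const (- 1), Const 1) \<otimes>\<^bsub>K\<^esub> A)"
      by (intro rep_mult rep_const C_basic 1)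
    show "\<exists>B\<in>carrier K. B \<oplus>\<^bsub>K\<^esub> A = \<zero>\<^bsub>K\<^esub>"
      by (rule bexI[OF _ rep_carrier[OF m]], rule rep_unique[OF rep_add[OF m 1(2)] rep_zero 1(1)]) simp
  qed (rule K_closed)
  show "comm_monoid K"
  proof (rule comm_monoidI)
    show "\<one>\<^bsub>K\<^esub> \<in> carrier K" using rep_carrier[OF rep_one] .
  next
    fix A B E assume "A \<in> carrier K" "B \<in> carrier K" "E \<in> carrier K"
    then show "(A \<otimes>\<^bsub>K\<^esub> B) \<otimes>\<^bsub>K\<^esub> E = A \<otimes>\<^bsub>K\<^esub> (B \<otimes>\<^bsub>K\<^esub> E)"
      by (rule ex_rep3) (rule rep_unique, (rule rep_mult | assumption)+, simp)
  next
    fix A B assume "A \<in> carrier K" "B \<in> carrier K"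
    then show "A \<otimes>\<^bsub>K\<^esub> B = B \<otimes>\<^bsub>K\<^esub> A"
      by (rule ex_rep2) (rule rep_unique, (rule rep_mult | assumption)+, simp)
  next
    fix A assume A: "A \<in> carrier K"
    obtain T f where 1: "dense T" "rep T f A" using ex_rep[OF A dense_W0] by blast
    show "\<one>\<^bsub>K\<^esub> \<otimes>\<^bsub>K\<^esub> A = A"
      by (rule rep_unique[OF rep_mult[OF rep_one 1(2)] 1(2) 1(1)]) simp
  qed (rule K_closed)
next
  fix A B E assume "A \<in> carrier K" "B \<in> carrier K" "E \<in> carrier K"
  then show "(A \<oplus>\<^bsub>K\<^esub> B) \<otimes>\<^bsub>K\<^esub> E = A \<otimes>\<^bsub>K\<^esub> E \<oplus>\<^bsub>K\<^esub> B \<otimes>\<^bsub>K\<^esub> E"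
    by (rule ex_rep3) (rule rep_unique, (rule rep_mult rep_add | assumption)+, simp add: algebra_simps)
qed

lemma nonzero_rep:
  assumes "rep S f A" "dense S" "A \<noteq> \<zero>\<^bsub>K\<^esub>"
  obtains T where "dense T" "T \<subseteq> S" "\<And>v. v \<in> T \<Longrightarrow> f v \<noteq> 0"
  using assms(1)
proof (rule repE)
  fix p q assume 1: "(p, q) \<in> dfracs D W" "A = cls (p, q)"
    "\<And>v. v \<in> S \<Longrightarrow> deval D q (($) v) \<noteq> 0"
    "\<And>v. v \<in> S \<Longrightarrow> f v = deval D p (($) v) / deval D q (($) v)"
  have "\<exists>v\<in>S. f v \<noteq> 0"
    using rep_unique[OF assms(1) rep_zero assms(2)] assms(3) by blast
  then have "\<exists>v\<in>W. deval D p (($) v) \<noteq> 0"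
    using 1(4) dense_sub[OF assms(2)] W0_sub by fastforce
  then have "dense {v\<in>S. deval D p (($) v) \<noteq> 0}" by (intro dense_nonzero assms)
  then show ?thesis using that[of "{v\<in>S. deval D p (($) v) \<noteq> 0}"] 1 by auto
qed

lemma rep_divide:
  assumes "rep S f A" "rep S g B" "dense S" "\<And>v. v \<in> S \<Longrightarrow> h v * g v = f v" "rep S h E" "\<exists>v\<in>S. g v \<noteq> 0"
  shows "E \<otimes>\<^bsub>K\<^esub> B = A" "B \<noteq> \<zero>\<^bsub>K\<^esub>"
proof -
  show "E \<otimes>\<^bsub>K\<^esub> B = A"
    by (rule rep_unique[OF rep_mult[OF assms(5,2)] assms(1,3)]) (rule assms)
  show "B \<noteq> \<zero>\<^bsub>K\<^esub>"
    using rep_inj[OF assms(2), of "\<lambda>v. 0"] assms(6) rep_zero[of S] dense_sub[OF assms(3)] W0_sub by blast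
qed

lemma K_field: "Ring.field K"
proof (rule cring.cring_fieldI2[OF K_cring])
  show "\<zero>\<^bsub>K\<^esub> \<noteq> \<one>\<^bsub>K\<^esub>"
    using rep_inj[OF rep_zero[of W0], of "\<lambda>v. 1"] rep_one[of W0] W0_sub dense_ne[OF dense_W0] by force
next
  fix A assume A: "A \<in> carrier K" "A \<noteq> \<zero>\<^bsub>K\<^esub>"
  obtain T f where 1: "dense T" "rep T f A" using ex_rep[OF A(1) dense_W0] by blast
  obtain S where S: "dense S" "S \<subseteq> T" "\<And>v. v \<in> S \<Longrightarrow> f v \<noteq> 0"
    using nonzero_rep[OF 1(2) 1(1) A(2)] by blast
  have 2: "rep S f A" using rep_mono 1 S by blast
  obtain B where B: "rep S (\<lambda>v. 1 / f v) B"
    using rep_inverse[OF 2] S dense_ne[OF S(1)] dense_sub[OF S(1)] W0_sub by blast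
  show "\<exists>B\<in>carrier K. A \<otimes>\<^bsub>K\<^esub> B = \<one>\<^bsub>K\<^esub>"
    by (rule bexI[OF _ rep_carrier[OF B]], rule rep_unique[OF rep_mult[OF 2 B] rep_one S(1)])
      (use S in auto)
qed

sublocale K: Ring.field K by (rule K_field)

lemma rep_finsum:
  assumes "finite I" "\<And>i. i \<in> I \<Longrightarrow> rep S (f i) (A i)"
  shows "rep S (\<lambda>v. \<Sum>i\<in>I. f i v) (\<Oplus>\<^bsub>K\<^esub>i\<in>I. A i)"
  using assms
proof (induction I)
  case empty
  then show ?case by (simp add: rep_zero)
next
  case (insert i I)
  have "A j \<in> carrier K" if "j \<in> insert i I" for j
    using insert.prems that rep_carrier by blast
  then have "(\<Oplus>\<^bsub>K\<^esub>j\<in>insert i I. A j) = A i \<oplus>\<^bsub>K\<^esub> (\<Oplus>\<^bsub>K\<^esub>j\<in>I. A j)"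
    using insert.hyps by (intro K.finsum_insert) auto
  then show ?case using insert by (auto intro!: rep_add)
qed

lemma rep_mat_der:
  assumes "\<And>j. rep S (\<lambda>v. M v $ i $ j) (Q i j)" "rep S f A"
  shows "rep S (\<lambda>v. ((M v **\<^sub>d D) $ i) (f v)) (ratfun_mat_der D W Q i A)"
  unfolding ratfun_mat_der_def mat_der_nth
  by (intro rep_finsum rep_mult rep_der assms) auto

text \<open>\<open>ratfun_of\<close> collects every fraction that agrees with f off its own poles.
  By density this is exactly the class of the given fraction, which has no poles on W0.\<close>

lemma ratfun_of_rep:
  assumes "rat_on C ({D} \<times> W0) ($) (\<lambda>\<delta>. f)"
  shows "rep W0 f (ratfun_of D W W0 f)"
  using assms
proof (rule rat_onE)
  fix p q
  assume pq: "dcoeffs p \<subseteq> C" "dcoeffs q \<subseteq> C"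
   "\<And>\<delta> v. (\<delta>, v) \<in> {D} \<times> W0 \<Longrightarrow> deval \<delta> q (($) v) \<noteq> 0"
   "\<And>\<delta> v. (\<delta>, v) \<in> {D} \<times> W0 \<Longrightarrow> f v = deval \<delta> p (($) v) / deval \<delta> q (($) v)"
  have dfr: "(p, q) \<in> dfracs D W"
    using pq dense_ne[OF dense_W0] W0_sub by (force simp: dfracs_def)
  have "ratfun_of D W W0 f = cls (p, q)"
  proof (intro subset_antisym subsetI)
    fix s assume s: "s \<in> cls (p, q)"
    then have "f v = frac_at D s v" if "v \<in> W0" "deval D (snd s) (($) v) \<noteq> 0" for v
      using cls_frac_eq[OF dfr s, of v] that pq W0_sub by (auto simp: frac_at_def)
    then show "s \<in> ratfun_of D W W0 f"
      using mem_cls(1)[OF dfr s] by (auto simp: ratfun_of_def frac_at_def)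
  next
    fix s assume s: "s \<in> ratfun_of D W W0 f"
    then have sd: "s \<in> dfracs D W" by (auto simp: ratfun_of_def)
    have "cls s = cls (p, q)"
      by (rule cls_eqI[OF sd dfr dense_W0]) (use s pq in \<open>auto simp: ratfun_of_def frac_at_def\<close>)
    then show "s \<in> cls (p, q)" using cls_self[OF sd] by simp
  qed
  then show ?thesis using pq by (auto intro!: repI dfr)
qed

end

section \<open>Polynomial expressions\<close>

text \<open>The coefficients will be functions of a point, so one expression describes a family of
  polynomials and a formal operation such as \<open>pd\<close> acts at all points at once.\<close>

datatype (pcoeffs: 'c, pvars: 'x) pexp =
    PC 'c
  | PV 'x
  | PAdd "('c, 'x) pexp" "('c, 'x) pexp"
  | PMul "('c, 'x) pexp" "('c, 'x) pexp"

primrec pev :: "'b \<Rightarrow> ('x \<Rightarrow> 'a::field) \<Rightarrow> ('b \<Rightarrow> 'a, 'x) pexp \<Rightarrow> 'a" where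
  "pev v u (PC c) = c v"
| "pev v u (PV x) = u x"
| "pev v u (PAdd a b) = pev v u a + pev v u b"
| "pev v u (PMul a b) = pev v u a * pev v u b"

text \<open>A bound for the degree read off the syntax, blind to cancellation. It is 0 exactly when
  no variable occurs.\<close>

primrec pdeg :: "('c, 'x) pexp \<Rightarrow> nat" where
  "pdeg (PC c) = 0"
| "pdeg (PV x) = 1"
| "pdeg (PAdd a b) = max (pdeg a) (pdeg b)"
| "pdeg (PMul a b) = pdeg a + pdeg b"

text \<open>The case distinction for products makes \<open>pdeg\<close> drop even when
  one factor is constant.\<close>

primrec pd :: "'x \<Rightarrow> ('b \<Rightarrow> 'a::field, 'x) pexp \<Rightarrow> ('b \<Rightarrow> 'a, 'x) pexp" where
  "pd x (PC c) = PC (\<lambda>_. 0)"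
| "pd x (PV y) = PC (\<lambda>_. if x = y then 1 else 0)"
| "pd x (PAdd a b) = PAdd (pd x a) (pd x b)"
| "pd x (PMul a b) =
    (if pdeg a = 0 then PMul a (pd x b)
     else if pdeg b = 0 then PMul (pd x a) b
     else PAdd (PMul (pd x a) b) (PMul a (pd x b)))"

lemma pdeg_pd: "pdeg (pd x e) \<le> pdeg e - 1"
  by (induction e) auto

text \<open>Only 0 and 1 arise as new coefficients, so differentiation does not leave a coefficient
  ring.\<close>

lemma pcoeffs_pd: "pcoeffs (pd x e) \<subseteq> insert (\<lambda>_. 0) (insert (\<lambda>_. 1) (pcoeffs e))"
  by (induction e) auto

lemma finite_pvars: "finite (pvars e)"
  by (induction e) auto

lemma pev_deg0: "pdeg e = 0 \<Longrightarrow> pev v u e = pev v u' e"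
  by (induction e) auto

text \<open>The chain rule along a line, with a univariate polynomial in t and its formal
  derivative. \<open>V\<close> may be any finite superset of the variables, so that the two parts of
  a sum or product can share it.\<close>

lemma pev_line:
  fixes e :: "('b \<Rightarrow> 'a::field_char_0, 'x) pexp"
  shows "\<exists>\<pi>. (\<forall>t. poly \<pi> t = pev v (\<lambda>x. u x + t * w x) e) \<and>
    (\<forall>t V. finite V \<longrightarrow> pvars e \<subseteq> V \<longrightarrow>
       poly (pderiv \<pi>) t = (\<Sum>x\<in>V. pev v (\<lambda>x. u x + t * w x) (pd x e) * w x))"
proof (induction e)
  case (PC c)
  show ?case by (rule exI[of _ "[:c v:]"]) simp
next
  case (PV y)
  show ?case
  proof (rule exI[of _ "[:u y, w y:]"], intro conjI allI impI)
    fix t and V :: "'x set" assume "finite V" "pvars (PV y) \<subseteq> V"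
    then have "(\<Sum>x\<in>V. (if x = y then 1 else 0) * w x) = w y"
      by (simp add: if_distrib[of "\<lambda>x. x * _"] cong: if_cong)
    then show "poly (pderiv [:u y, w y:]) t = (\<Sum>x\<in>V. pev v (\<lambda>x. u x + t * w x) (pd x (PV y)) * w x)"
      by (simp add: pderiv_pCons)
  qed simp
next
  case (PAdd a b)
  then obtain \<pi> \<rho> where *: "\<forall>t. poly \<pi> t = pev v (\<lambda>x. u x + t * w x) a"
    "\<forall>t. poly \<rho> t = pev v (\<lambda>x. u x + t * w x) b"
    "\<forall>t V. finite V \<longrightarrow> pvars a \<subseteq> V \<longrightarrow>
       poly (pderiv \<pi>) t = (\<Sum>x\<in>V. pev v (\<lambda>x. u x + t * w x) (pd x a) * w x)"
    "\<forall>t V. finite V \<longrightarrow> pvars b \<subseteq> V \<longrightarrow>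
       poly (pderiv \<rho>) t = (\<Sum>x\<in>V. pev v (\<lambda>x. u x + t * w x) (pd x b) * w x)"
    by blast
  then show ?case
    by (intro exI[of _ "\<pi> + \<rho>"]) (auto simp: pderiv_add distrib_right sum.distrib)
next
  case (PMul a b)
  then obtain \<pi> \<rho> where *: "\<forall>t. poly \<pi> t = pev v (\<lambda>x. u x + t * w x) a"
    "\<forall>t. poly \<rho> t = pev v (\<lambda>x. u x + t * w x) b"
    "\<forall>t V. finite V \<longrightarrow> pvars a \<subseteq> V \<longrightarrow>
       poly (pderiv \<pi>) t = (\<Sum>x\<in>V. pev v (\<lambda>x. u x + t * w x) (pd x a) * w x)"
    "\<forall>t V. finite V \<longrightarrow> pvars b \<subseteq> V \<longrightarrow>
       poly (pderiv \<rho>) t = (\<Sum>x\<in>V. pev v (\<lambda>x. u x + t * w x) (pd x b) * w x)"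
    by blast
  \<comment> \<open>\<open>pd\<close> omits the term in which a factor without variables would be
    differentiated. Along the line such a factor is a constant polynomial, so nothing is
    lost.\<close>
  have const: "pderiv \<sigma> = 0"
    if "\<forall>t. poly \<sigma> t = pev v (\<lambda>x. u x + t * w x) e" "pdeg e = 0" for \<sigma> and e :: "('b \<Rightarrow> 'a, 'x) pexp"
  proof -
    have "poly \<sigma> t = poly [:poly \<sigma> 0:] t" for t
      using that(1) pev_deg0[OF that(2), of v "\<lambda>x. u x + t * w x" "\<lambda>x. u x + 0 * w x"] by simp
    then have "\<sigma> = [:poly \<sigma> 0:]" by (simp flip: poly_eq_poly_eq_iff add: fun_eq_iff)
    then show ?thesis by (metis pderiv_singleton)
  qed
  show ?case
  proof (rule exI[of _ "\<pi> * \<rho>"], intro conjI allI impI)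
    fix t show "poly (\<pi> * \<rho>) t = pev v (\<lambda>x. u x + t * w x) (PMul a b)"
      using * by simp
  next
    fix t and V :: "'x set" assume V: "finite V" "pvars (PMul a b) \<subseteq> V"
    let ?u = "\<lambda>x. u x + t * w x"
    have da: "poly (pderiv \<pi>) t = (\<Sum>x\<in>V. pev v ?u (pd x a) * w x)"
      and db: "poly (pderiv \<rho>) t = (\<Sum>x\<in>V. pev v ?u (pd x b) * w x)"
      using * V by auto
    have "poly (pderiv (\<pi> * \<rho>)) t = pev v ?u a * poly (pderiv \<rho>) t + pev v ?u b * poly (pderiv \<pi>) t"
      using * by (simp add: pderiv_mult)
    also have "\<dots> = (\<Sum>x\<in>V. pev v ?u (pd x (PMul a b)) * w x)"
    proof -
      consider (a) "pdeg a = 0" | (b) "pdeg a \<noteq> 0" "pdeg b = 0" | (c) "pdeg a \<noteq> 0" "pdeg b \<noteq> 0" by blast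
      then show ?thesis
      proof cases
        case a
        then show ?thesis using const[OF *(1) a] db by (simp add: sum_distrib_left mult.assoc)
      next
        case b
        then show ?thesis using const[OF *(2) b(2)] da by (simp add: sum_distrib_left mult_ac)
      next
        case c
        then show ?thesis unfolding da db by (simp add: sum_distrib_left sum.distrib algebra_simps)
      qed
    qed
    finally show "poly (pderiv (\<pi> * \<rho>)) t = (\<Sum>x\<in>V. pev v ?u (pd x (PMul a b)) * w x)" .
  qed
qed

section \<open>Jets of the group elements\<close>

text \<open>Coordinates on \<open>GL(n) \<times> GL\<^sup>\<delta>(m)\<close>: \<open>Inl ((i, j), B)\<close> stands for \<open>\<delta>\<^sup>B h\<^sub>i\<^sub>j\<close>, and
  \<open>Inr (k, B + {#j#})\<close> for \<open>\<delta>\<^sup>B g\<^sub>j\<^sub>k\<close>, which depends on \<open>j\<close> only through \<open>B + {#j#}\<close>.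
  In these coordinates there are no further relations. The coordinate \<open>Inr (k, {#})\<close> is
  a dummy.\<close>

fun jet :: "('a::field, 'm::finite) der_col \<Rightarrow> 'a ^ 'n ^ 'n \<Rightarrow> 'a ^ 'm ^ 'm \<Rightarrow>
    ('n \<times> 'n) \<times> 'm multiset + 'm \<times> 'm multiset \<Rightarrow> 'a" where
  "jet \<delta> h g (Inl ((i, j), B)) = iter_der \<delta> B (h $ i $ j)"
| "jet \<delta> h g (Inr (k, G)) = (if G = {#} then 0
     else iter_der \<delta> (G - {#SOME j. j \<in># G#}) (g $ (SOME j. j \<in># G) $ k))"

definition line_mat :: "'a::field ^ 'k ^ 'k \<Rightarrow> 'a ^ 'k ^ 'k \<Rightarrow> 'a \<Rightarrow> 'a ^ 'k ^ 'k" where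
  "line_mat h \<eta> t = (\<chi> i j. h $ i $ j + t * \<eta> $ i $ j)"

text \<open>The determinant of h + t \<eta> is a polynomial in t whose value at 0 is det h, so it is
  not the zero polynomial.\<close>

lemma finite_singular_line:
  fixes h :: "'a::field_char_0 ^ 'k ^ 'k"
  assumes "invertible h"
  shows "finite {t. \<not> invertible (line_mat h \<eta> t)}"
proof -
  define \<pi> where "\<pi> = (\<Sum>p | p permutes (UNIV :: 'k set).
    of_int (sign p) * (\<Prod>i\<in>UNIV. [:h $ i $ p i, \<eta> $ i $ p i:]))"
  have "poly (of_int k) t = of_int k" for k and t :: 'a
    by (metis of_int_poly poly_const_conv)
  then have \<pi>: "poly \<pi> t = det (line_mat h \<eta> t)" for t
    by (simp add: \<pi>_def det_def line_mat_def poly_sum poly_prod)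
  have "line_mat h \<eta> 0 = h" by (simp add: line_mat_def vec_eq_iff)
  then have "poly \<pi> 0 \<noteq> 0" using assms by (simp add: \<pi> invertible_det_nz)
  then have "finite {t. poly \<pi> t = 0}" by (intro poly_roots_finite) auto
  then show ?thesis by (simp add: invertible_det_nz \<pi>)
qed

section \<open>Polynomials that vanish on all jets\<close>

context frame
begin

text \<open>The linear half of the condition defining \<open>GLd\<close>. Without invertibility it
  also describes the directions \<gamma> in which g may be moved.\<close>

definition closed_mat :: "'a ^ 'm ^ 'm \<Rightarrow> bool" where
  "closed_mat g \<longleftrightarrow> (\<forall>i j k. (\<delta> $ i) (g $ j $ k) = (\<delta> $ j) (g $ i $ k))"

lemma GLd_iff: "g \<in> GLd \<delta> \<longleftrightarrow> g \<in> GL \<and> closed_mat g"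
  by (auto simp: GLd_def closed_mat_def)

text \<open>The exchange rule \<open>\<delta>\<^sup>i g\<^sub>j\<^sub>k = \<delta>\<^sup>j
  g\<^sub>i\<^sub>k\<close> makes the choice by \<open>SOME\<close> in the definition of
  \<open>jet\<close> irrelevant.\<close>

lemma jet_Inr:
  assumes "closed_mat g"
  shows "jet \<delta> h g (Inr (k, add_mset j G)) = dB G (g $ j $ k)"
proof -
  define i where "i = (SOME i. i \<in># add_mset j G)"
  have "i \<in># add_mset j G" unfolding i_def by (rule someI[of _ j]) simp
  moreover have "jet \<delta> h g (Inr (k, add_mset j G)) = dB (add_mset j G - {#i#}) (g $ i $ k)"
    by (simp add: i_def)
  moreover have "dB (add_mset j G - {#i#}) (g $ i $ k) = dB G (g $ j $ k)" if ij: "i \<noteq> j" "i \<in># G"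
  proof -
    obtain G' where G: "G = add_mset i G'" using ij(2) by (metis insert_DiffM)
    then have "add_mset j G - {#i#} = add_mset j G'" using ij by (simp add: add_mset_commute)
    then show ?thesis using assms by (simp add: G dB_add_mset' closed_mat_def)
  qed
  ultimately show ?thesis by (cases "i = j") auto
qed

lemma jet_line:
  assumes "\<And>i. (\<delta> $ i) t = 0"
  shows "jet \<delta> (line_mat h \<eta> t) (line_mat g \<gamma> t) x = jet \<delta> h g x + t * jet \<delta> \<eta> \<gamma> x"
  by (cases "(\<delta>, h, g, x)" rule: jet.cases) (auto simp: line_mat_def dB_add dB_scale[OF assms])

text \<open>Invertibility fails at finitely many t only. At all other natural numbers t the property
  \<open>Q\<close> holds, which gives \<pi> infinitely many zeros. \<open>Q\<close> is a parameter
  because it is used once for the vanishing of a polynomial and once for the vanishing of all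
  partial derivatives.\<close>

lemma line_vanish:
  assumes h: "h \<in> GL" and g: "g \<in> GLd \<delta>" and \<gamma>: "closed_mat \<gamma>"
    and Q: "\<And>h g. h \<in> GL \<Longrightarrow> g \<in> GLd \<delta> \<Longrightarrow> Q (jet \<delta> h g)"
    and \<pi>: "\<And>t. Q (\<lambda>x. jet \<delta> h g x + t * jet \<delta> \<eta> \<gamma> x) \<Longrightarrow> poly \<pi> t = 0"
  shows "\<pi> = 0"
proof (rule ccontr)
  assume "\<pi> \<noteq> 0"
  then have fin: "finite {t. poly \<pi> t = 0}" by (rule poly_roots_finite)
  define bad where "bad = {t. \<not> invertible (line_mat h \<eta> t)} \<union> {t. \<not> invertible (line_mat g \<gamma> t)}"
  have "finite bad"
    using h g unfolding bad_def by (auto intro!: finite_singular_line simp: GLd_def GL_def)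
  have "range of_nat \<subseteq> bad \<union> {t. poly \<pi> t = 0}"
  proof safe
    fix n assume nb: "of_nat n \<notin> bad"
    let ?t = "of_nat n :: 'a"
    have "closed_mat (line_mat g \<gamma> ?t)"
      using g \<gamma> by (auto simp: GLd_iff closed_mat_def line_mat_def der_simps)
    then have "Q (jet \<delta> (line_mat h \<eta> ?t) (line_mat g \<gamma> ?t))"
      using nb by (intro Q) (auto simp: bad_def GLd_iff GL_def)
    moreover have "jet \<delta> (line_mat h \<eta> ?t) (line_mat g \<gamma> ?t) = (\<lambda>x. jet \<delta> h g x + ?t * jet \<delta> \<eta> \<gamma> x)"
      by (rule ext) (simp add: jet_line der_simps)
    ultimately show "poly \<pi> ?t = 0" using \<pi> by simp
  qed
  then have "finite (range (of_nat :: nat \<Rightarrow> 'a))"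
    using fin \<open>finite bad\<close> by (meson finite_UnI finite_subset)
  then show False by (simp add: finite_image_iff inj_of_nat)
qed

text \<open>A family of directions parametrized by a turns the relation between jets into an
  operator identity in a, to which \<open>dB_indep\<close> applies. \<open>R\<close> is the set of
  multi-indices that the family moves: all of them for h, the nonempty ones for g.\<close>

lemma extract_coefficient:
  assumes "finite V" "inj f" "\<And>a. (\<Sum>x\<in>V. F x * J a x) = 0"
    "\<And>a B. B \<in> R \<Longrightarrow> J a (f B) = dB B a" "\<And>a x. x \<notin> f ` R \<Longrightarrow> J a x = 0"
    "B \<in> R" "f B \<in> V"
  shows "F (f B) = 0"
proof -
  define S where "S = {B\<in>R. f B \<in> V}"
  have inj: "inj_on f S" using assms(2) by (rule inj_on_subset) simp
  have fS: "f ` S \<subseteq> V" by (auto simp: S_def)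
  have "finite S"
    by (rule finite_imageD[OF finite_subset[OF fS assms(1)] inj])
  moreover have "(\<Sum>B\<in>S. F (f B) * dB B a) = 0" for a
  proof -
    have "(\<Sum>B\<in>S. F (f B) * dB B a) = (\<Sum>B\<in>S. F (f B) * J a (f B))"
      by (rule sum.cong) (auto simp: S_def assms(4))
    also have "\<dots> = (\<Sum>x\<in>f ` S. F x * J a x)"
      by (simp add: sum.reindex[OF inj])
    also have "\<dots> = (\<Sum>x\<in>V. F x * J a x)"
      by (rule sum.mono_neutral_left[OF assms(1) fS]) (auto simp: S_def intro!: assms(5))
    finally show ?thesis using assms(3) by simp
  qed
  ultimately show ?thesis
    using assms(6,7) by (intro dB_indep[where c = "\<lambda>B. F (f B)" and S = S and B = B]) (auto simp: S_def)
qed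

text \<open>By \<open>line_vanish\<close> the derivative of \<open>G\<close> is zero in every
  direction, and suitable families of directions isolate the single partial derivatives. The dummy
  coordinates are excluded because no direction moves them.\<close>

lemma partials_vanish:
  fixes G :: "('b \<Rightarrow> 'a, ('n::finite \<times> 'n) \<times> 'm multiset + 'm \<times> 'm multiset) pexp"
  assumes van: "\<And>h g. h \<in> GL \<Longrightarrow> g \<in> GLd \<delta> \<Longrightarrow> pev v (jet \<delta> h g) G = 0"
    and h: "h \<in> GL" and g: "g \<in> GLd \<delta>" and x: "x \<notin> range (\<lambda>k. Inr (k, {#}))"
  shows "pev v (jet \<delta> h g) (pd x G) = 0"
proof -
  define V where "V = insert x (pvars G)"
  have V: "finite V" "pvars G \<subseteq> V" "x \<in> V" by (auto simp: V_def finite_pvars)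
  have main: "(\<Sum>x\<in>V. pev v (jet \<delta> h g) (pd x G) * jet \<delta> \<eta> \<gamma> x) = 0" if \<gamma>: "closed_mat \<gamma>" for \<eta> \<gamma>
  proof -
    obtain \<pi> where \<pi>: "\<And>t. poly \<pi> t = pev v (\<lambda>x. jet \<delta> h g x + t * jet \<delta> \<eta> \<gamma> x) G"
      "\<And>t. poly (pderiv \<pi>) t = (\<Sum>x\<in>V. pev v (\<lambda>x. jet \<delta> h g x + t * jet \<delta> \<eta> \<gamma> x) (pd x G) * jet \<delta> \<eta> \<gamma> x)"
      using pev_line[of v "jet \<delta> h g" "jet \<delta> \<eta> \<gamma>" G] V by blast
    have "\<pi> = 0"
      by (rule line_vanish[OF h g \<gamma>, where Q = "\<lambda>u. pev v u G = 0" and \<eta> = \<eta>]) (auto simp: van \<pi>(1))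
    then show ?thesis using \<pi>(2)[of 0] by simp
  qed
  show ?thesis
  proof (cases x)
    case (Inl y)
    obtain i j B where y: "y = ((i, j), B)" by (metis prod.exhaust)
    \<comment> \<open>Only the entry (i, j) moves, by an arbitrary a in F, so the jets of this
      direction are the \<open>\<delta>\<^sup>B a\<close>.\<close>
    define \<eta> :: "'a \<Rightarrow> 'a ^ 'n ^ 'n" where "\<eta> a = (\<chi> i' j'. if i' = i \<and> j' = j then a else 0)" for a
    have z: "closed_mat 0" by (simp add: closed_mat_def der_simps)
    have "dB B 0 = 0" for B using dB_const[of 0 B] by (simp add: der_simps)
    then have J: "jet \<delta> (\<eta> a) 0 x = 0" if "x \<notin> range (\<lambda>B. Inl ((i, j), B))" for a x
      using that by (cases "(\<delta>, \<eta> a, 0 :: 'a ^ 'm ^ 'm, x)" rule: jet.cases) (auto simp: \<eta>_def)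
    have "pev v (jet \<delta> h g) (pd (Inl ((i, j), B)) G) = 0"
      by (rule extract_coefficient[OF V(1), where f = "\<lambda>B. Inl ((i, j), B)" and R = UNIV
          and F = "\<lambda>x. pev v (jet \<delta> h g) (pd x G)" and J = "\<lambda>a. jet \<delta> (\<eta> a) 0"])
        (use V(3) Inl y J main[OF z] in \<open>auto simp: inj_def \<eta>_def\<close>)
    then show ?thesis by (simp add: Inl y)
  next
    case (Inr y)
    obtain k B where y: "y = (k, B)" by (metis prod.exhaust)
    \<comment> \<open>Column k is the gradient of a, closed because the derivations commute. Its
      coordinate \<open>Inr (k, B)\<close> is \<open>\<delta>\<^sup>B a\<close> for every nonempty
      \<open>B\<close>.\<close>
    define \<gamma> :: "'a \<Rightarrow> 'a ^ 'm ^ 'm" where "\<gamma> a = (\<chi> j k'. if k' = k then (\<delta> $ j) a else 0)" for a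
    have z: "closed_mat (\<gamma> a)" for a
      by (simp add: closed_mat_def \<gamma>_def good_frame_commute[OF good] der_simps)
    have d0: "dB B 0 = 0" for B using dB_const[of 0 B] by (simp add: der_simps)
    have J1: "jet \<delta> (0 :: 'a ^ 'n ^ 'n) (\<gamma> a) (Inr (k, B)) = dB B a" if "B \<noteq> {#}" for a B
    proof -
      obtain j B' where B': "B = add_mset j B'" using multiset_cases[of B] \<open>B \<noteq> {#}\<close> by metis
      show ?thesis unfolding B' jet_Inr[OF z] by (simp add: \<gamma>_def dB_add_mset')
    qed
    have J0: "jet \<delta> (0 :: 'a ^ 'n ^ 'n) (\<gamma> a) x = 0" if "x \<notin> (\<lambda>B. Inr (k, B)) ` {B. B \<noteq> {#}}" for a x
      using that by (cases "(\<delta>, 0 :: 'a ^ 'n ^ 'n, \<gamma> a, x)" rule: jet.cases) (auto simp: \<gamma>_def d0)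
    have "pev v (jet \<delta> h g) (pd (Inr (k, B)) G) = 0"
      by (rule extract_coefficient[OF V(1), where f = "\<lambda>B. Inr (k, B)" and R = "{B. B \<noteq> {#}}"
          and F = "\<lambda>x. pev v (jet \<delta> h g) (pd x G)" and J = "\<lambda>a. jet \<delta> 0 (\<gamma> a)"])
        (use V(3) x Inr y J0 J1 main[OF z] in \<open>auto simp: inj_def simp del: jet.simps\<close>)
    then show ?thesis by (simp add: Inr y)
  qed
qed

text \<open>Along the line through the identity and (h, g) the derivative of \<open>b\<close> is a
  polynomial in t. It vanishes at infinitely many t even if the line meets singular matrices, so
  \<open>b\<close> has the same value at t = 0 and t = 1.\<close>

lemma constant_if_partials_vanish:
  fixes h :: "'a ^ 'n::finite ^ 'n"
  assumes van: "\<And>x h g. x \<notin> range (\<lambda>k. Inr (k, {#})) \<Longrightarrow> h \<in> (GL :: ('a ^ 'n ^ 'n) set) \<Longrightarrow> g \<in> GLd \<delta> \<Longrightarrow>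
      pev v (jet \<delta> h g) (pd x b) = 0"
    and h: "h \<in> GL" and g: "g \<in> GLd \<delta>"
  shows "pev v (jet \<delta> h g) b = pev v (jet \<delta> (mat 1 :: 'a ^ 'n ^ 'n) (mat 1)) b"
proof -
  define \<eta> where "\<eta> = h - mat 1"
  define \<gamma> where "\<gamma> = g - mat 1"
  have one: "mat 1 \<in> GLd \<delta>" by (rule GLd_one[OF der])
  have \<gamma>: "closed_mat \<gamma>"
    using g one by (simp add: GLd_iff closed_mat_def \<gamma>_def der_simps)
  obtain \<pi> where \<pi>: "\<And>t. poly \<pi> t = pev v (\<lambda>x. jet \<delta> (mat 1) (mat 1) x + t * jet \<delta> \<eta> \<gamma> x) b"
    "\<And>t. poly (pderiv \<pi>) t = (\<Sum>x\<in>pvars b. pev v (\<lambda>x. jet \<delta> (mat 1) (mat 1) x + t * jet \<delta> \<eta> \<gamma> x) (pd x b) * jet \<delta> \<eta> \<gamma> x)"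
    using pev_line[of v "jet \<delta> (mat 1) (mat 1)" "jet \<delta> \<eta> \<gamma>" b] finite_pvars[of b] by blast
  have "pderiv \<pi> = 0"
  proof (rule line_vanish[OF GL_one one \<gamma>, where \<eta> = \<eta> and
      Q = "\<lambda>u. \<forall>x. x \<notin> range (\<lambda>k. Inr (k, {#})) \<longrightarrow> pev v u (pd x b) = 0"])
    fix t assume *: "\<forall>x. x \<notin> range (\<lambda>k. Inr (k, {#})) \<longrightarrow>
       pev v (\<lambda>x. jet \<delta> (mat 1) (mat 1) x + t * jet \<delta> \<eta> \<gamma> x) (pd x b) = 0"
    have "jet \<delta> \<eta> \<gamma> x = 0" if "x \<in> range (\<lambda>k. Inr (k, {#}))" for x using that by auto
    then show "poly (pderiv \<pi>) t = 0" unfolding \<pi>(2) using * by (intro sum.neutral) auto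
  qed (use van in blast)
  then obtain c where "\<pi> = [:c:]" using pderiv_iszero by blast
  then have "poly \<pi> 1 = poly \<pi> 0" by simp
  moreover have "line_mat (mat 1) \<eta> 1 = h" "line_mat (mat 1) \<gamma> 1 = g"
    by (auto simp: line_mat_def \<eta>_def \<gamma>_def vec_eq_iff)
  then have "jet \<delta> h g = (\<lambda>x. jet \<delta> (mat 1) (mat 1) x + 1 * jet \<delta> \<eta> \<gamma> x)"
    using jet_line[of 1 "mat 1" \<eta> "mat 1" \<gamma>] by (auto simp: der_simps)
  ultimately show ?thesis by (simp add: \<pi>(1))
qed

text \<open>Needed because evaluation at jets that are 0 or 1 keeps coefficients in their ring, and
  because the right-hand side is the same in all frames. The 1 at \<open>{#k#}\<close> is the
  diagonal entry \<open>g\<^sub>k\<^sub>k\<close>.\<close>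

lemma jet_one:
  "jet \<delta> (mat 1 :: 'a ^ 'n::finite ^ 'n) (mat 1) x =
    (case x of Inl ((i, j), B) \<Rightarrow> if i = j \<and> B = {#} then 1 else 0
     | Inr (k, B) \<Rightarrow> if B = {#k#} then 1 else 0)"
proof -
  have d: "dB B 0 = 0" "dB B 1 = (if B = {#} then 1 else 0)" for B
    using dB_const[of 0 B] dB_const[of 1 B] by (auto simp: der_simps)
  have one: "closed_mat (mat 1)" using GLd_one[OF der] by (simp add: GLd_iff)
  consider (1) i j B where "x = Inl ((i, j), B)" | (2) k B where "x = Inr (k, B)"
    by (metis sum.exhaust prod.exhaust)
  then show ?thesis
  proof cases
    case 1
    then show ?thesis by (simp add: mat_def d)
  next
    case 2
    show ?thesis
    proof (cases B)
      case empty
      then show ?thesis using 2 by simp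
    next
      case (add j B')
      have "jet \<delta> (mat 1 :: 'a ^ 'n ^ 'n) (mat 1) x = dB B' (mat 1 $ j $ k)"
        using 2 jet_Inr[OF one] add by simp
      then show ?thesis using 2 add by (auto simp: mat_def d)
    qed
  qed
qed

end

section \<open>Descent on the degree of the denominator\<close>

locale coeff_ring =
  fixes E :: "('b \<Rightarrow> 'a::field_char_0) set"
  assumes E_zero: "(\<lambda>_. 0) \<in> E" and E_one: "(\<lambda>_. 1) \<in> E"
    and E_add: "\<And>c d. c \<in> E \<Longrightarrow> d \<in> E \<Longrightarrow> (\<lambda>v. c v + d v) \<in> E"
    and E_mult: "\<And>c d. c \<in> E \<Longrightarrow> d \<in> E \<Longrightarrow> (\<lambda>v. c v * d v) \<in> E"
begin

lemma pev_in_E: "pcoeffs e \<subseteq> E \<Longrightarrow> (\<And>x. u x = 0 \<or> u x = 1) \<Longrightarrow> (\<lambda>v. pev v u e) \<in> E"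
proof (induction e)
  case (PV x)
  from PV(2)[of x] show ?case
    using E_zero E_one by (elim disjE) simp_all
qed (auto intro: E_add E_mult)

lemma pcoeffs_pd_E: "pcoeffs e \<subseteq> E \<Longrightarrow> pcoeffs (pd x e) \<subseteq> E"
  using pcoeffs_pd[of x e] E_zero E_one by blast

text \<open>If \<open>f\<close> is a quotient of two polynomials in the jets whose value does not depend on the
  jets, then differentiating numerator and denominator with respect to the jets lowers the
  degree until the coefficients themselves have quotient \<open>f\<close>.\<close>

lemma descent:
  fixes Fr :: "'b \<Rightarrow> ('a, 'm::finite) der_col"
    and a b :: "('b \<Rightarrow> 'a, ('n::finite \<times> 'n) \<times> 'm multiset + 'm \<times> 'm multiset) pexp"
  assumes Fr: "\<And>v. v \<in> Z \<Longrightarrow> good_frame (Fr v)"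
    and ab: "pcoeffs a \<subseteq> E" "pcoeffs b \<subseteq> E"
    and eq: "\<And>v h g. v \<in> Z \<Longrightarrow> h \<in> GL \<Longrightarrow> g \<in> GLd (Fr v) \<Longrightarrow>
      f v * pev v (jet (Fr v) h g) b = pev v (jet (Fr v) h g) a"
    and nz: "\<exists>v\<in>Z. \<exists>h\<in>GL. \<exists>g\<in>GLd (Fr v). pev v (jet (Fr v) h g) b \<noteq> 0"
  shows "\<exists>c\<in>E. \<exists>d\<in>E. (\<exists>v\<in>Z. d v \<noteq> 0) \<and> (\<forall>v\<in>Z. f v * d v = c v)"
  using ab eq nz
proof (induction "pdeg b" arbitrary: a b rule: less_induct)
  case less
  show ?case
  \<comment> \<open>A partial derivative of \<open>b\<close> that is nonzero somewhere can serve as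
    the new denominator; \<open>pdeg b \<noteq> 0\<close> makes the decrease of the degree
    strict.\<close>
  proof (cases "\<exists>x v h g. pdeg b \<noteq> 0 \<and> x \<notin> range (\<lambda>k. Inr (k, {#})) \<and> v \<in> Z \<and> h \<in> GL \<and> g \<in> GLd (Fr v) \<and>
      pev v (jet (Fr v) h g) (pd x b) \<noteq> 0")
    case True
    then obtain x where x: "pdeg b \<noteq> 0" "x \<notin> range (\<lambda>k. Inr (k, {#}))"
      "\<exists>v\<in>Z. \<exists>h\<in>GL. \<exists>g\<in>GLd (Fr v). pev v (jet (Fr v) h g) (pd x b) \<noteq> 0" by blast
    show ?thesis
    proof (rule less.hyps[of "pd x b" "pd x a"])
      show "pdeg (pd x b) < pdeg b" using pdeg_pd[of x b] x(1) by simp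
      show "pcoeffs (pd x a) \<subseteq> E" "pcoeffs (pd x b) \<subseteq> E" by (intro pcoeffs_pd_E less.prems)+
      fix v g and h :: "'a ^ 'n ^ 'n" assume v: "v \<in> Z" and h: "h \<in> GL" and g: "g \<in> GLd (Fr v)"
      interpret frame "Fr v" by standard (rule Fr[OF v])
      \<comment> \<open>f enters as a coefficient that is constant in the jets. Only the derivatives
        of \<open>a\<close> and \<open>b\<close> are passed on, and their coefficients remain in
        \<open>E\<close>.\<close>
      let ?G = "PAdd (PMul (PC f) b) (PMul (PC (\<lambda>_. - 1)) a)"
      have "pev v (jet (Fr v) h g) (pd x ?G) = 0"
        by (rule partials_vanish[OF _ h g x(2)]) (simp add: less.prems(3)[OF v])
      then show "f v * pev v (jet (Fr v) h g) (pd x b) = pev v (jet (Fr v) h g) (pd x a)" by simp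
    qed (rule x(3))
  next
    case False
    \<comment> \<open>The jets of the identity without reference to a frame, so that one evaluation
      serves all v and yields elements of \<open>E\<close>.\<close>
    define u0 :: "('n \<times> 'n) \<times> 'm multiset + 'm \<times> 'm multiset \<Rightarrow> 'a" where
      "u0 x = (case x of Inl ((i, j), B) \<Rightarrow> if i = j \<and> B = {#} then 1 else 0
         | Inr (k, B) \<Rightarrow> if B = {#k#} then 1 else 0)" for x
    have jet_u0: "jet (Fr v) (mat 1) (mat 1) = u0" if "v \<in> Z" for v
    proof -
      interpret frame "Fr v" by standard (rule Fr[OF that])
      show ?thesis by (rule ext) (simp add: jet_one u0_def)
    qed
    have const: "pev v (jet (Fr v) h g) b = pev v u0 b" if v: "v \<in> Z" and h: "h \<in> GL" and g: "g \<in> GLd (Fr v)" for v g and h :: "'a ^ 'n ^ 'n"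
    proof (cases "pdeg b = 0")
      case True
      then show ?thesis by (rule pev_deg0)
    next
      case b: False
      interpret frame "Fr v" by standard (rule Fr[OF v])
      show ?thesis
        unfolding jet_u0[OF v, symmetric]
        by (rule constant_if_partials_vanish[OF _ h g]) (use False v b in blast)
    qed
    have u01: "u0 x = 0 \<or> u0 x = 1" for x by (auto simp: u0_def split: sum.split)
    have in_E: "(\<lambda>v. pev v u0 b) \<in> E" "(\<lambda>v. pev v u0 a) \<in> E"
      using less.prems(1,2) u01 by (auto intro!: pev_in_E)
    have "f v * pev v u0 b = pev v u0 a" if v: "v \<in> Z" for v
    proof -
      have "mat 1 \<in> GLd (Fr v)"
        by (intro GLd_one good_frame_derivation Fr v)
      then show ?thesis
        using less.prems(3)[OF v GL_one, of "mat 1"] by (simp add: jet_u0[OF v])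
    qed
    moreover have "\<exists>v\<in>Z. pev v u0 b \<noteq> 0" using less.prems(4) const by metis
    ultimately show ?thesis
      by (intro bexI[OF _ in_E(2)] bexI[OF _ in_E(1)]) blast
  qed
qed

text \<open>A derivation adds its index to the multiset of a jet coordinate and sends coefficients
  to coefficients. Differential polynomials in (h, g) therefore become ordinary polynomials in the
  jets.\<close>

lemma jet_expansion:
  fixes Fr :: "'b \<Rightarrow> ('a, 'm::finite) der_col" and Y :: "'b \<Rightarrow> 'a ^ 'l::finite"
    and p :: "('a, 'm, ('n::finite \<times> 'n) + ('m \<times> 'm) + 'l) dpoly"
  assumes Fr: "\<And>v. v \<in> Z \<Longrightarrow> good_frame (Fr v)"
    and E_der: "\<And>c i. c \<in> E \<Longrightarrow> (\<lambda>v. (Fr v $ i) (c v)) \<in> E"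
    and E_const: "\<And>c. c \<in> dcoeffs p \<Longrightarrow> (\<lambda>v. c) \<in> E"
    and Y: "\<And>k. (\<lambda>v. Y v $ k) \<in> E"
  shows "\<exists>e. pcoeffs e \<subseteq> E \<and> (\<forall>v\<in>Z. \<forall>h. \<forall>g\<in>GLd (Fr v).
    pev v (jet (Fr v) h g) e = deval (Fr v) p (crd_hgv (h, g, Y v)))"
  using E_const
proof (induction p)
  case (Const c)
  then show ?case by (intro exI[of _ "PC (\<lambda>_. c)"]) auto
next
  case (Var x)
  consider (h) i j where "x = Inl (i, j)" | (g) i j where "x = Inr (Inl (i, j))" | (v) k where "x = Inr (Inr k)"
    by (metis sum.exhaust prod.exhaust)
  then show ?case
  proof cases
    case h
    then show ?thesis
      by (intro exI[of _ "PV (Inl ((i, j), {#}))"]) (auto simp: iter_der_def)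
  next
    case g
    have "jet (Fr v) h m (Inr (j, {#i#})) = m $ i $ j" if "v \<in> Z" "m \<in> GLd (Fr v)"
      for v and h :: "'a ^ 'n ^ 'n" and m
    proof -
      interpret frame "Fr v" by standard (rule Fr[OF that(1)])
      show ?thesis using jet_Inr[of m h j i "{#}"] that(2) by (simp add: GLd_iff)
    qed
    then show ?thesis
      using g by (intro exI[of _ "PV (Inr (j, {#i#}))"]) (auto simp del: jet.simps)
  next
    case v
    then show ?thesis by (intro exI[of _ "PC (\<lambda>v. Y v $ k)"]) (auto simp: Y)
  qed
next
  case (Add p q)
  then obtain a b where "pcoeffs a \<subseteq> E" "pcoeffs b \<subseteq> E"
    "\<forall>v\<in>Z. \<forall>h. \<forall>g\<in>GLd (Fr v). pev v (jet (Fr v) h g) a = deval (Fr v) p (crd_hgv (h, g, Y v))"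
    "\<forall>v\<in>Z. \<forall>h. \<forall>g\<in>GLd (Fr v). pev v (jet (Fr v) h g) b = deval (Fr v) q (crd_hgv (h, g, Y v))"
    by auto
  then show ?case by (intro exI[of _ "PAdd a b"]) auto
next
  case (Mul p q)
  then obtain a b where "pcoeffs a \<subseteq> E" "pcoeffs b \<subseteq> E"
    "\<forall>v\<in>Z. \<forall>h. \<forall>g\<in>GLd (Fr v). pev v (jet (Fr v) h g) a = deval (Fr v) p (crd_hgv (h, g, Y v))"
    "\<forall>v\<in>Z. \<forall>h. \<forall>g\<in>GLd (Fr v). pev v (jet (Fr v) h g) b = deval (Fr v) q (crd_hgv (h, g, Y v))"
    by auto
  then show ?case by (intro exI[of _ "PMul a b"]) auto
next
  case (Der i p)
  then obtain a where a: "pcoeffs a \<subseteq> E"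
    "\<forall>v\<in>Z. \<forall>h. \<forall>g\<in>GLd (Fr v). pev v (jet (Fr v) h g) a = deval (Fr v) p (crd_hgv (h, g, Y v))"
    by auto
  have "\<exists>e'. pcoeffs e' \<subseteq> E \<and> (\<forall>v\<in>Z. \<forall>h. \<forall>g\<in>GLd (Fr v).
      pev v (jet (Fr v) h g) e' = (Fr v $ i) (pev v (jet (Fr v) h g) e))"
    if "pcoeffs e \<subseteq> E" for e :: "('b \<Rightarrow> 'a, ('n \<times> 'n) \<times> 'm multiset + 'm \<times> 'm multiset) pexp"
    using that
  proof (induction e)
    case (PC c)
    then show ?case by (intro exI[of _ "PC (\<lambda>v. (Fr v $ i) (c v))"]) (auto intro: E_der)
  next
    case (PV x)
    consider (h) ij B where "x = Inl (ij, B)" | (z) k where "x = Inr (k, {#})"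
      | (g) k j B where "x = Inr (k, add_mset j B)"
      by (metis sum.exhaust prod.exhaust multiset_cases)
    then show ?case
    proof cases
      case h
      have "jet (Fr v) h m (Inl (ij, add_mset i B)) = (Fr v $ i) (jet (Fr v) h m (Inl (ij, B)))"
        if "v \<in> Z" for v and h :: "'a ^ 'n ^ 'n" and m
      proof -
        interpret frame "Fr v" by standard (rule Fr[OF that(1)])
        show ?thesis by (cases ij) (simp add: dB_add_mset)
      qed
      then show ?thesis
        using h by (intro exI[of _ "PV (Inl (ij, add_mset i B))"]) (auto simp del: jet.simps)
    next
      \<comment> \<open>Shifting the multiset would turn the dummy into the entry
        \<open>g\<^sub>i\<^sub>k\<close>; since its value is 0 by convention, its derivative must be
        0 as well.\<close>
      case z
      then show ?thesis
        using E_zero by (intro exI[of _ "PC (\<lambda>_. 0)"])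
          (auto simp: derivation_zero good_frame_derivation Fr)
    next
      case g
      have "jet (Fr v) h m (Inr (k, add_mset i (add_mset j B))) = (Fr v $ i) (jet (Fr v) h m (Inr (k, add_mset j B)))"
        if "v \<in> Z" "m \<in> GLd (Fr v)" for v and h :: "'a ^ 'n ^ 'n" and m
      proof -
        interpret frame "Fr v" by standard (rule Fr[OF that(1)])
        have m: "closed_mat m" using that(2) by (simp add: GLd_iff)
        show ?thesis
          unfolding add_mset_commute[of i j] jet_Inr[OF m] by (simp add: dB_add_mset)
      qed
      then show ?thesis
        using g by (intro exI[of _ "PV (Inr (k, add_mset i (add_mset j B)))"]) (auto simp del: jet.simps)
    qed
  next
    case (PAdd a b)
    then obtain a' b' where "pcoeffs a' \<subseteq> E" "pcoeffs b' \<subseteq> E"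
      "\<forall>v\<in>Z. \<forall>h. \<forall>g\<in>GLd (Fr v). pev v (jet (Fr v) h g) a' = (Fr v $ i) (pev v (jet (Fr v) h g) a)"
      "\<forall>v\<in>Z. \<forall>h. \<forall>g\<in>GLd (Fr v). pev v (jet (Fr v) h g) b' = (Fr v $ i) (pev v (jet (Fr v) h g) b)"
      by auto
    then show ?case
      by (intro exI[of _ "PAdd a' b'"]) (auto simp: derivation_add good_frame_derivation Fr)
  next
    case (PMul a b)
    then obtain a' b' where "pcoeffs a' \<subseteq> E" "pcoeffs b' \<subseteq> E"
      "\<forall>v\<in>Z. \<forall>h. \<forall>g\<in>GLd (Fr v). pev v (jet (Fr v) h g) a' = (Fr v $ i) (pev v (jet (Fr v) h g) a)"
      "\<forall>v\<in>Z. \<forall>h. \<forall>g\<in>GLd (Fr v). pev v (jet (Fr v) h g) b' = (Fr v $ i) (pev v (jet (Fr v) h g) b)"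
      by auto
    then show ?case
      using PMul.prems by (intro exI[of _ "PAdd (PMul a' b) (PMul a b')"])
        (auto simp: derivation_mult good_frame_derivation Fr)
  qed
  from this[OF a(1)] show ?case using a(2) by auto
qed

end

section \<open>The differential Zariski topology\<close>

lemma topspace_kolchin: "topspace (kolchin_topology \<delta>) = UNIV"
proof -
  have "UNIV = {v. deval \<delta> (Const 1) (($) v) \<noteq> 0}" by simp
  then show ?thesis unfolding kolchin_topology_def topology_generated_by_topspace by blast
qed

lemma openin_kolchin: "openin (kolchin_topology \<delta>) {v. deval \<delta> p (($) v) \<noteq> 0}"
  unfolding kolchin_topology_def by (rule topology_generated_by_Basis) blast

lemma closedin_kolchin: "closedin (kolchin_topology \<delta>) {v. deval \<delta> p (($) v) = 0}"
proof -
  have "UNIV - {v. deval \<delta> p (($) v) = 0} = {v. deval \<delta> p (($) v) \<noteq> 0}" by auto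
  then show ?thesis by (simp add: closedin_def topspace_kolchin openin_kolchin)
qed

lemma irreducible_kolchin:
  assumes "irreducible_in (kolchin_topology \<delta>) S"
    and "\<exists>v\<in>S. deval \<delta> p (($) v) \<noteq> 0" "\<exists>v\<in>S. deval \<delta> q (($) v) \<noteq> 0"
  shows "\<exists>v\<in>S. deval \<delta> p (($) v) \<noteq> 0 \<and> deval \<delta> q (($) v) \<noteq> 0"
proof (rule ccontr)
  assume "\<not> ?thesis"
  then have "S \<subseteq> {v. deval \<delta> p (($) v) = 0} \<union> {v. deval \<delta> q (($) v) = 0}" by auto
  then have "S \<subseteq> {v. deval \<delta> p (($) v) = 0} \<or> S \<subseteq> {v. deval \<delta> q (($) v) = 0}"
    using assms(1) closedin_kolchin unfolding irreducible_in_def by blast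
  then show False using assms(2,3) by blast
qed

lemma dense_kolchin:
  assumes "kolchin_topology \<delta> closure_of S0 = S" "\<exists>v\<in>S. deval \<delta> p (($) v) \<noteq> 0"
  shows "\<exists>v\<in>S0. deval \<delta> p (($) v) \<noteq> 0"
proof -
  let ?U = "{v. deval \<delta> p (($) v) \<noteq> 0}"
  obtain v where v: "v \<in> kolchin_topology \<delta> closure_of S0" "v \<in> ?U"
    using assms by blast
  have "\<exists>y. y \<in> S0 \<and> y \<in> ?U"
    using v(1)[unfolded in_closure_of] v(2) openin_kolchin[of \<delta> p] by metis
  then show ?thesis by auto
qed

section \<open>Invariant families\<close>

locale equivariant =
  fixes D :: "('a::field_char_0, 'm::finite) der_col"
    and W W0 :: "('a, 'm) der_col \<Rightarrow> ('a ^ 'l::finite) set"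
    and \<tau> :: "('a, 'm) der_col \<Rightarrow> 'a ^ 'n::finite ^ 'n \<Rightarrow> 'a ^ 'm ^ 'm \<Rightarrow> 'a ^ 'l \<Rightarrow> 'a ^ 'l"
    and P0 :: "('a, 'm) der_col \<Rightarrow> 'a ^ 'l \<Rightarrow> 'a ^ 'n ^ 'n"
    and P1 :: "('a, 'm) der_col \<Rightarrow> 'a ^ 'l \<Rightarrow> 'a ^ 'm ^ 'm"
  assumes good: "good_frame D"
    and W_irreducible: "\<And>\<delta>. \<delta> \<in> frames D \<Longrightarrow> irreducible_in (kolchin_topology \<delta>) (W \<delta>)"
    and \<tau>_maps: "\<And>\<delta> h g v. \<lbrakk>\<delta> \<in> frames D; h \<in> GL; g \<in> GLd \<delta>; v \<in> W \<delta>\<rbrakk>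
           \<Longrightarrow> \<tau> \<delta> h g v \<in> W (matrix_inv g **\<^sub>d \<delta>)"
    and \<tau>_one: "\<And>\<delta> v. \<lbrakk>\<delta> \<in> frames D; v \<in> W \<delta>\<rbrakk> \<Longrightarrow> \<tau> \<delta> (mat 1) (mat 1) v = v"
    and \<tau>_mult: "\<And>\<delta> h h1 g g1 v.
           \<lbrakk>\<delta> \<in> frames D; h \<in> GL; h1 \<in> GL; g \<in> GLd \<delta>; g1 \<in> GLd (matrix_inv g **\<^sub>d \<delta>); v \<in> W \<delta>\<rbrakk>
           \<Longrightarrow> \<tau> (matrix_inv g **\<^sub>d \<delta>) h1 g1 (\<tau> \<delta> h g v) = \<tau> \<delta> (h ** h1) (g ** g1) v"
    and \<tau>_rational: "\<And>k. uniform_rational D (\<lambda>\<delta>. GL \<times> GLd \<delta> \<times> W \<delta>) crd_hgv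
           (\<lambda>\<delta> (h, g, v). \<tau> \<delta> h g v $ k)"
    and W0_subset: "\<And>\<delta>. \<delta> \<in> frames D \<Longrightarrow> W0 \<delta> \<subseteq> W \<delta>"
    and W0_dense: "\<And>\<delta>. \<delta> \<in> frames D \<Longrightarrow> kolchin_topology \<delta> closure_of W0 \<delta> = W \<delta>"
    and W0_invariant: "\<And>\<delta> h g v. \<lbrakk>\<delta> \<in> frames D; h \<in> GL; g \<in> GLd \<delta>; v \<in> W0 \<delta>\<rbrakk>
           \<Longrightarrow> \<tau> \<delta> h g v \<in> W0 (matrix_inv g **\<^sub>d \<delta>)"
    and P_maps: "\<And>\<delta> v. \<lbrakk>\<delta> \<in> frames D; v \<in> W0 \<delta>\<rbrakk> \<Longrightarrow> P0 \<delta> v \<in> GL \<and> P1 \<delta> v \<in> GLd \<delta>"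
    and P0_equivariant: "\<And>\<delta> h g v. \<lbrakk>\<delta> \<in> frames D; h \<in> GL; g \<in> GLd \<delta>; v \<in> W0 \<delta>\<rbrakk>
           \<Longrightarrow> P0 (matrix_inv g **\<^sub>d \<delta>) (\<tau> \<delta> h g v) = matrix_inv h ** P0 \<delta> v"
    and P1_equivariant: "\<And>\<delta> h g v. \<lbrakk>\<delta> \<in> frames D; h \<in> GL; g \<in> GLd \<delta>; v \<in> W0 \<delta>\<rbrakk>
           \<Longrightarrow> P1 (matrix_inv g **\<^sub>d \<delta>) (\<tau> \<delta> h g v) = matrix_inv g ** P1 \<delta> v"
    and P0_rational: "\<And>i j. uniform_rational D W0 ($) (\<lambda>\<delta> v. P0 \<delta> v $ i $ j)"
    and P1_rational: "\<And>i j. uniform_rational D W0 ($) (\<lambda>\<delta> v. P1 \<delta> v $ i $ j)"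
begin

lemmas D_frame = frames_self[OF good]
lemmas frame_good = frames_good[OF good]
lemmas frame_change = frames_matrix_inv[OF good]

lemma ratfun_frame:
  assumes "\<delta> \<in> frames D" shows "ratfun \<delta> (W \<delta>) (W0 \<delta>)"
  by unfold_locales
    (use assms W0_subset irreducible_kolchin[OF W_irreducible] dense_kolchin[OF W0_dense] W_irreducible
      in \<open>auto simp: irreducible_in_def intro: good_frame_derivation frame_good\<close>)

sublocale ratfun D "W D" "W0 D" by (rule ratfun_frame[OF D_frame])

definition nz :: "('a, 'm) der_col \<Rightarrow> ('a, 'm, 'l) dpoly \<Rightarrow> bool" where
  "nz \<delta> p \<longleftrightarrow> (\<exists>v\<in>W \<delta>. deval \<delta> p (($) v) \<noteq> 0)"

lemma nz_mult: "\<delta> \<in> frames D \<Longrightarrow> nz \<delta> p \<Longrightarrow> nz \<delta> q \<Longrightarrow> nz \<delta> (Mul p q)"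
  using ratfun.W_irr[OF ratfun_frame] by (simp add: nz_def)

lemma nz_W0: "\<delta> \<in> frames D \<Longrightarrow> nz \<delta> p \<Longrightarrow> \<exists>v\<in>W0 \<delta>. deval \<delta> p (($) v) \<noteq> 0"
  using ratfun.W0_dense[OF ratfun_frame] by (simp add: nz_def)

lemma nz_one: "\<delta> \<in> frames D \<Longrightarrow> nz \<delta> (Const 1)"
  using ratfun.W_ne[OF ratfun_frame] by (auto simp: nz_def)

lemma rat_domainI:
  assumes "C \<subseteq> B" "\<And>\<delta> u. (\<delta>, u) \<in> Z \<Longrightarrow> \<delta> \<in> frames D"
  shows "rat_domain B Z"
  by unfold_locales (use assms C_basic in \<open>blast intro: good_frame_derivation frame_good\<close>)+

lemma rat_tau:
  assumes "C \<subseteq> B"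
    and Z: "\<And>\<delta> u. (\<delta>, u) \<in> Z \<Longrightarrow> \<delta> \<in> frames D \<and> H \<delta> u \<in> GL \<and> G \<delta> u \<in> GLd \<delta> \<and> V \<delta> u \<in> W \<delta>"
    and "\<And>i j. rat_on B Z crd (\<lambda>\<delta> u. H \<delta> u $ i $ j)" "\<And>i j. rat_on B Z crd (\<lambda>\<delta> u. G \<delta> u $ i $ j)"
    "\<And>k. rat_on B Z crd (\<lambda>\<delta> u. V \<delta> u $ k)"
  shows "rat_on B Z crd (\<lambda>\<delta> u. \<tau> \<delta> (H \<delta> u) (G \<delta> u) (V \<delta> u) $ k)"
proof -
  interpret rd: rat_domain B Z crd by (rule rat_domainI) (use assms in auto)
  have t: "rat_on B (Sigma (frames D) (\<lambda>\<delta>. GL \<times> GLd \<delta> \<times> W \<delta>)) crd_hgv (\<lambda>\<delta> (h, g, v). \<tau> \<delta> h g v $ k)"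
    using \<tau>_rational[of k] assms(1) unfolding uniform_rational_iff by (rule rat_on_mono) auto
  have "rat_on B Z crd (\<lambda>\<delta> u. crd_hgv (H \<delta> u, G \<delta> u, V \<delta> u) x)" for x
  proof -
    consider (h) i j where "x = Inl (i, j)" | (g) i j where "x = Inr (Inl (i, j))" | (v) k where "x = Inr (Inr k)"
      by (metis sum.exhaust prod.exhaust)
    then show ?thesis by cases (simp_all add: assms)
  qed
  then show ?thesis
    using rd.rat_compose[OF t, of "\<lambda>\<delta> u. (H \<delta> u, G \<delta> u, V \<delta> u)"] Z by auto
qed

text \<open>With h and g fixed, their entries become coefficients, so \<open>N\<close> and
  \<open>M\<close> are over all of F. They serve to compare zero sets on \<open>W \<delta>\<close>,
  and density and irreducibility cover such polynomials.\<close>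

lemma pullback:
  assumes \<delta>: "\<delta> \<in> frames D" and h: "h \<in> GL" and g: "g \<in> GLd \<delta>"
  shows "\<exists>N M. \<forall>v\<in>W \<delta>. deval \<delta> M (($) v) \<noteq> 0 \<and>
    deval (matrix_inv g **\<^sub>d \<delta>) p (($) (\<tau> \<delta> h g v)) = deval \<delta> N (($) v) / deval \<delta> M (($) v)"
proof -
  interpret rd: rat_domain UNIV "{\<delta>} \<times> W \<delta>" "($)" by (rule rat_domainI) (use \<delta> in auto)
  have "rd.rat (\<lambda>\<epsilon> v. deval (matrix_inv g **\<^sub>d \<epsilon>) p (($) (\<tau> \<epsilon> h g v)))"
    by (intro rd.rat_deval rat_tau rd.rat_const rd.rat_var) (use \<delta> h g in auto)
  then show ?thesis unfolding rat_on_def by blast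
qed

text \<open>The inverse pair undoes the action, so a point at which s is nonzero is the image of a
  point of \<open>W \<delta>\<close>.\<close>

lemma pullback_nz:
  assumes \<delta>: "\<delta> \<in> frames D" and h: "h \<in> GL" and g: "g \<in> GLd \<delta>"
    and s: "nz (matrix_inv g **\<^sub>d \<delta>) s"
  obtains N where "nz \<delta> N"
    "\<And>v. v \<in> W \<delta> \<Longrightarrow> deval \<delta> N (($) v) \<noteq> 0 \<Longrightarrow> deval (matrix_inv g **\<^sub>d \<delta>) s (($) (\<tau> \<delta> h g v)) \<noteq> 0"
proof -
  obtain N M where NM: "\<And>v. v \<in> W \<delta> \<Longrightarrow> deval \<delta> M (($) v) \<noteq> 0"
    "\<And>v. v \<in> W \<delta> \<Longrightarrow> deval (matrix_inv g **\<^sub>d \<delta>) s (($) (\<tau> \<delta> h g v)) = deval \<delta> N (($) v) / deval \<delta> M (($) v)"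
    using pullback[OF \<delta> h g, where p = s] by blast
  let ?\<epsilon> = "matrix_inv g **\<^sub>d \<delta>"
  obtain w where w: "w \<in> W ?\<epsilon>" "deval ?\<epsilon> s (($) w) \<noteq> 0" using s by (auto simp: nz_def)
  have inv: "invertible h" "invertible g" using h g by (auto simp: GL_def GLd_def)
  have \<epsilon>: "?\<epsilon> \<in> frames D" by (rule frame_change[OF \<delta> g])
  have gi: "matrix_inv g \<in> GLd ?\<epsilon>" by (rule good_frame_matrix_inv[OF frame_good[OF \<delta>] g])
  have undo: "matrix_inv (matrix_inv g) **\<^sub>d ?\<epsilon> = \<delta>"
    by (simp add: mat_der_mat_der matrix_inv_matrix_inv inv matrix_inv_mult mat_der_one)
  define v where "v = \<tau> ?\<epsilon> (matrix_inv h) (matrix_inv g) w"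
  have v: "v \<in> W \<delta>" using \<tau>_maps[OF \<epsilon> GL_inv[OF h] gi w(1)] unfolding undo v_def .
  have "\<tau> \<delta> h g v = \<tau> ?\<epsilon> (matrix_inv h ** h) (matrix_inv g ** g) w"
    using \<tau>_mult[OF \<epsilon> GL_inv[OF h] h gi _ w(1), of g] g unfolding undo v_def by simp
  also have "\<dots> = w" using \<tau>_one[OF \<epsilon> w(1)] by (simp add: matrix_inv_mult inv)
  finally have "nz \<delta> N" using NM[OF v] w v by (auto simp: nz_def)
  then show ?thesis using NM by (intro that[of N]) auto
qed

section \<open>Invariance tested off a zero set\<close>

definition pts :: "('a, 'm, 'l) dpoly \<Rightarrow> (('a, 'm) der_col \<times> ('a ^ 'l)) set" where
  "pts s = {(\<delta>, v). \<delta> \<in> frames D \<and> v \<in> W0 \<delta> \<and> deval \<delta> s (($) v) \<noteq> 0}"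

text \<open>As s has to be nonzero only somewhere on each \<open>W \<delta>\<close>, it can be
  multiplied by further factors: this gives two families a common domain and removes zeros before an
  inversion.\<close>

definition inv_family :: "('a, 'm, 'l) dpoly \<Rightarrow> (('a, 'm) der_col \<Rightarrow> 'a ^ 'l \<Rightarrow> 'a) \<Rightarrow> bool" where
  "inv_family s f \<longleftrightarrow> dcoeffs s \<subseteq> C \<and> (\<forall>\<delta>\<in>frames D. nz \<delta> s) \<and> rat_on C (pts s) ($) f \<and>
     (\<forall>\<delta> h g v. (\<delta>, v) \<in> pts s \<longrightarrow> h \<in> GL \<longrightarrow> g \<in> GLd \<delta> \<longrightarrow>
        (matrix_inv g **\<^sub>d \<delta>, \<tau> \<delta> h g v) \<in> pts s \<longrightarrow>
        f (matrix_inv g **\<^sub>d \<delta>) (\<tau> \<delta> h g v) = f \<delta> v)"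

abbreviation dom :: "('a, 'm, 'l) dpoly \<Rightarrow> ('a ^ 'l) set" where
  "dom s \<equiv> {v\<in>W0 D. deval D s (($) v) \<noteq> 0}"

lemma dense_dom: "nz D s \<Longrightarrow> dense (dom s)"
  by (intro dense_nonzero dense_W0) (simp add: nz_def)

lemma rat_domain_pts: "rat_domain C (pts s)"
  by (rule rat_domainI) (auto simp: pts_def)

text \<open>By density an identity between invariants need only be tested where an auxiliary
  polynomial \<open>s\<close> does not vanish.\<close>

lemma invariant_iff:
  "A \<in> invariant_ratfuns D W \<tau> \<longleftrightarrow> (\<exists>s f. inv_family s f \<and> rep (dom s) (f D) A)"
proof
  assume "A \<in> invariant_ratfuns D W \<tau>"
  then obtain p q where A: "A = cls (p, q)" and C: "dcoeffs p \<subseteq> C" "dcoeffs q \<subseteq> C"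
    and q: "\<forall>\<delta>\<in>frames D. nz \<delta> q"
    and inv: "\<forall>\<delta>\<in>frames D. \<forall>h\<in>GL. \<forall>g\<in>GLd \<delta>. \<forall>v\<in>W \<delta>.
        let \<delta>' = matrix_inv g **\<^sub>d \<delta>; v' = \<tau> \<delta> h g v in
        deval \<delta> q (($) v) \<noteq> 0 \<and> deval \<delta>' q (($) v') \<noteq> 0 \<longrightarrow>
        deval \<delta>' p (($) v') / deval \<delta>' q (($) v') = deval \<delta> p (($) v) / deval \<delta> q (($) v)"
    by (auto simp: invariant_ratfuns_def nz_def)
  define f where "f \<delta> v = deval \<delta> p (($) v) / deval \<delta> q (($) v)" for \<delta> v
  have "inv_family q f"
    unfolding inv_family_def
  proof (intro conjI q C allI impI)
    show "rat_on C (pts q) ($) f"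
      by (rule rat_onI[OF C]) (auto simp: pts_def f_def)
    fix \<delta> h g v
    assume "(\<delta>, v) \<in> pts q" "h \<in> GL" "g \<in> GLd \<delta>" "(matrix_inv g **\<^sub>d \<delta>, \<tau> \<delta> h g v) \<in> pts q"
    then show "f (matrix_inv g **\<^sub>d \<delta>) (\<tau> \<delta> h g v) = f \<delta> v"
      using inv W0_subset by (force simp: pts_def f_def Let_def)
  qed
  moreover have "(p, q) \<in> dfracs D (W D)"
    using C q D_frame by (auto simp: dfracs_def nz_def)
  then have "rep (dom q) (f D) A"
    unfolding A by (rule repI) (auto simp: f_def)
  ultimately show "\<exists>s f. inv_family s f \<and> rep (dom s) (f D) A" by blast
next
  assume "\<exists>s f. inv_family s f \<and> rep (dom s) (f D) A"
  then obtain s f where s: "\<And>\<delta>. \<delta> \<in> frames D \<Longrightarrow> nz \<delta> s" and rat: "rat_on C (pts s) ($) f"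
    and inv: "\<And>\<delta> h g v. (\<delta>, v) \<in> pts s \<Longrightarrow> h \<in> GL \<Longrightarrow> g \<in> GLd \<delta> \<Longrightarrow>
        (matrix_inv g **\<^sub>d \<delta>, \<tau> \<delta> h g v) \<in> pts s \<Longrightarrow> f (matrix_inv g **\<^sub>d \<delta>) (\<tau> \<delta> h g v) = f \<delta> v"
    and A: "rep (dom s) (f D) A" by (auto simp: inv_family_def)
  from rat obtain p q where C: "dcoeffs p \<subseteq> C" "dcoeffs q \<subseteq> C"
    and q: "\<And>\<delta> v. (\<delta>, v) \<in> pts s \<Longrightarrow> deval \<delta> q (($) v) \<noteq> 0"
    and f: "\<And>\<delta> v. (\<delta>, v) \<in> pts s \<Longrightarrow> f \<delta> v = deval \<delta> p (($) v) / deval \<delta> q (($) v)"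
    by (rule rat_onE) blast
  have q_nz: "nz \<delta> q" if "\<delta> \<in> frames D" for \<delta>
    using nz_W0[OF that s[OF that]] q[of \<delta>] that W0_subset[OF that] by (auto simp: nz_def pts_def)
  have dfr: "(p, q) \<in> dfracs D (W D)" using C q_nz[OF D_frame] by (auto simp: dfracs_def nz_def)
  have "rep (dom s) (f D) (cls (p, q))"
    by (rule repI[OF dfr]) (use q f D_frame in \<open>auto simp: pts_def\<close>)
  then have "A = cls (p, q)"
    by (rule rep_unique[OF A _ dense_dom[OF s[OF D_frame]]]) simp
  moreover have "deval \<delta>' p (($) v') / deval \<delta>' q (($) v') = deval \<delta> p (($) v) / deval \<delta> q (($) v)"
    if \<delta>: "\<delta> \<in> frames D" and h: "h \<in> GL" and g: "g \<in> GLd \<delta>" and v: "v \<in> W \<delta>"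
      and \<delta>': "\<delta>' = matrix_inv g **\<^sub>d \<delta>" and v': "v' = \<tau> \<delta> h g v"
      and nonzero: "deval \<delta> q (($) v) \<noteq> 0" "deval \<delta>' q (($) v') \<noteq> 0" for \<delta> h g v \<delta>' v'
  proof (rule ccontr)
    assume neq: "\<not> ?thesis"
    have \<delta>'_frame: "\<delta>' \<in> frames D" unfolding \<delta>' by (rule frame_change[OF \<delta> g])
    obtain Np Mp where Np: "\<And>v. v \<in> W \<delta> \<Longrightarrow> deval \<delta> Mp (($) v) \<noteq> 0"
      "\<And>v. v \<in> W \<delta> \<Longrightarrow> deval \<delta>' p (($) (\<tau> \<delta> h g v)) = deval \<delta> Np (($) v) / deval \<delta> Mp (($) v)"
      using pullback[OF \<delta> h g, where p = p] unfolding \<delta>' by blast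
    obtain Nq Mq where Nq: "\<And>v. v \<in> W \<delta> \<Longrightarrow> deval \<delta> Mq (($) v) \<noteq> 0"
      "\<And>v. v \<in> W \<delta> \<Longrightarrow> deval \<delta>' q (($) (\<tau> \<delta> h g v)) = deval \<delta> Nq (($) v) / deval \<delta> Mq (($) v)"
      using pullback[OF \<delta> h g, where p = q] unfolding \<delta>' by blast
    obtain Ns where Ns: "nz \<delta> Ns"
      "\<And>v. v \<in> W \<delta> \<Longrightarrow> deval \<delta> Ns (($) v) \<noteq> 0 \<Longrightarrow> deval \<delta>' s (($) (\<tau> \<delta> h g v)) \<noteq> 0"
      using pullback_nz[OF \<delta> h g s] \<delta>'_frame unfolding \<delta>' by blast
    \<comment> \<open>The difference of the two quotients with all denominators cleared: a
      polynomial over F whose zeros on \<open>W \<delta>\<close> are the points where the cross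
      products agree.\<close>
    define t where "t = Add (Mul (Mul Np Mq) q) (Mul (Const (- 1)) (Mul (Mul Nq Mp) p))"
    have t: "deval \<delta> t (($) u) = 0 \<longleftrightarrow>
        deval \<delta>' p (($) (\<tau> \<delta> h g u)) * deval \<delta> q (($) u) = deval \<delta> p (($) u) * deval \<delta>' q (($) (\<tau> \<delta> h g u))"
      if "u \<in> W \<delta>" for u
    proof -
      have "deval \<delta> t (($) u) = deval \<delta> Mp (($) u) * deval \<delta> Mq (($) u) *
          (deval \<delta>' p (($) (\<tau> \<delta> h g u)) * deval \<delta> q (($) u) - deval \<delta> p (($) u) * deval \<delta>' q (($) (\<tau> \<delta> h g u)))"
        using Np[OF that] Nq[OF that] by (simp add: t_def right_diff_distrib)
      then show ?thesis using Np(1)[OF that] Nq(1)[OF that] by simp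
    qed
    have "nz \<delta> t"
      using t[OF v] v nonzero neq unfolding nz_def v' by (auto simp: frac_eq_eq)
    \<comment> \<open>If t is not identically zero, it is nonzero at a point of W0 at which s and
      its pullback are nonzero too. There the invariance of f applies and forces t to
      vanish.\<close>
    then have "nz \<delta> (Mul t (Mul Ns s))" by (intro nz_mult \<delta> Ns s)
    then obtain u where u: "u \<in> W0 \<delta>" "deval \<delta> t (($) u) \<noteq> 0" "deval \<delta> Ns (($) u) \<noteq> 0" "deval \<delta> s (($) u) \<noteq> 0"
      using nz_W0[OF \<delta>, of "Mul t (Mul Ns s)"] by auto
    have uW: "u \<in> W \<delta>" using u W0_subset[OF \<delta>] by auto
    have 1: "(\<delta>, u) \<in> pts s" using \<delta> u by (simp add: pts_def)
    have 2: "(\<delta>', \<tau> \<delta> h g u) \<in> pts s"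
      using \<delta>'_frame W0_invariant[OF \<delta> h g u(1)] Ns(2)[OF uW u(3)] by (simp add: pts_def \<delta>')
    have "f \<delta>' (\<tau> \<delta> h g u) = f \<delta> u" using inv[OF 1 h g] 2 unfolding \<delta>' by simp
    then show False
      using u(2) t[OF uW] q[OF 1] q[OF 2] by (simp add: f[OF 1] f[OF 2] frac_eq_eq)
  qed
  ultimately show "A \<in> invariant_ratfuns D W \<tau>"
    using C q_nz unfolding invariant_ratfuns_def nz_def Let_def by blast
qed

lemma inv_familyE:
  assumes "A \<in> invariant_ratfuns D W \<tau>"
  obtains s f where "dcoeffs s \<subseteq> C" "\<And>\<delta>. \<delta> \<in> frames D \<Longrightarrow> nz \<delta> s" "rat_on C (pts s) ($) f"
    "\<And>\<delta> h g v. (\<delta>, v) \<in> pts s \<Longrightarrow> h \<in> GL \<Longrightarrow> g \<in> GLd \<delta> \<Longrightarrow>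
        (matrix_inv g **\<^sub>d \<delta>, \<tau> \<delta> h g v) \<in> pts s \<Longrightarrow> f (matrix_inv g **\<^sub>d \<delta>) (\<tau> \<delta> h g v) = f \<delta> v"
    "rep (dom s) (f D) A"
  using assms unfolding invariant_iff inv_family_def by blast

lemma invariantI:
  assumes "dcoeffs s \<subseteq> C" "\<And>\<delta>. \<delta> \<in> frames D \<Longrightarrow> nz \<delta> s" "rat_on C (pts s) ($) f"
    "\<And>\<delta> h g v. (\<delta>, v) \<in> pts s \<Longrightarrow> h \<in> GL \<Longrightarrow> g \<in> GLd \<delta> \<Longrightarrow>
        (matrix_inv g **\<^sub>d \<delta>, \<tau> \<delta> h g v) \<in> pts s \<Longrightarrow> f (matrix_inv g **\<^sub>d \<delta>) (\<tau> \<delta> h g v) = f \<delta> v"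
    "rep (dom s) (f D) A"
  shows "A \<in> invariant_ratfuns D W \<tau>"
  using assms unfolding invariant_iff inv_family_def by blast

section \<open>The field of invariants\<close>

abbreviation "KG \<equiv> invariant_ratfuns D W \<tau>"

lemma pts_mult: "pts (Mul s t) = pts s \<inter> pts t"
  by (auto simp: pts_def)

lemma KG_carrier: "KG \<subseteq> carrier K"
  using invariant_iff rep_carrier by blast

lemma KG_ring:
  assumes "A \<in> KG" "B \<in> KG"
  shows "A \<oplus>\<^bsub>K\<^esub> B \<in> KG" "A \<otimes>\<^bsub>K\<^esub> B \<in> KG"
proof -
  obtain s f where A: "dcoeffs s \<subseteq> C" "\<And>\<delta>. \<delta> \<in> frames D \<Longrightarrow> nz \<delta> s" "rat_on C (pts s) ($) f"
    "\<And>\<delta> h g v. (\<delta>, v) \<in> pts s \<Longrightarrow> h \<in> GL \<Longrightarrow> g \<in> GLd \<delta> \<Longrightarrow>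
        (matrix_inv g **\<^sub>d \<delta>, \<tau> \<delta> h g v) \<in> pts s \<Longrightarrow> f (matrix_inv g **\<^sub>d \<delta>) (\<tau> \<delta> h g v) = f \<delta> v"
    "rep (dom s) (f D) A"
    using assms(1) by (rule inv_familyE) blast
  obtain t e where B: "dcoeffs t \<subseteq> C" "\<And>\<delta>. \<delta> \<in> frames D \<Longrightarrow> nz \<delta> t" "rat_on C (pts t) ($) e"
    "\<And>\<delta> h g v. (\<delta>, v) \<in> pts t \<Longrightarrow> h \<in> GL \<Longrightarrow> g \<in> GLd \<delta> \<Longrightarrow>
        (matrix_inv g **\<^sub>d \<delta>, \<tau> \<delta> h g v) \<in> pts t \<Longrightarrow> e (matrix_inv g **\<^sub>d \<delta>) (\<tau> \<delta> h g v) = e \<delta> v"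
    "rep (dom t) (e D) B"
    using assms(2) by (rule inv_familyE) blast
  interpret rd: rat_domain C "pts (Mul s t)" "($)" by (rule rat_domain_pts)
  have r: "rd.rat f" "rd.rat e"
    by (rule rat_on_mono[OF A(3)], simp, simp add: pts_mult)
      (rule rat_on_mono[OF B(3)], simp, simp add: pts_mult)
  have reps: "rep (dom (Mul s t)) (f D) A" "rep (dom (Mul s t)) (e D) B"
    by (rule rep_mono[OF A(5)], auto) (rule rep_mono[OF B(5)], auto)
  have add: "rd.rat (\<lambda>\<delta> v. f \<delta> v + e \<delta> v)" "rep (dom (Mul s t)) (\<lambda>v. f D v + e D v) (A \<oplus>\<^bsub>K\<^esub> B)"
    by (intro rd.rat_add r rep_add reps)+
  show "A \<oplus>\<^bsub>K\<^esub> B \<in> KG"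
    by (rule invariantI[OF _ _ add(1) _ add(2)]) (use A B in \<open>auto simp: pts_mult intro: nz_mult\<close>)
  have mult: "rd.rat (\<lambda>\<delta> v. f \<delta> v * e \<delta> v)" "rep (dom (Mul s t)) (\<lambda>v. f D v * e D v) (A \<otimes>\<^bsub>K\<^esub> B)"
    by (intro rd.rat_mult r rep_mult reps)+
  show "A \<otimes>\<^bsub>K\<^esub> B \<in> KG"
    by (rule invariantI[OF _ _ mult(1) _ mult(2)]) (use A B in \<open>auto simp: pts_mult intro: nz_mult\<close>)
qed

lemma KG_const: "c \<in> C \<Longrightarrow> cls (Const c, Const 1) \<in> KG"
  by (rule invariantI[of "Const 1" "\<lambda>\<delta> v. c"])
    (auto intro: nz_one rep_const C_basic rat_domain.rat_const[OF rat_domain_pts])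

text \<open>The inverse family must exist on every \<open>W \<delta>\<close>, so the numerator has
  to be nonzero on each of them, whereas A \<noteq> 0 speaks only of \<open>D\<close>. The
  invariance of f carries a nonzero value from \<open>D\<close> to any other frame.\<close>

lemma KG_inv:
  assumes "A \<in> KG" "A \<noteq> \<zero>\<^bsub>K\<^esub>"
  shows "inv\<^bsub>K\<^esub> A \<in> KG"
  using assms(1)
proof (rule inv_familyE)
  fix s f
  assume sC: "dcoeffs s \<subseteq> C" and s: "\<And>\<delta>. \<delta> \<in> frames D \<Longrightarrow> nz \<delta> s" and rat: "rat_on C (pts s) ($) f"
    and inv: "\<And>\<delta> h g v. (\<delta>, v) \<in> pts s \<Longrightarrow> h \<in> GL \<Longrightarrow> g \<in> GLd \<delta> \<Longrightarrow>
        (matrix_inv g **\<^sub>d \<delta>, \<tau> \<delta> h g v) \<in> pts s \<Longrightarrow> f (matrix_inv g **\<^sub>d \<delta>) (\<tau> \<delta> h g v) = f \<delta> v"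
    and A: "rep (dom s) (f D) A"
  from rat obtain p q where C: "dcoeffs p \<subseteq> C" "dcoeffs q \<subseteq> C"
    and q: "\<And>\<delta> v. (\<delta>, v) \<in> pts s \<Longrightarrow> deval \<delta> q (($) v) \<noteq> 0"
    and f: "\<And>\<delta> v. (\<delta>, v) \<in> pts s \<Longrightarrow> f \<delta> v = deval \<delta> p (($) v) / deval \<delta> q (($) v)"
    by (rule rat_onE) blast
  obtain T where T: "dense T" "T \<subseteq> dom s" "\<And>v. v \<in> T \<Longrightarrow> f D v \<noteq> 0"
    using nonzero_rep[OF A dense_dom[OF s[OF D_frame]] assms(2)] by blast
  obtain v0 where "v0 \<in> T" using dense_ne[OF T(1)] by blast
  then have "v0 \<in> W0 D" "deval D s (($) v0) \<noteq> 0" "f D v0 \<noteq> 0" using T(2,3) by auto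
  then have "v0 \<in> W D" "deval D p (($) v0) \<noteq> 0"
    using f[of D v0] D_frame W0_subset[OF D_frame] by (auto simp: pts_def)
  then have "nz D p" by (auto simp: nz_def)
  have p: "nz \<delta> p" if fr: "\<delta> \<in> frames D" for \<delta>
  proof -
    obtain g where g: "g \<in> GLd D" "\<delta> = matrix_inv g **\<^sub>d D" using fr by (auto simp: frames_def)
    obtain N where N: "nz D N"
      "\<And>v. v \<in> W D \<Longrightarrow> deval D N (($) v) \<noteq> 0 \<Longrightarrow> deval \<delta> s (($) (\<tau> D (mat 1) g v)) \<noteq> 0"
      using pullback_nz[OF D_frame GL_one g(1)] s[OF fr] unfolding g(2) by blast
    have "nz D (Mul p (Mul N s))" by (intro nz_mult D_frame \<open>nz D p\<close> N s)
    then obtain v where v: "v \<in> W0 D" "deval D p (($) v) \<noteq> 0" "deval D N (($) v) \<noteq> 0" "deval D s (($) v) \<noteq> 0"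
      using nz_W0[OF D_frame, of "Mul p (Mul N s)"] by auto
    have vW: "v \<in> W D" using v W0_subset[OF D_frame] by auto
    have 1: "(D, v) \<in> pts s" using D_frame v by (simp add: pts_def)
    have \<tau>v: "\<tau> D (mat 1) g v \<in> W0 \<delta>" using W0_invariant[OF D_frame GL_one g(1) v(1)] g(2) by simp
    then have 2: "(\<delta>, \<tau> D (mat 1) g v) \<in> pts s"
      using fr N(2)[OF vW v(3)] by (simp add: pts_def)
    have "f \<delta> (\<tau> D (mat 1) g v) = f D v" using inv[OF 1 GL_one g(1)] 2 unfolding g(2) by simp
    then have "deval \<delta> p (($) (\<tau> D (mat 1) g v)) \<noteq> 0"
      using f[OF 1] f[OF 2] q[OF 1] v(2) by auto
    then show ?thesis using \<tau>v W0_subset[OF fr] by (auto simp: nz_def)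
  qed
  interpret rd: rat_domain C "pts (Mul s p)" "($)" by (rule rat_domain_pts)
  have fnz: "f \<delta> v \<noteq> 0" if "(\<delta>, v) \<in> pts (Mul s p)" for \<delta> v
    using that f[of \<delta> v] q[of \<delta> v] by (auto simp: pts_def)
  have r: "rd.rat f"
    by (rule rat_on_mono[OF rat]) (auto simp: pts_mult)
  have repA: "rep (dom (Mul s p)) (f D) A"
    by (rule rep_mono[OF A]) auto
  have dd: "dense (dom (Mul s p))"
    by (intro dense_dom nz_mult D_frame s p)
  obtain B where B: "rep (dom (Mul s p)) (\<lambda>v. 1 / f D v) B"
  proof (rule rep_inverse[OF repA])
    show "dom (Mul s p) \<noteq> {}" by (rule dense_ne[OF dd])
    show "dom (Mul s p) \<subseteq> W D" using W0_subset[OF D_frame] by auto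
    show "f D v \<noteq> 0" if "v \<in> dom (Mul s p)" for v
      using that D_frame by (intro fnz) (auto simp: pts_def)
  qed
  have "B \<in> KG"
  proof (rule invariantI[of "Mul s p" "\<lambda>\<delta> v. 1 / f \<delta> v"])
    show "rd.rat (\<lambda>\<delta> v. 1 / f \<delta> v)"
      by (intro rd.rat_divide rd.rat_const C_basic r fnz)
  qed (use B s p inv sC C in \<open>auto simp: pts_mult intro: nz_mult\<close>)
  have BA: "B \<otimes>\<^bsub>K\<^esub> A = \<one>\<^bsub>K\<^esub>"
  proof (rule rep_unique[OF rep_mult[OF B repA] rep_one dd])
    fix v assume "v \<in> dom (Mul s p)"
    then have "f D v \<noteq> 0" using D_frame by (intro fnz) (auto simp: pts_def)
    then show "1 / f D v * f D v = 1" by simp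
  qed
  have U: "A \<in> Units K" using K.field_Units rep_carrier[OF A] assms(2) by auto
  have "B = inv\<^bsub>K\<^esub> A"
    by (rule K.inv_unique[OF BA K.Units_r_inv[OF U]])
      (use rep_carrier[OF A] rep_carrier[OF B] K.Units_inv_closed[OF U] in auto)
  then show ?thesis using \<open>B \<in> KG\<close> by simp
qed

lemma KG_subfield: "subfield KG K"
proof (rule K.subfieldI')
  have one: "\<one>\<^bsub>K\<^esub> = cls (Const 1, Const 1)" by (simp add: ratfun_field_def)
  show "subring KG K"
  proof (rule K.subringI[OF KG_carrier])
    show "\<one>\<^bsub>K\<^esub> \<in> KG" unfolding one by (intro KG_const C_basic)
    fix A assume A: "A \<in> KG"
    then have Ac: "A \<in> carrier K" using KG_carrier by blast
    obtain S f where S: "dense S" "rep S f A" using ex_rep[OF Ac dense_W0] by blast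
    have m: "rep S (\<lambda>v. - 1 * f v) (cls (Const (- 1), Const 1) \<otimes>\<^bsub>K\<^esub> A)"
      by (intro rep_mult rep_const C_basic S)
    have "cls (Const (- 1), Const 1) \<otimes>\<^bsub>K\<^esub> A \<oplus>\<^bsub>K\<^esub> A = \<zero>\<^bsub>K\<^esub>"
      by (rule rep_unique[OF rep_add[OF m S(2)] rep_zero S(1)]) simp
    then have "\<ominus>\<^bsub>K\<^esub> A = cls (Const (- 1), Const 1) \<otimes>\<^bsub>K\<^esub> A"
      using K.minus_equality[OF _ Ac rep_carrier[OF m]] by simp
    then show "\<ominus>\<^bsub>K\<^esub> A \<in> KG" using KG_ring(2)[OF KG_const A] C_basic by simp
  qed (use KG_ring in auto)
  fix A assume "A \<in> KG - {\<zero>\<^bsub>K\<^esub>}"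
  then show "inv\<^bsub>K\<^esub> A \<in> KG" using KG_inv by auto
qed

section \<open>The moving frame and the section point\<close>

text \<open>\<open>section_pt \<delta> v\<close> is the point \<open>y(v)\<close> of the introduction.\<close>

definition moving :: "('a, 'm) der_col \<Rightarrow> 'a ^ 'l \<Rightarrow> ('a, 'm) der_col" where
  "moving \<delta> v = matrix_inv (P1 \<delta> v) **\<^sub>d \<delta>"

definition section_pt :: "('a, 'm) der_col \<Rightarrow> 'a ^ 'l \<Rightarrow> 'a ^ 'l" where
  "section_pt \<delta> v = \<tau> \<delta> (P0 \<delta> v) (P1 \<delta> v) v"

lemma moving_frame: "\<delta> \<in> frames D \<Longrightarrow> v \<in> W0 \<delta> \<Longrightarrow> moving \<delta> v \<in> frames D"
  unfolding moving_def using P_maps by (intro frame_change) auto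

lemma section_W0: "\<delta> \<in> frames D \<Longrightarrow> v \<in> W0 \<delta> \<Longrightarrow> section_pt \<delta> v \<in> W0 (moving \<delta> v)"
  unfolding section_pt_def moving_def using P_maps by (intro W0_invariant) auto

text \<open>By equivariance \<open>P1\<close> at the new point is
  \<open>g\<^sup>-\<^sup>1 P1\<close>, so g cancels against the change of frame. In y(v) the
  composition law of \<tau> makes h and g cancel in the same way.\<close>

lemma
  assumes \<delta>: "\<delta> \<in> frames D" and h: "h \<in> GL" and g: "g \<in> GLd \<delta>" and v: "v \<in> W0 \<delta>"
  shows moving_invariant: "moving (matrix_inv g **\<^sub>d \<delta>) (\<tau> \<delta> h g v) = moving \<delta> v"
    and section_invariant: "section_pt (matrix_inv g **\<^sub>d \<delta>) (\<tau> \<delta> h g v) = section_pt \<delta> v"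
proof -
  have inv: "invertible h" "invertible g" "invertible (P1 \<delta> v)" "invertible (matrix_inv g)"
    using h g P_maps[OF \<delta> v] by (auto simp: GL_def GLd_def invertible_matrix_inv)
  have cancel: "k ** (matrix_inv k ** A) = A" if "invertible k" for k A :: "'a ^ 'k ^ 'k"
    using that by (simp add: matrix_mul_assoc matrix_inv_mult)
  show "moving (matrix_inv g **\<^sub>d \<delta>) (\<tau> \<delta> h g v) = moving \<delta> v"
    unfolding moving_def P1_equivariant[OF \<delta> h g v]
    by (simp add: mat_der_mat_der matrix_inv_mul matrix_inv_matrix_inv inv flip: matrix_mul_assoc)
      (simp add: matrix_inv_mult inv)
  have v': "v \<in> W \<delta>" using v W0_subset[OF \<delta>] by auto
  have \<delta>': "matrix_inv g **\<^sub>d \<delta> \<in> frames D" by (rule frame_change[OF \<delta> g])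
  note P' = P_maps[OF \<delta>' W0_invariant[OF \<delta> h g v]]
  show "section_pt (matrix_inv g **\<^sub>d \<delta>) (\<tau> \<delta> h g v) = section_pt \<delta> v"
    unfolding section_pt_def using \<tau>_mult[OF \<delta> h _ g _ v'] P'
    by (simp add: P0_equivariant[OF \<delta> h g v] P1_equivariant[OF \<delta> h g v] cancel inv)
qed

lemma P_rat:
  assumes "Z \<subseteq> Sigma (frames D) W0"
  shows "rat_on C Z ($) (\<lambda>\<delta> v. P0 \<delta> v $ i $ j)" "rat_on C Z ($) (\<lambda>\<delta> v. P1 \<delta> v $ i' $ j')"
  using P0_rational[of i j] P1_rational[of i' j'] assms
  unfolding uniform_rational_iff by (blast intro: rat_on_mono)+

lemma moving_rat:
  assumes Z: "Z \<subseteq> Sigma (frames D) W0"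
  shows "rat_on C Z ($) (\<lambda>\<delta> v. matrix_inv (P1 \<delta> v) $ i $ j)"
proof -
  interpret rd: rat_domain C Z "($)" by (rule rat_domainI) (use Z in auto)
  show ?thesis
    by (rule rd.rat_matrix_inv[OF P_rat(2)[OF Z]]) (use Z P_maps in \<open>force simp: GLd_def GL_def\<close>)
qed

lemma section_rat:
  assumes Z: "Z \<subseteq> Sigma (frames D) W0"
  shows "rat_on C Z ($) (\<lambda>\<delta> v. section_pt \<delta> v $ k)"
proof -
  interpret rd: rat_domain C Z "($)" by (rule rat_domainI) (use Z in auto)
  show ?thesis
    unfolding section_pt_def
  proof (rule rat_tau)
    fix \<delta> v assume "(\<delta>, v) \<in> Z"
    then have "\<delta> \<in> frames D" "v \<in> W0 \<delta>" using Z by auto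
    then show "\<delta> \<in> frames D \<and> P0 \<delta> v \<in> GL \<and> P1 \<delta> v \<in> GLd \<delta> \<and> v \<in> W \<delta>"
      using P_maps W0_subset by blast
  qed (auto intro: P_rat[OF Z] rd.rat_var)
qed

abbreviation "Q \<equiv> \<lambda>i j. ratfun_of D (W D) (W0 D) (\<lambda>x. matrix_inv (P1 D x) $ i $ j)"
abbreviation "Delta \<equiv> ratfun_mat_der D (W D) Q"
abbreviation "Y \<equiv> \<lambda>k. ratfun_of D (W D) (W0 D) (\<lambda>x. \<tau> D (P0 D x) (P1 D x) x $ k)"

lemma rat_on_D: "rat_on C ({D} \<times> W0 D) ($) f \<Longrightarrow> rat_on C ({D} \<times> W0 D) ($) (\<lambda>\<delta>. f D)"
  by (subst rat_on_cong[of _ _ f]) auto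

lemma rep_Q: "rep (W0 D) (\<lambda>v. matrix_inv (P1 D v) $ i $ j) (Q i j)"
  by (rule ratfun_of_rep, rule rat_on_D[OF moving_rat]) (use D_frame in auto)

lemma rep_Y: "rep (W0 D) (\<lambda>v. section_pt D v $ k) (Y k)"
  unfolding section_pt_def[symmetric]
  by (rule ratfun_of_rep, rule rat_on_D[OF section_rat]) (use D_frame in auto)

text \<open>Derivatives of classes are computed by applying \<open>D\<close> to values. At a fixed v
  the operator is therefore a derivation of F, from the frame \<open>moving D v\<close>, applied to
  the element f(v).\<close>

lemma rep_Delta:
  assumes "rep S f A" "S \<subseteq> W0 D"
  shows "rep S (\<lambda>v. (moving D v $ i) (f v)) (Delta i A)"
  unfolding moving_def by (intro rep_mat_der rep_mono[OF rep_Q] assms)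

text \<open>Pointwise the claim is that the members of the column \<open>moving D v\<close> commute
  on F, and this column lies in \<open>frames D\<close>. The derivatives of the matrix
  \<open>Q\<close> never have to be computed.\<close>

lemma Delta_commute:
  assumes "A \<in> carrier K"
  shows "Delta i (Delta j A) = Delta j (Delta i A)"
proof -
  obtain S f where S: "dense S" "rep S f A" using ex_rep[OF assms dense_W0] by blast
  note sub = dense_sub[OF S(1)]
  show ?thesis
    by (rule rep_unique[OF rep_Delta[OF rep_Delta[OF S(2) sub] sub] rep_Delta[OF rep_Delta[OF S(2) sub] sub] S(1)])
      (use sub D_frame in \<open>auto intro!: good_frame_commute frame_good moving_frame\<close>)
qed

lemma pts_sub: "pts s \<subseteq> Sigma (frames D) W0"
  by (auto simp: pts_def)

lemma KG_Delta:
  assumes "A \<in> KG" shows "Delta i A \<in> KG"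
  using assms
proof (rule inv_familyE)
  fix s f
  assume sC: "dcoeffs s \<subseteq> C" and s: "\<And>\<delta>. \<delta> \<in> frames D \<Longrightarrow> nz \<delta> s" and rat: "rat_on C (pts s) ($) f"
    and inv: "\<And>\<delta> h g v. (\<delta>, v) \<in> pts s \<Longrightarrow> h \<in> GL \<Longrightarrow> g \<in> GLd \<delta> \<Longrightarrow>
        (matrix_inv g **\<^sub>d \<delta>, \<tau> \<delta> h g v) \<in> pts s \<Longrightarrow> f (matrix_inv g **\<^sub>d \<delta>) (\<tau> \<delta> h g v) = f \<delta> v"
    and A: "rep (dom s) (f D) A"
  interpret rd: rat_domain C "pts s" "($)" by (rule rat_domain_pts)
  show ?thesis
  proof (rule invariantI[OF sC s, of "\<lambda>\<delta> v. (moving \<delta> v $ i) (f \<delta> v)"])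
    show "rd.rat (\<lambda>\<delta> v. (moving \<delta> v $ i) (f \<delta> v))"
      unfolding moving_def mat_der_nth
      by (intro rd.rat_sum rd.rat_mult rd.rat_der rat moving_rat pts_sub)
    show "rep (dom s) (\<lambda>v. (moving D v $ i) (f D v)) (Delta i A)"
      by (rule rep_Delta[OF A]) auto
  next
    fix \<delta> h g v
    assume *: "(\<delta>, v) \<in> pts s" "h \<in> GL" "g \<in> GLd \<delta>" "(matrix_inv g **\<^sub>d \<delta>, \<tau> \<delta> h g v) \<in> pts s"
    then have "moving (matrix_inv g **\<^sub>d \<delta>) (\<tau> \<delta> h g v) = moving \<delta> v"
      by (intro moving_invariant) (auto simp: pts_def)
    then show "(moving (matrix_inv g **\<^sub>d \<delta>) (\<tau> \<delta> h g v) $ i) (f (matrix_inv g **\<^sub>d \<delta>) (\<tau> \<delta> h g v)) =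
        (moving \<delta> v $ i) (f \<delta> v)"
      using inv[OF *] by simp
  qed
qed

lemma KG_Y: "Y k \<in> KG"
proof (rule invariantI[of "Const 1" "\<lambda>\<delta> v. section_pt \<delta> v $ k"])
  show "rep (dom (Const 1)) (\<lambda>v. section_pt D v $ k) (Y k)"
    by (rule rep_mono[OF rep_Y]) auto
qed (auto intro: nz_one section_rat pts_sub C_basic simp: section_invariant pts_def)

section \<open>Generation by the components of the section point\<close>

definition orbit_frac :: "('a, 'm, 'l) dpoly \<Rightarrow> ('a, 'm, ('n \<times> 'n) + ('m \<times> 'm) + 'l) dpoly \<Rightarrow>
    ('a, 'm, ('n \<times> 'n) + ('m \<times> 'm) + 'l) dpoly \<Rightarrow> bool" where
  "orbit_frac r N M \<longleftrightarrow> (\<forall>\<delta>\<in>frames D. \<forall>h\<in>GL. \<forall>g\<in>GLd \<delta>. \<forall>w\<in>W \<delta>.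
       deval \<delta> M (crd_hgv (h, g, w)) \<noteq> 0 \<and>
       deval (matrix_inv g **\<^sub>d \<delta>) r (($) (\<tau> \<delta> h g w)) = deval \<delta> N (crd_hgv (h, g, w)) / deval \<delta> M (crd_hgv (h, g, w)))"

text \<open>Unlike in \<open>pullback\<close>, h and g are variables here. Hence the coefficients
  can be taken constant, and one pair \<open>N\<close>, \<open>M\<close> serves all frames.\<close>

lemma orbit_frac_exists:
  assumes "dcoeffs r \<subseteq> C"
  shows "\<exists>N M. dcoeffs N \<subseteq> C \<and> dcoeffs M \<subseteq> C \<and> orbit_frac r N M"
proof -
  define Z where "Z = Sigma (frames D) (\<lambda>\<delta>. (GL :: ('a ^ 'n ^ 'n) set) \<times> GLd \<delta> \<times> W \<delta>)"
  interpret rd: rat_domain C Z crd_hgv by (rule rat_domainI) (auto simp: Z_def)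
  have H: "rd.rat (\<lambda>\<delta> u. fst u $ i $ j)" for i j
    using rd.rat_var[of "Inl (i, j)"] by (rule iffD1[OF rat_on_cong, rotated]) auto
  have G: "rd.rat (\<lambda>\<delta> u. fst (snd u) $ i $ j)" for i j
    using rd.rat_var[of "Inr (Inl (i, j))"] by (rule iffD1[OF rat_on_cong, rotated]) auto
  have V: "rd.rat (\<lambda>\<delta> u. snd (snd u) $ k)" for k
    using rd.rat_var[of "Inr (Inr k)"] by (rule iffD1[OF rat_on_cong, rotated]) auto
  have "rd.rat (\<lambda>\<delta> u. deval (matrix_inv (fst (snd u)) **\<^sub>d \<delta>) r (($) (\<tau> \<delta> (fst u) (fst (snd u)) (snd (snd u)))))"
    by (intro rd.rat_deval rd.rat_matrix_inv rat_tau H G V assms)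
      (auto simp: Z_def GLd_def GL_def)
  then obtain N M where "dcoeffs N \<subseteq> C" "dcoeffs M \<subseteq> C"
    and NM: "\<forall>(\<delta>, u)\<in>Z. deval \<delta> M (crd_hgv u) \<noteq> 0 \<and>
      deval (matrix_inv (fst (snd u)) **\<^sub>d \<delta>) r (($) (\<tau> \<delta> (fst u) (fst (snd u)) (snd (snd u)))) =
        deval \<delta> N (crd_hgv u) / deval \<delta> M (crd_hgv u)"
    unfolding rat_on_def by blast
  moreover have "orbit_frac r N M"
    unfolding orbit_frac_def
  proof (intro ballI)
    fix \<delta> g w and h :: "'a ^ 'n ^ 'n" assume "\<delta> \<in> frames D" "h \<in> GL" "g \<in> GLd \<delta>" "w \<in> W \<delta>"
    then have "(\<delta>, (h, g, w)) \<in> Z" by (simp add: Z_def)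
    from bspec[OF NM this] show "deval \<delta> M (crd_hgv (h, g, w)) \<noteq> 0 \<and>
       deval (matrix_inv g **\<^sub>d \<delta>) r (($) (\<tau> \<delta> h g w)) = deval \<delta> N (crd_hgv (h, g, w)) / deval \<delta> M (crd_hgv (h, g, w))"
      by simp
  qed
  ultimately show ?thesis by blast
qed

text \<open>\<open>descent\<close>, applied with the frames \<open>moving D v\<close> and the points
  y(v), yields functions c and d that represent elements of \<open>E\<close> and satisfy f d = c;
  the field \<open>E\<close> is closed under the division.\<close>

lemma KG_generated:
  assumes E: "subfield E K" "ratfun_consts D (W D) \<subseteq> E" "range Y \<subseteq> E"
    and E_Delta: "\<And>i A. A \<in> E \<Longrightarrow> Delta i A \<in> E" and "A \<in> KG"
  shows "A \<in> E"
  using assms(5)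
proof (rule inv_familyE)
  fix s f
  assume sC: "dcoeffs s \<subseteq> C" and s: "\<And>\<delta>. \<delta> \<in> frames D \<Longrightarrow> nz \<delta> s" and rat: "rat_on C (pts s) ($) f"
    and inv: "\<And>\<delta> h g v. (\<delta>, v) \<in> pts s \<Longrightarrow> h \<in> GL \<Longrightarrow> g \<in> GLd \<delta> \<Longrightarrow>
        (matrix_inv g **\<^sub>d \<delta>, \<tau> \<delta> h g v) \<in> pts s \<Longrightarrow> f (matrix_inv g **\<^sub>d \<delta>) (\<tau> \<delta> h g v) = f \<delta> v"
    and A: "rep (dom s) (f D) A"
  note E_ring = subringE[OF subfieldE(1)[OF E(1)]]
  \<comment> \<open>Functions without poles on the whole of W0: one domain for all coefficients,
    stable under sums, products and the moving derivations.\<close>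
  define E0 where "E0 = {c. \<exists>B\<in>E. rep (W0 D) c B}"
  have E0_const: "(\<lambda>v. c) \<in> E0" if "c \<in> C" for c
    using rep_const[OF that, of "W0 D"] E(2) that by (auto simp: E0_def ratfun_consts_def)
  interpret E0: coeff_ring E0
  proof
    show "(\<lambda>_. 0) \<in> E0" "(\<lambda>_. 1) \<in> E0" using E0_const C_basic by auto
    fix c d assume "c \<in> E0" "d \<in> E0"
    then obtain A B where "A \<in> E" "B \<in> E" "rep (W0 D) c A" "rep (W0 D) d B" by (auto simp: E0_def)
    note AB = this
    show "(\<lambda>v. c v + d v) \<in> E0"
      using rep_add[OF AB(3,4)] E_ring(7)[OF AB(1,2)] by (auto simp: E0_def)
    show "(\<lambda>v. c v * d v) \<in> E0"
      using rep_mult[OF AB(3,4)] E_ring(6)[OF AB(1,2)] by (auto simp: E0_def)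
  qed
  have E0_der: "(\<lambda>v. (moving D v $ i) (c v)) \<in> E0" if "c \<in> E0" for c i
  proof -
    obtain B where B: "B \<in> E" "rep (W0 D) c B" using \<open>c \<in> E0\<close> by (auto simp: E0_def)
    then show ?thesis
      using rep_Delta[OF B(2) order_refl, of i] E_Delta[OF B(1), of i] by (auto simp: E0_def)
  qed
  have E0_Y: "(\<lambda>v. section_pt D v $ k) \<in> E0" for k
    using rep_Y[of k] E(3) by (auto simp: E0_def)
  from rat obtain p q where pq: "dcoeffs p \<subseteq> C" "dcoeffs q \<subseteq> C"
    and q: "\<And>\<delta> v. (\<delta>, v) \<in> pts s \<Longrightarrow> deval \<delta> q (($) v) \<noteq> 0"
    and f: "\<And>\<delta> v. (\<delta>, v) \<in> pts s \<Longrightarrow> f \<delta> v = deval \<delta> p (($) v) / deval \<delta> q (($) v)"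
    by (rule rat_onE) blast
  obtain Np Mp where Np: "dcoeffs Np \<subseteq> C" "dcoeffs Mp \<subseteq> C" "orbit_frac p Np Mp"
    using orbit_frac_exists[OF pq(1)] by blast
  obtain Nq Mq where Nq: "dcoeffs Nq \<subseteq> C" "dcoeffs Mq \<subseteq> C" "orbit_frac q Nq Mq"
    using orbit_frac_exists[OF pq(2)] by blast
  obtain Ns Ms where Ns: "dcoeffs Ns \<subseteq> C" "dcoeffs Ms \<subseteq> C" "orbit_frac s Ns Ms"
    using orbit_frac_exists[OF sC] by blast
  have den: "deval \<delta> M (crd_hgv (h, g, w)) \<noteq> 0"
    and num: "deval (matrix_inv g **\<^sub>d \<delta>) r (($) (\<tau> \<delta> h g w)) = deval \<delta> N (crd_hgv (h, g, w)) / deval \<delta> M (crd_hgv (h, g, w))"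
    if "orbit_frac r N M" "\<delta> \<in> frames D" "h \<in> GL" "g \<in> GLd \<delta>" "w \<in> W \<delta>" for r N M \<delta> h g w
    using that by (simp_all add: orbit_frac_def)
  \<comment> \<open>a / b is p / q at the moved point with denominators cleared. Invariance of f is
    known only where s is nonzero; the factor \<open>Ns\<close> makes both sides 0 where s vanishes
    at the moved point.\<close>
  define a where "a = Mul (Mul Np Mq) Ns"
  define b where "b = Mul (Mul Nq Mp) Ns"
  have ab_C: "dcoeffs a \<subseteq> C" "dcoeffs b \<subseteq> C"
    using Np Nq Ns by (auto simp: a_def b_def)
  have dom_W0: "v \<in> W0 D" if "v \<in> dom s" for v using that by simp
  have ab: "f D v * deval (moving D v) b (crd_hgv (h, g, section_pt D v)) = deval (moving D v) a (crd_hgv (h, g, section_pt D v))"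
    if v: "v \<in> dom s" and h: "h \<in> GL" and g: "g \<in> GLd (moving D v)" for v h g
  proof -
    note v0 = dom_W0[OF v]
    note P = P_maps[OF D_frame v0]
    note m = moving_frame[OF D_frame v0]
    have w: "section_pt D v \<in> W (moving D v)"
      using section_W0[OF D_frame v0] W0_subset[OF m] by auto
    define \<epsilon> where "\<epsilon> = matrix_inv g **\<^sub>d moving D v"
    define u where "u = \<tau> (moving D v) h g (section_pt D v)"
    \<comment> \<open>Acting by (h, g) on y(v) is acting by the products \<open>P0 D v ** h\<close>
      and \<open>P1 D v ** g\<close> on v, so the moved point lies in the orbit of v and f has the
      value f(v) there.\<close>
    have g': "P1 D v ** g \<in> GLd D"
      using GLd_mult[OF good _ g[unfolded moving_def]] P by blast
    have h': "P0 D v ** h \<in> GL" using P h by (intro GL_mult) auto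
    have \<epsilon>: "\<epsilon> = matrix_inv (P1 D v ** g) **\<^sub>d D"
      using P g by (simp add: \<epsilon>_def moving_def mat_der_mat_der matrix_inv_mul GLd_def GL_def)
    have u: "u = \<tau> D (P0 D v ** h) (P1 D v ** g) v"
      unfolding u_def section_pt_def moving_def
      by (rule \<tau>_mult) (use P h g v0 W0_subset[OF D_frame] D_frame in \<open>auto simp: moving_def\<close>)
    have \<epsilon>_frame: "\<epsilon> \<in> frames D" unfolding \<epsilon>_def by (rule frame_change[OF m g])
    have u0: "u \<in> W0 \<epsilon>" unfolding u_def \<epsilon>_def by (rule W0_invariant[OF m h g section_W0[OF D_frame v0]])
    have key: "f D v * deval \<epsilon> q (($) u) = deval \<epsilon> p (($) u)" if "deval \<epsilon> s (($) u) \<noteq> 0"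
    proof -
      have 1: "(D, v) \<in> pts s" using v D_frame by (simp add: pts_def)
      have 2: "(\<epsilon>, u) \<in> pts s" using that \<epsilon>_frame u0 by (simp add: pts_def)
      have "f \<epsilon> u = f D v" using inv[OF 1 h' g'] 2 unfolding \<epsilon> u by simp
      then show ?thesis using f[OF 2] q[OF 2] by (simp add: field_simps)
    qed
    note [simp] = den[OF Np(3) m h g w] den[OF Nq(3) m h g w] den[OF Ns(3) m h g w]
    show ?thesis
    proof (cases "deval (moving D v) Ns (crd_hgv (h, g, section_pt D v)) = 0")
      case True
      then show ?thesis by (simp add: a_def b_def)
    next
      case False
      then have "f D v * deval \<epsilon> q (($) u) = deval \<epsilon> p (($) u)"
        using key num[OF Ns(3) m h g w] by (simp add: \<epsilon>_def u_def)
      then show ?thesis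
        using num[OF Np(3) m h g w] num[OF Nq(3) m h g w] by (simp add: a_def b_def \<epsilon>_def u_def field_simps)
    qed
  qed
  have b_nz: "\<exists>h\<in>GL. \<exists>g\<in>GLd (moving D v). deval (moving D v) b (crd_hgv (h, g, section_pt D v)) \<noteq> 0"
    if v: "v \<in> dom s" for v
  proof -
    note v0 = dom_W0[OF v]
    note P = P_maps[OF D_frame v0]
    note m = moving_frame[OF D_frame v0]
    have w: "section_pt D v \<in> W (moving D v)"
      using section_W0[OF D_frame v0] W0_subset[OF m] by auto
    \<comment> \<open>This pair leads from y(v) back to v, where s and q are nonzero.\<close>
    define h where "h = matrix_inv (P0 D v)"
    define g where "g = matrix_inv (P1 D v)"
    have inv': "invertible (P0 D v)" "invertible (P1 D v)" using P by (auto simp: GL_def GLd_def)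
    have h: "h \<in> GL" using P by (simp add: h_def GL_inv)
    have g: "g \<in> GLd (moving D v)"
      unfolding g_def moving_def using P by (intro good_frame_matrix_inv good) auto
    have \<epsilon>: "matrix_inv g **\<^sub>d moving D v = D"
      by (simp add: g_def moving_def mat_der_mat_der matrix_inv_matrix_inv matrix_inv_mult inv' mat_der_one)
    have "\<tau> (moving D v) h g (section_pt D v) = \<tau> D (P0 D v ** h) (P1 D v ** g) v"
      unfolding section_pt_def moving_def
      by (rule \<tau>_mult) (use P h g v0 W0_subset[OF D_frame] D_frame in \<open>auto simp: moving_def\<close>)
    also have "\<dots> = v"
      using v0 W0_subset[OF D_frame] D_frame by (auto simp: h_def g_def matrix_inv_mult inv' intro!: \<tau>_one)
    finally have u: "\<tau> (moving D v) h g (section_pt D v) = v" .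
    have "deval D s (($) v) \<noteq> 0" "deval D q (($) v) \<noteq> 0"
      using v q[of D v] D_frame by (auto simp: pts_def)
    then have "deval (moving D v) b (crd_hgv (h, g, section_pt D v)) \<noteq> 0"
      using den[OF Np(3) m h g w] num[OF Nq(3) m h g w] num[OF Ns(3) m h g w] unfolding \<epsilon> u by (auto simp: b_def)
    then show ?thesis using h g by blast
  qed
  have good_moving: "good_frame (moving D v)" if "v \<in> dom s" for v
    using that by (intro frame_good moving_frame D_frame) simp
  have expansion: "\<exists>e. pcoeffs e \<subseteq> E0 \<and> (\<forall>v\<in>dom s. \<forall>h. \<forall>g\<in>GLd (moving D v).
      pev v (jet (moving D v) h g) e = deval (moving D v) r (crd_hgv (h, g, section_pt D v)))"
    if "dcoeffs r \<subseteq> C" for r :: "('a, 'm, ('n \<times> 'n) + ('m \<times> 'm) + 'l) dpoly"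
    by (rule E0.jet_expansion[where Fr = "moving D" and Y = "section_pt D" and p = r and Z = "dom s",
          OF good_moving E0_der E0_const E0_Y]) (use that in auto)
  obtain a' where a': "pcoeffs a' \<subseteq> E0" "\<And>v h g. v \<in> dom s \<Longrightarrow> g \<in> GLd (moving D v) \<Longrightarrow>
      pev v (jet (moving D v) h g) a' = deval (moving D v) a (crd_hgv (h, g, section_pt D v))"
    using expansion[OF ab_C(1)] by blast
  obtain b' where b': "pcoeffs b' \<subseteq> E0" "\<And>v h g. v \<in> dom s \<Longrightarrow> g \<in> GLd (moving D v) \<Longrightarrow>
      pev v (jet (moving D v) h g) b' = deval (moving D v) b (crd_hgv (h, g, section_pt D v))"
    using expansion[OF ab_C(2)] by blast
  have dd: "dense (dom s)" by (intro dense_dom s D_frame)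
  have "\<exists>c\<in>E0. \<exists>d\<in>E0. (\<exists>v\<in>dom s. d v \<noteq> 0) \<and> (\<forall>v\<in>dom s. f D v * d v = c v)"
  proof (rule E0.descent[where Fr = "moving D" and a = a' and b = b', OF good_moving a'(1) b'(1)])
    show "f D v * pev v (jet (moving D v) h g) b' = pev v (jet (moving D v) h g) a'"
      if "v \<in> dom s" "h \<in> GL" "g \<in> GLd (moving D v)" for v h g
      unfolding a'(2)[OF that(1,3)] b'(2)[OF that(1,3)] by (rule ab[OF that])
    obtain v where v: "v \<in> dom s" using dense_ne[OF dd] by blast
    then show "\<exists>v\<in>dom s. \<exists>h\<in>GL. \<exists>g\<in>GLd (moving D v). pev v (jet (moving D v) h g) b' \<noteq> 0"
      using b_nz[OF v] b'(2)[OF v] by (metis (no_types, lifting))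
  qed
  then obtain c d Ac Ad where cd: "Ac \<in> E" "Ad \<in> E" "rep (W0 D) c Ac" "rep (W0 D) d Ad"
    "\<exists>v\<in>dom s. d v \<noteq> 0" "\<And>v. v \<in> dom s \<Longrightarrow> f D v * d v = c v"
    unfolding E0_def by blast
  have c: "rep (dom s) c Ac" "rep (dom s) d Ad"
    by (rule rep_mono[OF cd(3)], auto) (rule rep_mono[OF cd(4)], auto)
  \<comment> \<open>One point with d \<noteq> 0 suffices for the class of d to be nonzero; at the
    other zeros of d the relation f d = c still holds, so no restriction of the domain is
    needed.\<close>
  note div = rep_divide[OF c dd cd(6) A cd(5)]
  have "Ad \<otimes>\<^bsub>K\<^esub> A = Ac"
    using div(1) K.m_comm[OF rep_carrier[OF A] rep_carrier[OF c(2)]] by simp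
  then show ?thesis
    using K.subfield_m_inv_simprule[OF E(1), of Ad A] cd(1,2) div(2) rep_carrier[OF A] by auto
qed

text \<open>For the last clause, the invariants lie in every subfield of the intersection by
  \<open>KG_generated\<close>, and they form one of these subfields themselves.\<close>

lemma invariants_generated:
  "Ring.field K \<and> subfield KG K \<and>
    (\<forall>i j. \<forall>f\<in>carrier K. Delta i (Delta j f) = Delta j (Delta i f)) \<and>
    (\<forall>i. \<forall>f\<in>KG. Delta i f \<in> KG) \<and>
    KG = diff_field_gen K Delta (ratfun_consts D (W D)) (range Y)"
proof (intro conjI allI ballI K_field KG_subfield Delta_commute KG_Delta)
  have const_sub: "ratfun_consts D (W D) \<subseteq> KG"
    using KG_const by (auto simp: ratfun_consts_def)
  show "KG = diff_field_gen K Delta (ratfun_consts D (W D)) (range Y)"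
    unfolding diff_field_gen_def
  proof (intro subset_antisym Inter_greatest subsetI)
    fix E A assume "E \<in> {E. subfield E K \<and> ratfun_consts D (W D) \<subseteq> E \<and> range Y \<subseteq> E \<and> (\<forall>i. \<forall>f\<in>E. Delta i f \<in> E)}" "A \<in> KG"
    then have "subfield E K" "ratfun_consts D (W D) \<subseteq> E" "range Y \<subseteq> E" "\<And>i A. A \<in> E \<Longrightarrow> Delta i A \<in> E"
      by blast+
    then show "A \<in> E" using \<open>A \<in> KG\<close> by (rule KG_generated)
  next
    fix A assume A: "A \<in> \<Inter>{E. subfield E K \<and> ratfun_consts D (W D) \<subseteq> E \<and> range Y \<subseteq> E \<and> (\<forall>i. \<forall>f\<in>E. Delta i f \<in> E)}"
    have "range Y \<subseteq> KG" using KG_Y by auto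
    then show "A \<in> KG"
      using InterD[OF A, of KG] KG_subfield const_sub KG_Delta by simp
  qed
qed

end

theorem theorem2p4:
  fixes D :: "('a::field_char_0, 'm::finite) der_col"
    and W W0 :: "('a, 'm) der_col \<Rightarrow> ('a ^ 'l::finite) set"
    and \<tau> :: "('a, 'm) der_col \<Rightarrow> 'a ^ 'n::finite ^ 'n \<Rightarrow> 'a ^ 'm ^ 'm \<Rightarrow> 'a ^ 'l \<Rightarrow> 'a ^ 'l"
    and P0 :: "('a, 'm) der_col \<Rightarrow> 'a ^ 'l \<Rightarrow> 'a ^ 'n ^ 'n"
    and P1 :: "('a, 'm) der_col \<Rightarrow> 'a ^ 'l \<Rightarrow> 'a ^ 'm ^ 'm"
  assumes "commuting_derivations D" and "lin_indep_derivations D" and "diff_closed D"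
    and W_closed: "\<And>\<delta>. \<delta> \<in> frames D \<Longrightarrow> closedin (kolchin_topology \<delta>) (W \<delta>)"
    and W_irreducible: "\<And>\<delta>. \<delta> \<in> frames D \<Longrightarrow> irreducible_in (kolchin_topology \<delta>) (W \<delta>)"
    and \<tau>_maps: "\<And>\<delta> h g v. \<lbrakk>\<delta> \<in> frames D; h \<in> GL; g \<in> GLd \<delta>; v \<in> W \<delta>\<rbrakk>
           \<Longrightarrow> \<tau> \<delta> h g v \<in> W (matrix_inv g **\<^sub>d \<delta>)"
    and \<tau>_one: "\<And>\<delta> v. \<lbrakk>\<delta> \<in> frames D; v \<in> W \<delta>\<rbrakk> \<Longrightarrow> \<tau> \<delta> (mat 1) (mat 1) v = v"
    and \<tau>_mult: "\<And>\<delta> h h1 g g1 v.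
           \<lbrakk>\<delta> \<in> frames D; h \<in> GL; h1 \<in> GL; g \<in> GLd \<delta>; g1 \<in> GLd (matrix_inv g **\<^sub>d \<delta>); v \<in> W \<delta>\<rbrakk>
           \<Longrightarrow> \<tau> (matrix_inv g **\<^sub>d \<delta>) h1 g1 (\<tau> \<delta> h g v) = \<tau> \<delta> (h ** h1) (g ** g1) v"
    and \<tau>_rational: "\<And>k. uniform_rational D (\<lambda>\<delta>. GL \<times> GLd \<delta> \<times> W \<delta>) crd_hgv
           (\<lambda>\<delta> (h, g, v). \<tau> \<delta> h g v $ k)"
    and W0_nonempty: "\<exists>\<delta>\<in>frames D. W0 \<delta> \<noteq> {}"
    and W0_subset: "\<And>\<delta>. \<delta> \<in> frames D \<Longrightarrow> W0 \<delta> \<subseteq> W \<delta>"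
    and W0_dense: "\<And>\<delta>. \<delta> \<in> frames D \<Longrightarrow> kolchin_topology \<delta> closure_of W0 \<delta> = W \<delta>"
    and W0_invariant: "\<And>\<delta> h g v. \<lbrakk>\<delta> \<in> frames D; h \<in> GL; g \<in> GLd \<delta>; v \<in> W0 \<delta>\<rbrakk>
           \<Longrightarrow> \<tau> \<delta> h g v \<in> W0 (matrix_inv g **\<^sub>d \<delta>)"
    and P_maps: "\<And>\<delta> v. \<lbrakk>\<delta> \<in> frames D; v \<in> W0 \<delta>\<rbrakk> \<Longrightarrow> P0 \<delta> v \<in> GL \<and> P1 \<delta> v \<in> GLd \<delta>"
    and P0_equivariant: "\<And>\<delta> h g v. \<lbrakk>\<delta> \<in> frames D; h \<in> GL; g \<in> GLd \<delta>; v \<in> W0 \<delta>\<rbrakk>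
           \<Longrightarrow> P0 (matrix_inv g **\<^sub>d \<delta>) (\<tau> \<delta> h g v) = matrix_inv h ** P0 \<delta> v"
    and P1_equivariant: "\<And>\<delta> h g v. \<lbrakk>\<delta> \<in> frames D; h \<in> GL; g \<in> GLd \<delta>; v \<in> W0 \<delta>\<rbrakk>
           \<Longrightarrow> P1 (matrix_inv g **\<^sub>d \<delta>) (\<tau> \<delta> h g v) = matrix_inv g ** P1 \<delta> v"
    and P0_rational: "\<And>i j. uniform_rational D W0 ($) (\<lambda>\<delta> v. P0 \<delta> v $ i $ j)"
    and P1_rational: "\<And>i j. uniform_rational D W0 ($) (\<lambda>\<delta> v. P1 \<delta> v $ i $ j)"
  shows
    "let We = W D;
         K = ratfun_field D We;
         K_G = invariant_ratfuns D W \<tau>;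
         Q = (\<lambda>i j. ratfun_of D We (W0 D) (\<lambda>x. matrix_inv (P1 D x) $ i $ j));
         \<delta> = ratfun_mat_der D We Q;
         y = (\<lambda>k. ratfun_of D We (W0 D) (\<lambda>x. \<tau> D (P0 D x) (P1 D x) x $ k))
     in Ring.field K \<and> subfield K_G K \<and>
        (\<forall>i j. \<forall>f\<in>carrier K. \<delta> i (\<delta> j f) = \<delta> j (\<delta> i f)) \<and>
        (\<forall>i. \<forall>f\<in>K_G. \<delta> i f \<in> K_G) \<and>
        K_G = diff_field_gen K \<delta> (ratfun_consts D We) (range y)"
proof -
  have "good_frame D" using assms(1,2) by (simp add: good_frame_def)
  then interpret equivariant D W W0 \<tau> P0 P1
    by (rule equivariant.intro) (fact W_irreducible \<tau>_maps \<tau>_one \<tau>_mult \<tau>_rational W0_subset W0_dense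
      W0_invariant P_maps P0_equivariant P1_equivariant P0_rational P1_rational)+
  show ?thesis
    unfolding Let_def by (rule invariants_generated)
qed

end
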